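(* Let $m_1,\dots,m_4>0$ and let $q(t)=(q_1(t),\dots,q_4(t))$, $q_a(t)\in\mathbb{R}^3$, be a total collision solution of the Newtonian 4-body problem in $\mathbb{R}^3$ with these masses. If the limiting shape of the solution is planar, then the solution is planar (there is a fixed plane in $\mathbb{R}^3$ containing all four bodies at every instant). If the limiting shape of the solution is collinear, then the solution is collinear (there is a fixed line in $\mathbb{R}^3$ containing all four bodies at every instant).
   Context: Setting ($N$ bodies in $\mathbb{R}^d$; here $N=4$, $d=3$). The masses are $m_1,\dots,m_N>0$. A configuration is $q=(q_1,\dots,q_N)$ with $q_a\in\mathbb{R}^d$ and center of mass at the origin, $\sum_a m_aq_a=0$; the space of these is $\mathbb{E}_0$, with mass inner product $\langle q,y\rangle=\sum_a m_a\,q_a\cdot y_a$ and norm $\|q\|=\sqrt{\langle q,q\rangle}$. Let $U(q)=\sum_{a<b}\frac{m_am_b}{|q_a-q_b|}$ (the negative of the usual potential). Newton's equations are $\ddot q=\nabla U(q)$, the gradient being taken with respect to the mass inner product, i.e. $m_a\ddot q_a=\partial U/\partial q_a$. A solution is a collision-free solution in $\mathbb{E}_0$. Total collision solution: a solution $q:[t_0,T)\to\mathbb{E}_0$, $T<\infty$, with $q(t)\to 0$ as $t\to T^-$. Central configurations and limiting shape: let $\mathbb{S}=\{s\in\mathbb{E}_0:\|s\|=1\}$. A normalized central configuration (CC) is a critical point of the restriction of $U$ to the collision-free part of $\mathbb{S}$. The group $G=SO(d)$ acts on configurations by $gq=(gq_1,\dots,gq_N)$. A total collision solution $q(t)$ has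 limiting shape $s_0$, where $s_0$ is a normalized CC considered up to rotation, if the distance from $q(t)/\|q(t)\|$ to the orbit $Gs_0$ tends to $0$ as $t\to T^-$. It is a known fact that every total collision solution of the 4-body problem in $\mathbb{R}^3$ has a limiting shape. A configuration is called collinear, planar, or spatial if the linear span of $q_1,\dots,q_N$ in $\mathbb{R}^d$ has dimension exactly $1$, $2$, or $3$ respectively; the limiting shape is called collinear, planar or spatial if $s_0$ is. *)

theory Defs
  imports "HOL-Analysis.Analysis"
begin

text \<open>A configuration of bodies indexed by \<open>'n\<close> in \<open>'d\<close>-dimensional Euclidean space; \<open>q $ a\<close> is the position
  of body \<open>a\<close>.\<close>
type_synonym ('d, 'n) config = "real ^ 'd ^ 'n"

definition mass_inner :: "('n::finite \<Rightarrow> real) \<Rightarrow> ('d::finite, 'n) config \<Rightarrow> ('d, 'n) config \<Rightarrow> real"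
  where "mass_inner m q y = (\<Sum>a\<in>UNIV. m a * (q $ a \<bullet> y $ a))"

definition mass_norm :: "('n::finite \<Rightarrow> real) \<Rightarrow> ('d::finite, 'n) config \<Rightarrow> real"
  where "mass_norm m q = sqrt (mass_inner m q q)"

definition centered :: "('n::finite \<Rightarrow> real) \<Rightarrow> ('d::finite, 'n) config set"
  where "centered m = {q. (\<Sum>a\<in>UNIV. m a *\<^sub>R q $ a) = 0}"

definition collision_free :: "('d::finite, 'n::finite) config set"
  where "collision_free = {q. \<forall>a b. a \<noteq> b \<longrightarrow> q $ a \<noteq> q $ b}"

text \<open>The force function is total; at collisions its value is meaningless (division by zero),
  so it is only ever differentiated at points of the open set \<^term>\<open>collision_free\<close>.\<close>
definition force_function :: "('n::{finite,linorder} \<Rightarrow> real) \<Rightarrow> ('d::finite, 'n) config \<Rightarrow> real"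
  where "force_function m q =
    (\<Sum>(a, b)\<in>{(a, b). a < b}. m a * m b / norm (q $ a - q $ b))"

definition has_mass_gradient ::
    "('n::finite \<Rightarrow> real) \<Rightarrow> (('d::finite, 'n) config \<Rightarrow> real) \<Rightarrow> ('d, 'n) config \<Rightarrow> ('d, 'n) config \<Rightarrow> bool"
  where "has_mass_gradient m f q g \<longleftrightarrow> (f has_derivative (\<lambda>h. mass_inner m g h)) (at q)"

text \<open>Derivatives are taken within the half-open interval, hence one-sided at the initial time.\<close>
definition newton_solution ::
    "('n::{finite,linorder} \<Rightarrow> real) \<Rightarrow> real \<Rightarrow> real \<Rightarrow> (real \<Rightarrow> ('d::finite, 'n) config) \<Rightarrow> bool"
  where "newton_solution m t0 T q \<longleftrightarrow>
    (\<forall>t\<in>{t0..<T}. q t \<in> centered m \<inter> collision_free) \<and>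
    (\<exists>v w. \<forall>t\<in>{t0..<T}.
       (q has_vector_derivative v t) (at t within {t0..<T}) \<and>
       (v has_vector_derivative w t) (at t within {t0..<T}) \<and>
       has_mass_gradient m (force_function m) (q t) (w t))"

definition total_collision_solution ::
    "('n::{finite,linorder} \<Rightarrow> real) \<Rightarrow> real \<Rightarrow> real \<Rightarrow> (real \<Rightarrow> ('d::finite, 'n) config) \<Rightarrow> bool"
  where "total_collision_solution m t0 T q \<longleftrightarrow>
    t0 < T \<and> newton_solution m t0 T q \<and> (q \<longlongrightarrow> 0) (at_left T)"

definition mass_sphere :: "('n::finite \<Rightarrow> real) \<Rightarrow> ('d::finite, 'n) config set"
  where "mass_sphere m = {s \<in> centered m. mass_norm m s = 1}"

text \<open>A critical point of the restriction of \<open>f\<close> to \<open>S\<close>: the restriction has differential zero there.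
  For a submanifold \<open>S\<close> this means that \<open>df\<close> vanishes on the tangent space; the lemma
  \<open>normalized_CC_iff_tangent\<close> below spells this out for the sphere.\<close>
definition critical_point_on :: "('a::real_normed_vector \<Rightarrow> real) \<Rightarrow> 'a set \<Rightarrow> 'a \<Rightarrow> bool"
  where "critical_point_on f S x \<longleftrightarrow> x \<in> S \<and> (f has_derivative (\<lambda>_. 0)) (at x within S)"

definition normalized_CC ::
    "('n::{finite,linorder} \<Rightarrow> real) \<Rightarrow> ('d::finite, 'n) config \<Rightarrow> bool"
  where "normalized_CC m s \<longleftrightarrow>
    critical_point_on (force_function m) (mass_sphere m \<inter> collision_free) s"

lemma bilinear_mass_inner: "bounded_bilinear (mass_inner m :: ('d::finite, 'n::finite) config \<Rightarrow> _)"
  unfolding mass_inner_def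
  by (intro bilinear_conv_bounded_bilinear[THEN iffD1])
     (auto simp: bilinear_def linear_iff algebra_simps sum.distrib sum_distrib_left)

lemma force_function_differentiable:
  assumes "(q :: ('d::finite, 'n::{finite,linorder}) config) \<in> collision_free"
  shows "(force_function m) differentiable (at q)"
proof -
  have "(\<lambda>q :: ('d, 'n) config. \<Sum>p\<in>{(a, b). a < b}. m (fst p) * m (snd p) / norm (q $ fst p - q $ snd p)) differentiable (at q)"
  proof (rule differentiable_sum)
    show "finite {(a, b :: 'n). a < b}" by simp
    show "\<forall>p\<in>{(a, b). a < b}. (\<lambda>q :: ('d, 'n) config. m (fst p) * m (snd p) / norm (q $ fst p - q $ snd p)) differentiable (at q)"
    proof
      fix p :: "'n \<times> 'n" assume "p \<in> {(a, b). a < b}"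
      then have ne: "q $ fst p - q $ snd p \<noteq> 0" using assms by (auto simp: collision_free_def)
      have lin: "(\<lambda>q :: ('d, 'n) config. q $ fst p - q $ snd p) differentiable (at q)"
        by (intro differentiable_diff bounded_linear_imp_differentiable bounded_linear_vec_nth)
      have "(norm \<circ> (\<lambda>q :: ('d, 'n) config. q $ fst p - q $ snd p)) differentiable (at q)"
        by (rule differentiable_chain_at[OF lin differentiable_norm_at[OF ne]])
      then show "(\<lambda>q :: ('d, 'n) config. m (fst p) * m (snd p) / norm (q $ fst p - q $ snd p)) differentiable (at q)"
        using ne by (intro differentiable_divide) (auto simp: o_def)
    qed
  qed
  then show ?thesis unfolding force_function_def[abs_def] by (simp add: case_prod_unfold)
qed

lemma open_collision_free: "open (collision_free :: ('d::finite, 'n::finite) config set)"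
proof -
  have "collision_free = (\<Inter>p\<in>{p::'n\<times>'n. fst p \<noteq> snd p}. {q :: ('d, 'n) config. q $ fst p \<noteq> q $ snd p})"
    by (auto simp: collision_free_def)
  moreover have "open (\<Inter>p\<in>{p::'n\<times>'n. fst p \<noteq> snd p}. {q :: ('d, 'n) config. q $ fst p \<noteq> q $ snd p})"
    by (rule open_INT) (auto intro!: open_Collect_neq continuous_intros)
  ultimately show ?thesis by simp
qed

lemma normalized_CC_iff_tangent:
  fixes s :: "('d::finite, 'n::{finite,linorder}) config"
  assumes m: "\<And>a. m a > 0"
  shows "normalized_CC m s \<longleftrightarrow>
    s \<in> mass_sphere m \<inter> collision_free \<and>
    (\<forall>v\<in>centered m. mass_inner m s v = 0 \<longrightarrow> frechet_derivative (force_function m) (at s) v = 0)"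
proof (cases "s \<in> mass_sphere m \<inter> collision_free")
  case False
  then show ?thesis by (auto simp: normalized_CC_def critical_point_on_def)
next
  case s: True
  let ?S = "mass_sphere m \<inter> collision_free :: ('d, 'n) config set"
  let ?U = "force_function m :: ('d, 'n) config \<Rightarrow> real"
  let ?D = "frechet_derivative ?U (at s)"
  have D: "(?U has_derivative ?D) (at s)"
    using force_function_differentiable s by (auto simp: frechet_derivative_works)
  interpret B: bounded_bilinear "mass_inner m :: ('d, 'n) config \<Rightarrow> _" by (rule bilinear_mass_inner)
  interpret D: bounded_linear ?D using D by (rule has_derivative_bounded_linear)
  have sym: "mass_inner m x y = mass_inner m y x" for x y :: "('d, 'n) config"
    by (simp add: mass_inner_def inner_commute)
  have c: "x \<in> centered m \<Longrightarrow> y \<in> centered m \<Longrightarrow> x + y \<in> centered m"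
          "x \<in> centered m \<Longrightarrow> r *\<^sub>R x \<in> centered m" for x y :: "('d, 'n) config" and r
    by (auto simp: centered_def algebra_simps sum.distrib simp flip: scaleR_sum_right)
       (simp add: scaleR_sum_right[symmetric] flip: scaleR_scaleR add: scaleR_left_commute)
  have sp: "x \<in> mass_sphere m \<longleftrightarrow> x \<in> centered m \<and> mass_inner m x x = 1" for x :: "('d, 'n) config"
    by (auto simp: mass_sphere_def mass_norm_def)
  have s1: "mass_inner m s s = 1" "s \<in> centered m" using s sp by auto
  have "(?U has_derivative (\<lambda>_. 0)) (at s within ?S) \<longleftrightarrow>
     (\<forall>v\<in>centered m. mass_inner m s v = 0 \<longrightarrow> ?D v = 0)" (is "?L \<longleftrightarrow> ?R")
  proof
    assume L: ?L
    show ?R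
    proof (intro ballI impI)
      fix v assume v: "v \<in> centered m" "mass_inner m s v = 0"
      define b where "b = mass_inner m v v"
      have b: "b \<ge> 0" unfolding b_def mass_inner_def using m
        by (intro sum_nonneg mult_nonneg_nonneg) (auto intro: less_imp_le)
      define g where "g = (\<lambda>t::real. (1 / sqrt (1 + t^2 * b)) *\<^sub>R (s + t *\<^sub>R v))"
      have pos: "1 + t^2 * b > 0" for t using b by (simp add: add_pos_nonneg)
      have g0: "g 0 = s" by (simp add: g_def)
      have dg: "(g has_vector_derivative v) (at 0)"
        unfolding g_def has_vector_derivative_def
        by (auto intro!: derivative_eq_intros)
      have gs: "g t \<in> mass_sphere m" for t
      proof -
        have "mass_inner m (s + t *\<^sub>R v) (s + t *\<^sub>R v) = 1 + t^2 * b"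
          using v s1 by (simp add: B.add_left B.add_right B.scaleR_left B.scaleR_right sym[of v s] b_def power2_eq_square)
        then have "mass_inner m (g t) (g t) = 1"
          using pos[of t] by (simp add: g_def B.scaleR_left B.scaleR_right)
        moreover have "g t \<in> centered m" unfolding g_def by (intro c s1 v)
        ultimately show ?thesis by (simp add: sp)
      qed
      have cg: "(g \<longlongrightarrow> s) (at 0)"
        using has_vector_derivative_continuous[OF dg] g0 by (simp add: continuous_within)
      have "eventually (\<lambda>t. g t \<in> collision_free) (at 0)"
        using topological_tendstoD[OF cg open_collision_free] s by auto
      then obtain d where d: "d > 0" "\<And>t. dist t 0 < d \<Longrightarrow> g t \<in> collision_free"
        using s g0 by (auto simp: eventually_at) (metis dist_self)
      let ?I = "ball (0::real) d"
      have im: "g ` ?I \<subseteq> ?S" using gs d by (auto simp: dist_commute)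
      have dgI: "(g has_derivative (\<lambda>h. h *\<^sub>R v)) (at 0 within ?I)"
        using dg unfolding has_vector_derivative_def by (rule has_derivative_at_withinI)
      have "(?U has_derivative (\<lambda>_. 0)) (at (g 0) within g ` ?I)"
        using has_derivative_subset[OF L im] g0 by simp
      from has_derivative_in_compose[OF dgI this]
      have 1: "((\<lambda>t. ?U (g t)) has_derivative (\<lambda>_. 0)) (at 0)"
        using d at_within_open[of 0 ?I] by simp
      have "((\<lambda>t. ?U (g t)) has_derivative (\<lambda>h. ?D (h *\<^sub>R v))) (at 0)"
        using dg D g0 unfolding has_vector_derivative_def
        by (intro has_derivative_compose[of g _ _ _ ?U]) auto
      from has_derivative_unique[OF this 1] have "?D (1 *\<^sub>R v) = 0" by (rule fun_cong)
      then show "?D v = 0" by simp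
    qed
  next
    assume R: ?R
    obtain K where K: "K > 0" "\<And>x y. norm (mass_inner m x y) \<le> norm x * norm (y :: ('d, 'n) config) * K"
      using B.pos_bounded by blast
    have est: "?D (y - s) = - (mass_inner m (y - s) (y - s) / 2) * ?D s" if y: "y \<in> ?S" for y
    proof -
      let ?h = "y - s" and ?k = "mass_inner m s (y - s)"
      have y1: "mass_inner m y y = 1" "y \<in> centered m" using y sp by auto
      have "y + (-1) *\<^sub>R s + (- ?k) *\<^sub>R s \<in> centered m" by (intro c y1 s1)
      then have "?h - ?k *\<^sub>R s \<in> centered m" by (simp add: algebra_simps)
      moreover have "mass_inner m s (?h - ?k *\<^sub>R s) = 0"
        using s1 by (simp add: B.diff_right B.scaleR_right)
      ultimately have "?D (?h - ?k *\<^sub>R s) = 0" using R by blast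
      then have "?D ?h = ?k * ?D s" by (simp add: D.diff D.scaleR)
      moreover have "?k = - (mass_inner m ?h ?h / 2)"
        using y1 s1 by (simp add: B.diff_right B.diff_left sym[of y s] field_simps)
      ultimately show ?thesis by simp
    qed
    have lim: "((\<lambda>y. (?U y - ?U s - ?D (y - s)) /\<^sub>R norm (y - s)) \<longlongrightarrow> 0) (at s within ?S)"
      using has_derivative_at_withinI[OF D, of ?S] unfolding has_derivative_at_within by blast
    have lim2: "((\<lambda>y. ?D (y - s) /\<^sub>R norm (y - s)) \<longlongrightarrow> 0) (at s within ?S)"
    proof (rule Lim_null_comparison)
      show "eventually (\<lambda>y. norm (?D (y - s) /\<^sub>R norm (y - s)) \<le> K * \<bar>?D s\<bar> * norm (y - s)) (at s within ?S)"
        unfolding eventually_at_filter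
      proof (intro always_eventually allI impI)
        fix y assume y: "y \<noteq> s" "y \<in> ?S"
        have "\<bar>?D (y - s)\<bar> = \<bar>mass_inner m (y - s) (y - s)\<bar> / 2 * \<bar>?D s\<bar>"
          unfolding est[OF y(2)] by (simp add: abs_mult)
        also have "\<dots> \<le> (norm (y - s) * norm (y - s) * K) * \<bar>?D s\<bar>"
          using K(2)[of "y - s" "y - s"] by (intro mult_right_mono) auto
        finally show "norm (?D (y - s) /\<^sub>R norm (y - s)) \<le> K * \<bar>?D s\<bar> * norm (y - s)"
          using y by (simp add: field_simps)
      qed
      have "((\<lambda>y. K * \<bar>?D s\<bar> * norm (y - s)) \<longlongrightarrow> K * \<bar>?D s\<bar> * norm (s - s)) (at s within ?S)"
        by (intro tendsto_intros)
      then show "((\<lambda>y. K * \<bar>?D s\<bar> * norm (y - s)) \<longlongrightarrow> 0) (at s within ?S)" by simp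
    qed
    show ?L
      using tendsto_add[OF lim lim2]
      by (simp add: has_derivative_at_within algebra_simps)
  qed
  then show ?thesis using s by (auto simp: normalized_CC_def critical_point_on_def)
qed

definition rotation_orbit :: "('d::finite, 'n::finite) config \<Rightarrow> ('d, 'n) config set"
  where "rotation_orbit s = {\<chi> a. R *v (s $ a) |R. rotation_matrix R}"

definition mass_infdist ::
    "('n::finite \<Rightarrow> real) \<Rightarrow> ('d::finite, 'n) config \<Rightarrow> ('d, 'n) config set \<Rightarrow> real"
  where "mass_infdist m q A = (INF y\<in>A. mass_norm m (q - y))"

definition limiting_shape ::
    "('n::{finite,linorder} \<Rightarrow> real) \<Rightarrow> real \<Rightarrow> (real \<Rightarrow> ('d::finite, 'n) config) \<Rightarrow> ('d, 'n) config \<Rightarrow> bool"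
  where "limiting_shape m T q s \<longleftrightarrow>
    normalized_CC m s \<and>
    ((\<lambda>t. mass_infdist m (q t /\<^sub>R mass_norm m (q t)) (rotation_orbit s)) \<longlongrightarrow> 0) (at_left T)"

definition config_dim :: "('d::finite, 'n::finite) config \<Rightarrow> nat"
  where "config_dim q = dim (span (range (\<lambda>a. q $ a)))"

definition collinear_config :: "('d::finite, 'n::finite) config \<Rightarrow> bool"
  where "collinear_config q \<longleftrightarrow> config_dim q = 1"

definition planar_config :: "('d::finite, 'n::finite) config \<Rightarrow> bool"
  where "planar_config q \<longleftrightarrow> config_dim q = 2"

text \<open>One affine plane (line) contains all bodies at all times; it may depend on the solution but
  not on \<open>t\<close>.\<close>
definition planar_solution :: "real \<Rightarrow> real \<Rightarrow> (real \<Rightarrow> ('d::finite, 'n::finite) config) \<Rightarrow> bool"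
  where "planar_solution t0 T q \<longleftrightarrow>
    (\<exists>P. affine P \<and> aff_dim P = 2 \<and> (\<forall>t\<in>{t0..<T}. \<forall>a. q t $ a \<in> P))"

definition collinear_solution :: "real \<Rightarrow> real \<Rightarrow> (real \<Rightarrow> ('d::finite, 'n::finite) config) \<Rightarrow> bool"
  where "collinear_solution t0 T q \<longleftrightarrow>
    (\<exists>L. affine L \<and> aff_dim L = 1 \<and> (\<forall>t\<in>{t0..<T}. \<forall>a. q t $ a \<in> L))"

end

theory Submission
  imports Defs
begin

text \<open>For \<open>c\<close> in \<open>\<real>\<^sup>d\<close> put \<open>x\<^sub>c(t)\<^sub>a = sqrt m\<^sub>a (q\<^sub>a(t) \<bullet> c)\<close>. Every \<open>x\<^sub>c\<close> solves one and the same linear equation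
  \<open>x'' = - S(t) x\<close>, where \<open>S(t)\<close> depends only on the mutual distances. These are insensitive to rotation, so
  \<open>(T - t)\<^sup>2 S(t)\<close> converges to \<open>2/(9 \<mu>) L\<close>, where \<open>L\<close> is the Laplacian of the limiting shape and
  \<open>\<mu> = U(s\<^sub>0)\<close>, whether or not the solution spins. On the coordinate functions of \<open>s\<^sub>0\<close>, a space \<open>P\<close> of
  dimension \<open>k\<close> equal to that of the shape, \<open>L\<close> equals \<open>\<mu>\<close> and the exponents at the collision are \<open>1/3\<close> and
  \<open>2/3\<close>; on the complement \<open>L > \<mu>\<close> (Conley for collinear shapes, Dziobek's relations for planar ones) and
  the exponents have real part below \<open>2/3\<close>. Hence the solutions of size \<open>O((T - t)\<^sup>2\<^sup>/\<^sup>3)\<close> form a space of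
  dimension at most \<open>k\<close>. All \<open>x\<^sub>c\<close> are of this size, so \<open>x\<^sub>c = 0\<close> for all \<open>c\<close> in a fixed subspace of
  codimension at most \<open>k\<close>, whose orthogonal complement contains all bodies at all times.\<close>

subsection \<open>Solutions of a perturbed Euler equation\<close>

text \<open>The obstacle is that a limiting shape gives convergence of the mutual distances without
  any rate. The exponent 2/3 lies exactly on the border of the admissible size, where an error o(1)
  of unknown rate could shift it, so solutions are not expanded asymptotically. Comparing growth
  through an indefinite quadratic form only needs an error below a fixed small multiple of x. The
  factor 2/(9 \<mu>) comes from the size r of the configuration: r^3 is asymptotic to (9/2) \<mu> (T
  - t)^2, and inverse cubes of distances scale like 1/r^3. On an eigenvector of L with eigenvalue
  \<lambda>, (T - t)^\<rho> solves the limiting equation if \<rho> (1 - \<rho>) = 2 \<lambda> / (9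
  \<mu>). For \<lambda> = \<mu> this gives 1/3 and 2/3; for \<lambda> > \<mu> both roots lie
  strictly between these or are complex with real part 1/2. The count is made at one time t1 near T:
  k linear conditions on c force x_c and its derivative to vanish there, and uniqueness for the
  linear equation carries this to all times.\<close>

lemma nondecreasing_within:
  fixes f :: "real \<Rightarrow> real"
  assumes "a \<le> b"
    and d: "\<And>t. t \<in> {a..b} \<Longrightarrow> (f has_real_derivative f' t) (at t within {a..b})"
    and nn: "\<And>t. t \<in> {a..b} \<Longrightarrow> f' t \<ge> 0"
  shows "f a \<le> f b"
proof (rule DERIV_nonneg_imp_increasing_open[OF \<open>a \<le> b\<close>])
  show "\<exists>y. (f has_real_derivative y) (at t) \<and> 0 \<le> y" if "a < t" "t < b" for t
    using d[of t] nn[of t] that at_within_Icc_at[of a t b] by auto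
  show "continuous_on {a..b} f"
    using d by (rule DERIV_continuous_on)
qed

text \<open>Gronwall's inequality in both time directions: the energy \<open>g\<close> satisfies
  \<open>\<bar>g' t\<bar> \<le> D * g t\<close>, so \<open>exp (D * t) * g t\<close> cannot decrease
  and \<open>exp (- D * t) * g t\<close> cannot increase. A zero of \<open>g\<close> at
  \<open>s\<close> therefore spreads to both sides.\<close>

lemma second_order_zero_unique:
  fixes x v w :: "real \<Rightarrow> 'a::real_inner"
  assumes dx: "\<And>t. t \<in> {a..b} \<Longrightarrow> (x has_vector_derivative v t) (at t within {a..b})"
    and dv: "\<And>t. t \<in> {a..b} \<Longrightarrow> (v has_vector_derivative w t) (at t within {a..b})"
    and w: "\<And>t. t \<in> {a..b} \<Longrightarrow> norm (w t) \<le> C * norm (x t)"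
    and s: "s \<in> {a..b}" "x s = 0" "v s = 0" and t: "t \<in> {a..b}"
  shows "x t = 0"
proof -
  define g where "g = (\<lambda>t. x t \<bullet> x t + v t \<bullet> v t)"
  define g' where "g' = (\<lambda>t. 2 * (x t \<bullet> v t) + 2 * (v t \<bullet> w t))"
  define D where "D = 1 + \<bar>C\<bar>"
  have g0: "g t \<ge> 0" for t by (simp add: g_def)
  have dg: "(g has_real_derivative g' t) (at t within {a..b})" if "t \<in> {a..b}" for t
    using dx[OF that] dv[OF that]
    unfolding g_def g'_def has_vector_derivative_def has_field_derivative_def
    by (auto intro!: derivative_eq_intros simp: inner_commute algebra_simps)
  have bd: "\<bar>g' t\<bar> \<le> D * g t" if "t \<in> {a..b}" for t
  proof -
    have "norm (w t) \<le> \<bar>C\<bar> * norm (x t)"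
      using w[OF that] abs_ge_self[of C] by (meson mult_right_mono norm_ge_zero order_trans)
    then have "norm (v t) * norm (w t) \<le> norm (v t) * (\<bar>C\<bar> * norm (x t))"
      by (rule mult_left_mono) simp
    moreover have "\<bar>x t \<bullet> v t\<bar> \<le> norm (x t) * norm (v t)" "\<bar>v t \<bullet> w t\<bar> \<le> norm (v t) * norm (w t)"
      by (rule Cauchy_Schwarz_ineq2)+
    ultimately have "\<bar>g' t\<bar> \<le> D * (2 * norm (x t) * norm (v t))"
      unfolding g'_def D_def by (simp add: algebra_simps abs_le_iff)
    also have "\<dots> \<le> D * g t"
      using sum_squares_bound[of "norm (x t)" "norm (v t)"]
      unfolding D_def g_def power2_norm_eq_inner by (intro mult_left_mono) auto
    finally show ?thesis .
  qed
  have mono: "exp (k * p) * g p \<le> exp (k * r) * g r"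
    if "a \<le> p" "p \<le> r" "r \<le> b" "k = D" for p r k
  proof (rule nondecreasing_within[where f = "\<lambda>t. exp (k * t) * g t" and f' = "\<lambda>t. exp (k * t) * (k * g t + g' t)"])
    fix t assume t: "t \<in> {p..r}"
    then have "(g has_real_derivative g' t) (at t within {p..r})"
      using DERIV_subset[OF dg, of t "{p..r}"] that by auto
    then show "((\<lambda>t. exp (k * t) * g t) has_real_derivative exp (k * t) * (k * g t + g' t)) (at t within {p..r})"
      by (auto intro!: derivative_eq_intros simp: algebra_simps)
    show "0 \<le> exp (k * t) * (k * g t + g' t)"
      using bd[of t] t that by (auto simp: abs_le_iff)
  qed (use that in auto)
  have mono': "- (exp (- D * p) * g p) \<le> - (exp (- D * r) * g r)"
    if "a \<le> p" "p \<le> r" "r \<le> b" for p r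
  proof (rule nondecreasing_within[where f = "\<lambda>t. - (exp (- D * t) * g t)" and f' = "\<lambda>t. exp (- D * t) * (D * g t - g' t)"])
    fix t assume t: "t \<in> {p..r}"
    then have "(g has_real_derivative g' t) (at t within {p..r})"
      using DERIV_subset[OF dg, of t "{p..r}"] that by auto
    then show "((\<lambda>t. - (exp (- D * t) * g t)) has_real_derivative exp (- D * t) * (D * g t - g' t)) (at t within {p..r})"
      by (auto intro!: derivative_eq_intros simp: algebra_simps)
    show "0 \<le> exp (- D * t) * (D * g t - g' t)"
      using bd[of t] t that by (auto simp: abs_le_iff)
  qed (use that in auto)
  have "g s = 0" by (simp add: g_def s)
  then have "g t \<le> 0"
    using mono[of t s D] mono'[of s t] s t
    by (cases "t \<le> s") (auto simp: mult_le_0_iff)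
  then show "x t = 0"
    unfolding g_def by (metis add_nonneg_eq_0_iff inner_eq_zero_iff inner_ge_zero antisym add_nonneg_nonneg)
qed

text \<open>In the time \<open>- ln (T - t)\<close> and after rescaling, the linearised equation reads
  \<open>y' = z\<close>, \<open>z' = z / 3 - B y + d\<close>. Where \<open>B\<close> vanishes, \<open>y - 3 z\<close> is conserved up to \<open>d\<close> and \<open>z\<close> expands;
  where \<open>B \<ge> \<beta>\<close>, both \<open>y\<close> and \<open>z\<close> expand. The form \<open>W\<close> is positive on the expanding directions and
  negative on the conserved ones.\<close>
lemma growth_form:
  fixes \<pi> B :: "'a::real_inner \<Rightarrow> 'a" and y z :: 'a
  assumes beta: "\<beta> > 0"
    and \<pi>: "linear \<pi>" "\<And>x y. \<pi> x \<bullet> y = x \<bullet> \<pi> y" "\<And>x. \<pi> (\<pi> x) = \<pi> x"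
    and B: "linear B" "\<And>x y. B x \<bullet> y = x \<bullet> B y" "\<And>x. B (\<pi> x) = 0"
    and \<epsilon>: "0 < \<epsilon>" "\<epsilon> \<le> 1/12" "\<epsilon> \<le> \<beta>"
    and gap: "\<beta> * (norm (y - \<pi> y))\<^sup>2 \<le> B y \<bullet> y"
  defines "W \<equiv> z \<bullet> z + B y \<bullet> y - \<epsilon> * ((y - \<pi> y) \<bullet> z) - (\<pi> y - 3 *\<^sub>R \<pi> z) \<bullet> (\<pi> y - 3 *\<^sub>R \<pi> z)"
  shows growth_form_definite: "\<pi> y = 3 *\<^sub>R \<pi> z \<Longrightarrow> W \<le> 0 \<Longrightarrow> y = 0 \<and> z = 0"
    and growth_form_expands: "240 * \<delta> \<le> \<epsilon> / 36 \<Longrightarrow> 240 * \<delta> \<le> \<epsilon> * \<beta> / 2 \<Longrightarrow> norm d \<le> \<delta> * norm y \<Longrightarrow>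
      \<epsilon> / 18 * W \<le> 2 * (z \<bullet> ((1/3) *\<^sub>R z - B y + d)) + 2 * (B y \<bullet> z)
         - \<epsilon> * ((z - \<pi> z) \<bullet> z + (y - \<pi> y) \<bullet> ((1/3) *\<^sub>R z - B y + d))
         - 2 * ((\<pi> y - 3 *\<^sub>R \<pi> z) \<bullet> (\<pi> z - 3 *\<^sub>R \<pi> ((1/3) *\<^sub>R z - B y + d)))"
proof -
  interpret P: linear \<pi> by fact
  interpret L: linear B by fact
  define n where "n = y - \<pi> y"
  have ez: "\<epsilon> * (n \<bullet> z) \<le> \<epsilon> * ((norm n)\<^sup>2 / 2 + (norm z)\<^sup>2 / 2)"
    using Cauchy_Schwarz_ineq2[of n z] sum_squares_bound[of "norm n" "norm z"] \<epsilon>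
    by (intro mult_left_mono) (auto simp: abs_le_iff)
  show "y = 0 \<and> z = 0" if "\<pi> y = 3 *\<^sub>R \<pi> z" "W \<le> 0"
  proof -
    have "(norm z)\<^sup>2 + \<beta> * (norm n)\<^sup>2 \<le> \<epsilon> * ((norm n)\<^sup>2 / 2 + (norm z)\<^sup>2 / 2)"
      using that ez gap unfolding W_def n_def power2_norm_eq_inner by simp
    also have "\<dots> \<le> \<beta> * ((norm n)\<^sup>2 / 2) + 1/2 * ((norm z)\<^sup>2 / 2)"
      unfolding distrib_left using \<epsilon> by (intro add_mono mult_right_mono) auto
    finally have 1: "(norm z)\<^sup>2 + \<beta> * (norm n)\<^sup>2 \<le> \<beta> * ((norm n)\<^sup>2 / 2) + 1/2 * ((norm z)\<^sup>2 / 2)" .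
    have "(norm z)\<^sup>2 \<ge> 0" "\<beta> * (norm n)\<^sup>2 \<ge> 0" using beta by simp_all
    with 1 have "(norm z)\<^sup>2 = 0" "\<beta> * (norm n)\<^sup>2 = 0" by linarith+
    then show ?thesis using that beta by (auto simp: n_def P.zero)
  qed
  assume \<delta>: "240 * \<delta> \<le> \<epsilon> / 36" "240 * \<delta> \<le> \<epsilon> * \<beta> / 2" and d: "norm d \<le> \<delta> * norm y"
  have \<pi>B: "\<pi> (B x) = 0" for x
  proof -
    have "\<pi> (B x) \<bullet> w = 0" for w using \<pi>(2) B(2)[of x "\<pi> w"] B(3) by simp
    then show ?thesis by (metis inner_eq_zero_iff)
  qed
  define b where "b = B y \<bullet> y"
  define u where "u = \<pi> y - 3 *\<^sub>R \<pi> z"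
  have pd: "u \<bullet> \<pi> d = u \<bullet> d" using \<pi> unfolding u_def by (simp add: P.diff P.scale inner_diff_left)
  have nB: "n \<bullet> B y = b"
  proof -
    have "\<pi> y \<bullet> B y = 0" using B(2)[of "\<pi> y" y] B(3)[of y] by simp
    then show ?thesis unfolding n_def b_def inner_diff_left by (simp add: inner_commute[of y])
  qed
  have zz: "(z - \<pi> z) \<bullet> z \<le> (norm z)\<^sup>2"
  proof -
    have "\<pi> z \<bullet> z = \<pi> z \<bullet> \<pi> z" using \<pi> by (metis inner_commute)
    then show ?thesis by (simp add: inner_diff_left power2_norm_eq_inner)
  qed
  \<comment> \<open>The terms in \<open>B y\<close> cancel from the derivative of
    \<open>z \<bullet> z + B y \<bullet> y\<close>, leaving 2/3 of the square of
    \<open>norm z\<close>. The cross term with factor \<open>\<epsilon>\<close> contributes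
    \<open>\<epsilon> * b\<close>, which is the growth off the range of \<open>\<pi>\<close>. Since
    \<open>u\<close> is conserved up to \<open>d\<close>, its square contributes only
    \<open>6 * (u \<bullet> d)\<close>.\<close>
  have rhs: "2 * (z \<bullet> ((1/3) *\<^sub>R z - B y + d)) + 2 * (B y \<bullet> z)
         - \<epsilon> * ((z - \<pi> z) \<bullet> z + (y - \<pi> y) \<bullet> ((1/3) *\<^sub>R z - B y + d))
         - 2 * ((\<pi> y - 3 *\<^sub>R \<pi> z) \<bullet> (\<pi> z - 3 *\<^sub>R \<pi> ((1/3) *\<^sub>R z - B y + d)))
     = 2/3 * (norm z)\<^sup>2 + 2 * (z \<bullet> d) - \<epsilon> * ((z - \<pi> z) \<bullet> z) - \<epsilon> / 3 * (n \<bullet> z) + \<epsilon> * b - \<epsilon> * (n \<bullet> d)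
       + 6 * (u \<bullet> d)"
    unfolding n_def[symmetric] u_def[symmetric] pd[symmetric] nB[symmetric]
    by (simp add: inner_add_right inner_diff_right P.add P.diff P.scale \<pi>B power2_norm_eq_inner inner_commute[of "B y"] algebra_simps)
  define Y Z N where "Y = norm (\<pi> y)" and "Z = norm z" and "N = norm n"
  have pos: "Y \<ge> 0" "Z \<ge> 0" "N \<ge> 0" by (simp_all add: Y_def Z_def N_def)
  have piz: "norm (\<pi> z) \<le> Z"
  proof (cases "\<pi> z = 0")
    case False
    have "norm (\<pi> z) * norm (\<pi> z) = \<pi> z \<bullet> z" using \<pi> by (metis inner_commute norm_eq_square power2_eq_square power2_norm_eq_inner)
    also have "\<dots> \<le> norm (\<pi> z) * Z" unfolding Z_def by (rule norm_cauchy_schwarz)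
    finally show ?thesis using False by simp
  qed (simp add: Z_def)
  have u1: "norm u \<le> Y + 3 * Z"
    unfolding u_def Y_def using norm_triangle_ineq4[of "\<pi> y" "3 *\<^sub>R \<pi> z"] piz by simp
  \<comment> \<open>The derivative of the form does not dominate the neutral part
    \<open>\<pi> y\<close>, although \<open>d\<close> may be proportional to it. The term
    \<open>- \<epsilon> / 18 * (u \<bullet> u)\<close> on the smaller side of the inequality
    provides the missing room, namely \<open>\<epsilon> / 36 * Y\<^sup>2\<close>.\<close>
  have u2: "u \<bullet> u \<ge> Y\<^sup>2 / 2 - 9 * Z\<^sup>2"
  proof -
    have "Y \<le> norm u + 3 * Z"
      unfolding u_def Y_def using norm_triangle_sub[of "\<pi> y" "3 *\<^sub>R \<pi> z"] piz by simp
    then have "Y\<^sup>2 \<le> (norm u + 3 * Z)\<^sup>2" using pos by (simp add: power_mono)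
    also have "\<dots> \<le> 2 * (norm u)\<^sup>2 + 2 * (3 * Z)\<^sup>2"
      using sum_squares_bound[of "norm u" "3 * Z"] by (simp add: power2_sum)
    finally show ?thesis by (simp add: power2_norm_eq_inner[symmetric] power_mult_distrib)
  qed
  \<comment> \<open>For negative \<open>\<delta>\<close> the bound on \<open>d\<close> forces
    \<open>y = 0\<close>, hence \<open>d = 0\<close>.\<close>
  have dn: "norm d \<le> \<delta> * (Y + N)"
  proof (cases "\<delta> \<ge> 0")
    case True
    have "norm y \<le> Y + N" unfolding Y_def N_def n_def using norm_triangle_ineq[of "\<pi> y" "y - \<pi> y"] by simp
    then show ?thesis using d True by (meson mult_left_mono order_trans)
  next
    case False
    then have "norm y = 0" using d by (smt (verit) norm_ge_zero mult_neg_pos)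
    then show ?thesis using d by (simp add: Y_def N_def n_def P.zero)
  qed
  have nd: "norm d \<ge> 0" by simp
  have t1: "z \<bullet> d \<ge> - (Z * norm d)" unfolding Z_def using Cauchy_Schwarz_ineq2[of z d] by linarith
  have t2: "n \<bullet> d \<le> N * norm d" unfolding N_def by (rule norm_cauchy_schwarz)
  have t3: "u \<bullet> d \<ge> - ((Y + 3 * Z) * norm d)"
    using Cauchy_Schwarz_ineq2[of u d] mult_right_mono[OF u1 nd] by linarith
  have t4: "\<bar>n \<bullet> z\<bar> \<le> N * Z" unfolding N_def Z_def by (rule Cauchy_Schwarz_ineq2)
  have t2': "\<epsilon> * (n \<bullet> d) \<le> N * norm d"
  proof -
    have "\<epsilon> * (n \<bullet> d) \<le> \<epsilon> * (N * norm d)" using t2 \<epsilon> by simp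
    also have "\<dots> \<le> 1 * (N * norm d)" using \<epsilon> pos by (intro mult_right_mono) auto
    finally show ?thesis by simp
  qed
  have zz': "\<epsilon> * ((z - \<pi> z) \<bullet> z) \<le> \<epsilon> * Z\<^sup>2" using zz \<epsilon> by (simp add: Z_def)
  have bN: "\<beta> * N\<^sup>2 \<le> b" using gap by (simp add: b_def N_def n_def)
  \<comment> \<open>All contributions of \<open>d\<close> together: the coefficients add up to 6 for
    \<open>Y\<close>, 1 for \<open>N\<close> and 2 + 18 = 20 for \<open>Z\<close>. Bounding the
    resulting quadratic form costs another factor 3, whence the multiple 60 of
    \<open>\<delta>\<close> below.\<close>
  define e where "e = 20 * norm d * (Y + N + Z)"
  have e1: "2 * (Z * norm d) + N * norm d + 6 * ((Y + 3 * Z) * norm d) \<le> e"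
    using pos nd mult_nonneg_nonneg[OF pos(1) nd] mult_nonneg_nonneg[OF pos(3) nd]
    unfolding e_def by (simp add: algebra_simps)
  have e2: "e \<le> \<epsilon> / 36 * Y\<^sup>2 / 2 + \<epsilon> * \<beta> / 4 * N\<^sup>2 + Z\<^sup>2 / 16"
  proof -
    have "e \<le> 20 * (\<delta> * (Y + N)) * (Y + N + Z)"
      unfolding e_def using dn pos by (intro mult_right_mono mult_left_mono) auto
    also have "\<dots> = \<delta> * (20 * ((Y + N) * (Y + N + Z)))" by simp
    finally have e: "e \<le> \<delta> * (20 * ((Y + N) * (Y + N + Z)))" .
    show ?thesis
    proof (cases "\<delta> \<ge> 0")
      case True
      have "\<delta> * (20 * ((Y + N) * (Y + N + Z))) \<le> \<delta> * (60 * (Y\<^sup>2 + N\<^sup>2 + Z\<^sup>2))"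
        unfolding power2_eq_square
      proof (rule mult_left_mono[OF _ True])
        have "0 \<le> (Y - N)\<^sup>2" "0 \<le> (Y - Z)\<^sup>2" "0 \<le> (N - Z)\<^sup>2" by simp_all
        then show "20 * ((Y + N) * (Y + N + Z)) \<le> 60 * (Y * Y + N * N + Z * Z)"
          using zero_le_square[of Y] zero_le_square[of N] zero_le_square[of Z]
          unfolding power2_eq_square distrib_left distrib_right left_diff_distrib right_diff_distrib
            mult.commute[of N Y] mult.commute[of Z Y] mult.commute[of Z N]
          by linarith
      qed
      also have "\<dots> = (60 * \<delta>) * Y\<^sup>2 + (60 * \<delta>) * N\<^sup>2 + (60 * \<delta>) * Z\<^sup>2"
        by (simp add: algebra_simps)
      also have "\<dots> \<le> (\<epsilon> / 72) * Y\<^sup>2 + (\<epsilon> * \<beta> / 4) * N\<^sup>2 + 1/16 * Z\<^sup>2"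
        using \<delta> \<epsilon> mult_pos_pos[OF \<epsilon>(1) beta] by (intro add_mono mult_right_mono) (linarith | simp)+
      finally show ?thesis using e by simp
    next
      case False
      then have "\<delta> * (20 * ((Y + N) * (Y + N + Z))) \<le> 0"
        using pos by (intro mult_nonpos_nonneg) auto
      also have "0 \<le> \<epsilon> / 36 * Y\<^sup>2 / 2 + \<epsilon> * \<beta> / 4 * N\<^sup>2 + Z\<^sup>2 / 16"
        using \<epsilon> beta by simp
      finally show ?thesis using e by simp
    qed
  qed
  have cross: "(\<epsilon> / 3 + \<epsilon> * \<epsilon> / 18) * (N * Z) \<le> \<epsilon> * \<beta> / 4 * N\<^sup>2 + Z\<^sup>2 / 4"
  proof -
    have "(\<epsilon> / 3 + \<epsilon> * \<epsilon> / 18) * (N * Z) \<le> \<epsilon> / 2 * (N * Z)"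
    proof (rule mult_right_mono)
      have "\<epsilon> * \<epsilon> \<le> \<epsilon> * 1" using \<epsilon> by (intro mult_left_mono) auto
      then show "\<epsilon> / 3 + \<epsilon> * \<epsilon> / 18 \<le> \<epsilon> / 2" using \<epsilon>(1) by linarith
    qed (use pos in simp)
    also have "\<dots> \<le> \<epsilon> * \<epsilon> / 4 * N\<^sup>2 + Z\<^sup>2 / 4"
      using sum_squares_bound[of "\<epsilon> * N" Z] by (simp add: power2_eq_square algebra_simps)
    also have "\<dots> \<le> \<epsilon> * \<beta> / 4 * N\<^sup>2 + Z\<^sup>2 / 4"
      using \<epsilon> by (intro add_right_mono mult_right_mono) auto
    finally show ?thesis .
  qed
  show "\<epsilon> / 18 * W \<le> 2 * (z \<bullet> ((1/3) *\<^sub>R z - B y + d)) + 2 * (B y \<bullet> z)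
         - \<epsilon> * ((z - \<pi> z) \<bullet> z + (y - \<pi> y) \<bullet> ((1/3) *\<^sub>R z - B y + d))
         - 2 * ((\<pi> y - 3 *\<^sub>R \<pi> z) \<bullet> (\<pi> z - 3 *\<^sub>R \<pi> ((1/3) *\<^sub>R z - B y + d)))"
  proof -
    \<comment> \<open>The budget: 2/3 of \<open>Z\<^sup>2\<close>, 17/18 of \<open>Bb\<close> and
      1/36 of \<open>C2\<close> must pay for the perturbation \<open>e\<close>, for 28/18 of
      \<open>A2\<close>, and for the mixed terms \<open>E1\<close> and \<open>E2\<close>. With the
      products named as atoms the balance is linear.\<close>
    define A2 Bb C2 E1 E2 N2 where "A2 = \<epsilon> * Z\<^sup>2" and "Bb = \<epsilon> * b" and "C2 = \<epsilon> * Y\<^sup>2"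
      and "E1 = \<epsilon> * (n \<bullet> z)" and "E2 = \<epsilon> * (\<epsilon> * (n \<bullet> z))" and "N2 = \<epsilon> * (\<beta> * N\<^sup>2)"
    note defs = A2_def Bb_def C2_def E1_def E2_def N2_def
    have "\<epsilon> / 18 * (z \<bullet> z + b - \<epsilon> * (n \<bullet> z) - u \<bullet> u)
        \<le> \<epsilon> / 18 * (Z\<^sup>2 + b - \<epsilon> * (n \<bullet> z) - (Y\<^sup>2 / 2 - 9 * Z\<^sup>2))"
      using u2 \<epsilon> by (intro mult_left_mono) (auto simp: Z_def power2_norm_eq_inner)
    also have "\<dots> = (10 / 18) * A2 + Bb / 18 - E2 / 18 - C2 / 36"
      unfolding defs by (simp add: field_simps)
    finally have h1: "\<epsilon> / 18 * (z \<bullet> z + b - \<epsilon> * (n \<bullet> z) - u \<bullet> u) \<le> \<dots>" .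
    have "E1 / 3 - E2 / 18 = (\<epsilon> / 3 - \<epsilon> * \<epsilon> / 18) * (n \<bullet> z)"
      unfolding defs by (simp add: algebra_simps)
    also have "\<dots> \<le> (\<epsilon> / 3 - \<epsilon> * \<epsilon> / 18) * \<bar>n \<bullet> z\<bar>"
    proof (rule mult_left_mono)
      have "\<epsilon> * \<epsilon> \<le> \<epsilon> * 6" using \<epsilon> by (intro mult_left_mono) auto
      then show "0 \<le> \<epsilon> / 3 - \<epsilon> * \<epsilon> / 18" by simp
    qed simp
    also have "\<dots> \<le> (\<epsilon> / 3 + \<epsilon> * \<epsilon> / 18) * (N * Z)"
      using t4 \<epsilon> pos by (intro mult_mono) auto
    also have "\<dots> \<le> N2 / 4 + Z\<^sup>2 / 4" using cross unfolding defs by simp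
    finally have h2: "E1 / 3 - E2 / 18 \<le> N2 / 4 + Z\<^sup>2 / 4" .
    have h3: "N2 \<le> Bb" "0 \<le> N2" using bN \<epsilon> beta unfolding defs by simp_all
    have h4: "0 \<le> A2" "A2 \<le> 1/12 * Z\<^sup>2" "0 \<le> C2"
      using \<epsilon> mult_right_mono[OF \<epsilon>(2), of "Z\<^sup>2"] unfolding defs by simp_all
    have h5: "e \<le> C2 / 72 + N2 / 4 + Z\<^sup>2 / 16" using e2 unfolding defs by simp
    have h6: "- e \<le> 2 * (z \<bullet> d) - \<epsilon> * (n \<bullet> d) + 6 * (u \<bullet> d)"
      using t1 t2' t3 e1 by linarith
    have h7: "\<epsilon> * ((z - \<pi> z) \<bullet> z) \<le> A2" using zz' unfolding defs .
    have "\<epsilon> / 3 * (n \<bullet> z) = E1 / 3" unfolding defs by simp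
    then show ?thesis
      unfolding rhs W_def unfolding n_def[symmetric] u_def[symmetric] b_def[symmetric] Z_def[symmetric] Bb_def[symmetric]
      using h1 h2 h3 h4 h5 h6 h7 by linarith
  qed
qed


text \<open>The form \<open>W\<close> satisfies \<open>c * W \<le> W'\<close> in logarithmic time,
  so a positive value at \<open>t1\<close> would grow at least like
  \<open>(T - t) powr (- c)\<close>. The two size bounds keep \<open>W\<close> bounded, hence
  \<open>W t1 \<le> 0\<close>. The initial condition removes the negative square from
  \<open>W t1\<close>, and what remains is positive definite. The perturbation need only be small,
  with no decay.\<close>

lemma bounded_solution_vanishes:
  fixes x v a :: "real \<Rightarrow> 'a::euclidean_space"
  assumes "t1 < T" and beta: "\<beta> > 0"
    and \<pi>: "linear \<pi>" "\<And>x y. \<pi> x \<bullet> y = x \<bullet> \<pi> y" "\<And>x. \<pi> (\<pi> x) = \<pi> x"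
    and B: "linear B" "\<And>x y. B x \<bullet> y = x \<bullet> B y" "\<And>x. B (\<pi> x) = 0"
    and \<epsilon>: "0 < \<epsilon>" "\<epsilon> \<le> 1/12" "\<epsilon> \<le> \<beta>"
    and \<delta>: "240 * \<delta> \<le> \<epsilon> / 36" "240 * \<delta> \<le> \<epsilon> * \<beta> / 2"
    and dx: "\<And>t. t \<in> {t1..<T} \<Longrightarrow> (x has_vector_derivative v t) (at t within {t1..<T})"
    and dv: "\<And>t. t \<in> {t1..<T} \<Longrightarrow> (v has_vector_derivative a t) (at t within {t1..<T})"
    and pert: "\<And>t. t \<in> {t1..<T} \<Longrightarrow>
      norm ((T - t)\<^sup>2 *\<^sub>R a t + (2/9) *\<^sub>R x t + B (x t)) \<le> \<delta> * norm (x t)"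
    and gap: "\<And>t. t \<in> {t1..<T} \<Longrightarrow> \<beta> * (norm (x t - \<pi> (x t)))\<^sup>2 \<le> B (x t) \<bullet> x t"
    and bx: "\<And>t. t \<in> {t1..<T} \<Longrightarrow> norm (x t) \<le> K * (T - t) powr (2/3)"
    and bv: "\<And>t. t \<in> {t1..<T} \<Longrightarrow> norm (v t) \<le> K * (T - t) powr (-1/3)"
    and init: "\<pi> (x t1 + (3 * (T - t1)) *\<^sub>R v t1) = 0"
  shows "x t1 = 0 \<and> v t1 = 0"
proof -
  interpret P: linear \<pi> by fact
  interpret L: linear B by fact
  define y where "y = (\<lambda>t. (T - t) powr (-2/3) *\<^sub>R x t)"
  define z where "z = (\<lambda>t. (T - t) powr (1/3) *\<^sub>R v t + (2/3) *\<^sub>R y t)"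
  define d where "d = (\<lambda>t. (T - t) powr (-2/3) *\<^sub>R ((T - t)\<^sup>2 *\<^sub>R a t + (2/9) *\<^sub>R x t + B (x t)))"
  define W where "W = (\<lambda>t. z t \<bullet> z t + B (y t) \<bullet> y t - \<epsilon> * ((y t - \<pi> (y t)) \<bullet> z t)
      - (\<pi> (y t) - 3 *\<^sub>R \<pi> (z t)) \<bullet> (\<pi> (y t) - 3 *\<^sub>R \<pi> (z t)))"
  define W' where "W' = (\<lambda>t. 2 * (z t \<bullet> ((1/3) *\<^sub>R z t - B (y t) + d t)) + 2 * (B (y t) \<bullet> z t)
         - \<epsilon> * ((z t - \<pi> (z t)) \<bullet> z t + (y t - \<pi> (y t)) \<bullet> ((1/3) *\<^sub>R z t - B (y t) + d t))
         - 2 * ((\<pi> (y t) - 3 *\<^sub>R \<pi> (z t)) \<bullet> (\<pi> (z t) - 3 *\<^sub>R \<pi> ((1/3) *\<^sub>R z t - B (y t) + d t))))"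
  \<comment> \<open>With \<open>s\<close> for \<open>T - t\<close> and \<open>g\<close> for its cube
    root, every power that occurs is rational in \<open>s\<close> and \<open>g\<close>. The change
    of variables thus reduces to vector identities with rational coefficients, the second of which
    is checked componentwise.\<close>
  have third: "s powr (-2/3) = s powr (1/3) / s" if "s > 0" for s :: real
    using that powr_diff[of s "1/3" 1] by simp
  have scale_y: "(g / s) *\<^sub>R p + (2/3 * (g / s / s)) *\<^sub>R q = (1 / s) *\<^sub>R (g *\<^sub>R p + (2/3) *\<^sub>R ((g / s) *\<^sub>R q))"
    if "s > 0" for s g and p q :: 'a
    by (simp add: scaleR_add_right)
  have scale_z: "g *\<^sub>R p - (1/3 * (g / s)) *\<^sub>R q + (2/3) *\<^sub>R ((1 / s) *\<^sub>R (g *\<^sub>R q + (2/3) *\<^sub>R ((g / s) *\<^sub>R r)))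
     = (1 / s) *\<^sub>R ((1/3) *\<^sub>R (g *\<^sub>R q + (2/3) *\<^sub>R ((g / s) *\<^sub>R r)) - (g / s) *\<^sub>R l
         + (g / s) *\<^sub>R (s\<^sup>2 *\<^sub>R p + (2/9) *\<^sub>R r + l))"
    if "s > 0" for s g and p q r l :: 'a
  proof (rule euclidean_eqI, goal_cases)
    case (1 e)
    have "g * p' - (1/3 * (g / s)) * q' + (2/3) * ((1 / s) * (g * q' + (2/3) * ((g / s) * r')))
     = (1 / s) * ((1/3) * (g * q' + (2/3) * ((g / s) * r')) - (g / s) * l' + (g / s) * (s\<^sup>2 * p' + (2/9) * r' + l'))"
      for p' q' r' l' :: real
      using that by (simp add: field_simps power2_eq_square)
    then show ?case
      unfolding inner_add_left inner_diff_left inner_scaleR_left by blast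
  qed
  have gap': "\<beta> * (norm (y t - \<pi> (y t)))\<^sup>2 \<le> B (y t) \<bullet> y t" if "t \<in> {t1..<T}" for t
  proof -
    have "y t - \<pi> (y t) = (T - t) powr (-2/3) *\<^sub>R (x t - \<pi> (x t))"
      by (simp add: y_def P.scale scaleR_diff_right)
    then have "\<beta> * (norm (y t - \<pi> (y t)))\<^sup>2 = ((T - t) powr (-2/3))\<^sup>2 * (\<beta> * (norm (x t - \<pi> (x t)))\<^sup>2)"
      by (simp add: power_mult_distrib)
    also have "\<dots> \<le> ((T - t) powr (-2/3))\<^sup>2 * (B (x t) \<bullet> x t)"
      by (intro mult_left_mono gap that) simp
    finally show ?thesis by (simp add: y_def L.scale power2_eq_square mult.assoc)
  qed
  have bd: "norm (d t) \<le> \<delta> * norm (y t)" if "t \<in> {t1..<T}" for t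
    using mult_left_mono[OF pert[OF that], of "(T - t) powr (-2/3)"]
    by (simp add: d_def y_def mult.left_commute)
  have dy: "(y has_vector_derivative (1 / (T - t)) *\<^sub>R z t) (at t within {t1..<T})" if t: "t \<in> {t1..<T}" for t
  proof -
    have pos: "T - t > 0" using t by simp
    have "(y has_vector_derivative ((T - t) powr (-2/3) *\<^sub>R v t + ((2/3) * (T - t) powr (-2/3 - 1)) *\<^sub>R x t)) (at t within {t1..<T})"
      unfolding y_def using dx[OF t] pos
      by (auto intro!: derivative_eq_intros)
    moreover have "(T - t) powr (-2/3 - 1) = (T - t) powr (-2/3) / (T - t)"
      using pos powr_diff[of "T - t" "-2/3" 1] by simp
    then have "(T - t) powr (-2/3) *\<^sub>R v t + ((2/3) * (T - t) powr (-2/3 - 1)) *\<^sub>R x t = (1 / (T - t)) *\<^sub>R z t"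
      unfolding z_def y_def using scale_y[OF pos, of "(T - t) powr (1/3)"] by (simp only: third[OF pos])
    ultimately show ?thesis by simp
  qed
  have dz: "(z has_vector_derivative (1 / (T - t)) *\<^sub>R ((1/3) *\<^sub>R z t - B (y t) + d t)) (at t within {t1..<T})"
    if t: "t \<in> {t1..<T}" for t
  proof -
    have pos: "T - t > 0" using t by simp
    have "(z has_vector_derivative ((T - t) powr (1/3) *\<^sub>R a t - ((1/3) * (T - t) powr (1/3 - 1)) *\<^sub>R v t
        + (2/3) *\<^sub>R ((1 / (T - t)) *\<^sub>R z t))) (at t within {t1..<T})"
      unfolding z_def using dv[OF t] dy[OF t] pos
      by (auto intro!: derivative_eq_intros simp: z_def algebra_simps)
    moreover have "(T - t) powr (1/3 - 1) = (T - t) powr (1/3) / (T - t)"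
      using pos powr_diff[of "T - t" "1/3" 1] by simp
    then have "(T - t) powr (1/3) *\<^sub>R a t - ((1/3) * (T - t) powr (1/3 - 1)) *\<^sub>R v t
        + (2/3) *\<^sub>R ((1 / (T - t)) *\<^sub>R z t) = (1 / (T - t)) *\<^sub>R ((1/3) *\<^sub>R z t - B (y t) + d t)"
      unfolding z_def y_def d_def L.scale using scale_z[OF pos, of "(T - t) powr (1/3)"] by (simp only: third[OF pos])
    ultimately show ?thesis by simp
  qed
  have dW: "(W has_real_derivative (1 / (T - t)) * W' t) (at t within {t1..<T})" if t: "t \<in> {t1..<T}" for t
  proof -
    have bl: "bounded_linear \<pi>" "bounded_linear B" using \<pi> B by (simp_all add: linear_conv_bounded_linear)
    note dB = bounded_linear.has_vector_derivative[OF bl(2)] and dP = bounded_linear.has_vector_derivative[OF bl(1)]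
      and I = bounded_bilinear.has_vector_derivative[OF bounded_bilinear_inner]
    let ?r = "1 / (T - t)" and ?q = "(1/3) *\<^sub>R z t - B (y t) + d t"
    have "(W has_vector_derivative
        2 * (z t \<bullet> (?r *\<^sub>R ?q)) + (B (?r *\<^sub>R z t) \<bullet> y t + B (y t) \<bullet> (?r *\<^sub>R z t))
        - \<epsilon> * ((?r *\<^sub>R z t - \<pi> (?r *\<^sub>R z t)) \<bullet> z t + (y t - \<pi> (y t)) \<bullet> (?r *\<^sub>R ?q))
        - 2 * ((\<pi> (y t) - 3 *\<^sub>R \<pi> (z t)) \<bullet> (\<pi> (?r *\<^sub>R z t) - 3 *\<^sub>R \<pi> (?r *\<^sub>R ?q)))) (at t within {t1..<T})"
    proof -
      note du = has_vector_derivative_diff[OF dP[OF dy[OF t]]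
          bounded_linear.has_vector_derivative[OF bounded_linear_scaleR_right[of 3] dP[OF dz[OF t]]]]
      note D = has_vector_derivative_diff[OF has_vector_derivative_diff[OF
            has_vector_derivative_add[OF I[OF dz[OF t] dz[OF t]] I[OF dB[OF dy[OF t]] dy[OF t]]]
            has_vector_derivative_mult_right[OF I[OF has_vector_derivative_diff[OF dy[OF t] dP[OF dy[OF t]]] dz[OF t]], of \<epsilon>]]
          I[OF du du]]
      show ?thesis
        unfolding W_def by (rule has_vector_derivative_eq_rhs[OF D]) (simp add: inner_commute algebra_simps)
    qed
    moreover have "2 * (z t \<bullet> (?r *\<^sub>R ?q)) + (B (?r *\<^sub>R z t) \<bullet> y t + B (y t) \<bullet> (?r *\<^sub>R z t))
        - \<epsilon> * ((?r *\<^sub>R z t - \<pi> (?r *\<^sub>R z t)) \<bullet> z t + (y t - \<pi> (y t)) \<bullet> (?r *\<^sub>R ?q))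
        - 2 * ((\<pi> (y t) - 3 *\<^sub>R \<pi> (z t)) \<bullet> (\<pi> (?r *\<^sub>R z t) - 3 *\<^sub>R \<pi> (?r *\<^sub>R ?q))) = ?r * W' t"
    proof -
      have "B (z t) \<bullet> y t = B (y t) \<bullet> z t" using B(2) by (metis inner_commute)
      then show ?thesis
        unfolding W'_def P.scale L.scale scaleR_diff_right[symmetric] scaleR_left_commute[of 3] inner_scaleR_left inner_scaleR_right
        by (simp add: algebra_simps)
    qed
    ultimately show ?thesis by (simp add: has_real_derivative_iff_has_vector_derivative)
  qed
  define c where "c = \<epsilon> / 18"
  have c: "c > 0" using \<epsilon> by (simp add: c_def)
  have cW: "c * W t \<le> W' t" if "t \<in> {t1..<T}" for t
    unfolding c_def W_def W'_def
    by (rule growth_form_expands[OF beta \<pi> B \<epsilon> gap'[OF that] \<delta> bd[OF that]])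
  have grow: "(T - t1) powr c * W t1 \<le> (T - s) powr c * W s" if s: "s \<in> {t1..<T}" for s
  proof (rule nondecreasing_within[where f = "\<lambda>t. (T - t) powr c * W t"
        and f' = "\<lambda>t. (T - t) powr (c - 1) * (W' t - c * W t)"])
    fix t assume t: "t \<in> {t1..s}"
    then have t': "t \<in> {t1..<T}" and pos: "T - t > 0" using s by auto
    have "(W has_real_derivative (1 / (T - t)) * W' t) (at t within {t1..s})"
      by (rule DERIV_subset[OF dW[OF t']]) (use s in auto)
    then have "((\<lambda>t. (T - t) powr c * W t) has_real_derivative
        (T - t) powr c * ((1 / (T - t)) * W' t) - c * (T - t) powr (c - 1) * W t) (at t within {t1..s})"
      using pos by (auto intro!: derivative_eq_intros)
    moreover have "(T - t) powr c * (1 / (T - t)) = (T - t) powr (c - 1)"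
      using pos powr_diff[of "T - t" c 1] by simp
    then have "(T - t) powr c * ((1 / (T - t)) * W' t) - c * (T - t) powr (c - 1) * W t
        = (T - t) powr (c - 1) * (W' t - c * W t)"
      unfolding mult.assoc[symmetric] by (simp add: algebra_simps)
    ultimately show "((\<lambda>t. (T - t) powr c * W t) has_real_derivative
        (T - t) powr (c - 1) * (W' t - c * W t)) (at t within {t1..s})" by simp
    show "0 \<le> (T - t) powr (c - 1) * (W' t - c * W t)" using cW[OF t'] by simp
  qed (use s in auto)
  obtain KB where KB: "KB > 0" "\<And>x. norm (B x) \<le> KB * norm x" using linear_bounded_pos[OF B(1)] by blast
  obtain KP where KP: "KP > 0" "\<And>x. norm (\<pi> x) \<le> KP * norm x" using linear_bounded_pos[OF \<pi>(1)] by blast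
  define M where "M = (2 * K)\<^sup>2 + KB * K * K + \<epsilon> * ((K + KP * K) * (2 * K))"
  have WM: "W t \<le> M" if t: "t \<in> {t1..<T}" for t
  proof -
    have pos: "T - t > 0" using t by simp
    have "norm (y t) \<le> (T - t) powr (-2/3) * (K * (T - t) powr (2/3))"
      using bx[OF t] by (simp add: y_def mult_left_mono)
    also have "\<dots> = K" using pos by (simp add: powr_add[symmetric])
    finally have yK: "norm (y t) \<le> K" .
    have K: "K \<ge> 0" using yK norm_ge_zero order_trans by blast
    have "norm ((T - t) powr (1/3) *\<^sub>R v t) \<le> (T - t) powr (1/3) * (K * (T - t) powr (-1/3))"
      using bv[OF t] by (simp add: mult_left_mono)
    also have "\<dots> = K" using pos by (simp add: powr_add[symmetric])
    finally have "norm (z t) \<le> K + norm ((2/3) *\<^sub>R y t)"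
      unfolding z_def by (rule norm_triangle_mono) simp
    then have zK: "norm (z t) \<le> 2 * K" using yK K by simp
    have 1: "z t \<bullet> z t \<le> (2 * K)\<^sup>2" using power_mono[OF zK norm_ge_zero, of 2] by (simp add: power2_norm_eq_inner)
    have "B (y t) \<bullet> y t \<le> norm (B (y t)) * norm (y t)" by (rule norm_cauchy_schwarz)
    also have "\<dots> \<le> (KB * K) * K"
      using yK KB K by (intro mult_mono order_trans[OF KB(2)] mult_left_mono) auto
    finally have 2: "B (y t) \<bullet> y t \<le> KB * K * K" .
    have "- ((y t - \<pi> (y t)) \<bullet> z t) \<le> norm (y t - \<pi> (y t)) * norm (z t)"
      using Cauchy_Schwarz_ineq2 abs_le_D2 by blast
    also have "\<dots> \<le> (K + KP * K) * (2 * K)"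
      using yK zK KP K
      by (intro mult_mono order_trans[OF norm_triangle_ineq4] add_mono order_trans[OF KP(2)] mult_left_mono) auto
    finally have 3: "\<epsilon> * - ((y t - \<pi> (y t)) \<bullet> z t) \<le> \<epsilon> * ((K + KP * K) * (2 * K))"
      using \<epsilon> by (intro mult_left_mono) auto
    have "0 \<le> (\<pi> (y t) - 3 *\<^sub>R \<pi> (z t)) \<bullet> (\<pi> (y t) - 3 *\<^sub>R \<pi> (z t))" by simp
    then show ?thesis using 1 2 3 unfolding W_def M_def by linarith
  qed
  \<comment> \<open>Let \<open>s\<close> tend to \<open>T\<close> in \<open>grow\<close>: the factor
    \<open>(T - s) powr c\<close> tends to 0 while \<open>W s\<close> stays below
    \<open>M\<close>.\<close>
  have "W t1 \<le> 0"
  proof -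
    have "((\<lambda>t. (T - t) powr c * M) \<longlongrightarrow> (T - T) powr c * M) (at_left T)"
      using c by (intro tendsto_intros tendsto_powr') (auto simp: eventually_at_left_field intro!: exI[of _ "T - 1"])
    moreover have "eventually (\<lambda>t. (T - t1) powr c * W t1 \<le> (T - t) powr c * M) (at_left T)"
    proof (rule eventually_at_leftI[OF _ \<open>t1 < T\<close>])
      fix t assume "t \<in> {t1<..<T}"
      then have t: "t \<in> {t1..<T}" by simp
      show "(T - t1) powr c * W t1 \<le> (T - t) powr c * M"
        using grow[OF t] WM[OF t] by (meson mult_left_mono order_trans powr_ge_zero)
    qed
    ultimately have "(T - t1) powr c * W t1 \<le> (T - T) powr c * M"
      using tendsto_lowerbound trivial_limit_at_left_real by blast
    then show ?thesis using \<open>t1 < T\<close> by (simp add: mult_le_0_iff)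
  qed
  \<comment> \<open>In the original variables the conserved quantity \<open>y - 3 z\<close> is a
    negative multiple of \<open>x + 3 (T - t) v\<close>, which is where the combination in the
    initial condition comes from.\<close>
  moreover have "\<pi> (y t1) = 3 *\<^sub>R \<pi> (z t1)"
  proof -
    have pos: "T - t1 > 0" using \<open>t1 < T\<close> by simp
    have "(g / s) *\<^sub>R p - 3 *\<^sub>R (g *\<^sub>R q + (2/3) *\<^sub>R ((g / s) *\<^sub>R p)) = - ((g / s) *\<^sub>R (p + (3 * s) *\<^sub>R q))"
      if "s > 0" for s g and p q :: 'a
    proof (rule euclidean_eqI, goal_cases)
      case (1 e)
      have "(g / s) * p' - 3 * (g * q' + (2/3) * ((g / s) * p')) = - ((g / s) * (p' + (3 * s) * q'))" for p' q' :: real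
        using that by (simp add: field_simps)
      then show ?case
        unfolding inner_add_left inner_diff_left inner_scaleR_left inner_minus_left by blast
    qed
    from this[OF pos] have "y t1 - 3 *\<^sub>R z t1 = - ((T - t1) powr (-2/3) *\<^sub>R (x t1 + (3 * (T - t1)) *\<^sub>R v t1))"
      unfolding z_def y_def third[OF pos] .
    then have "\<pi> (y t1 - 3 *\<^sub>R z t1) = 0" by (simp only: P.neg P.scale init) simp
    then show ?thesis by (simp add: P.diff P.scale)
  qed
  ultimately have "y t1 = 0 \<and> z t1 = 0"
    using growth_form_definite[OF beta \<pi> B \<epsilon> gap', of t1 "z t1"] \<open>t1 < T\<close> unfolding W_def by fastforce
  then show ?thesis using \<open>t1 < T\<close> by (auto simp: y_def z_def)
qed

subsection \<open>The mass Laplacian\<close>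

definition acceleration :: "('n::finite \<Rightarrow> real) \<Rightarrow> ('d::finite, 'n) config \<Rightarrow> ('d, 'n) config"
  where "acceleration m q =
    (\<chi> a. \<Sum>b\<in>UNIV. (m b / norm (q $ a - q $ b) ^ 3) *\<^sub>R (q $ b - q $ a))"

lemma sum_pairs_half:
  fixes f :: "'n::{finite,linorder} \<Rightarrow> 'n \<Rightarrow> real"
  assumes "\<And>a b. f a b = f b a" and "\<And>a. f a a = 0"
  shows "(\<Sum>(a, b)\<in>{(a, b). a < b}. f a b) = (\<Sum>a\<in>UNIV. \<Sum>b\<in>UNIV. f a b) / 2"
proof -
  let ?L = "{(a, b::'n). a < b}" and ?G = "{(a, b::'n). b < a}" and ?D = "{(a, b::'n). a = b}"
  have "(\<Sum>a\<in>UNIV. \<Sum>b\<in>UNIV. f a b) = (\<Sum>(a, b)\<in>UNIV. f a b)"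
    by (simp add: sum.cartesian_product)
  also have "(UNIV :: ('n \<times> 'n) set) = (?L \<union> ?G) \<union> ?D" by auto
  also have "(\<Sum>(a, b)\<in>(?L \<union> ?G) \<union> ?D. f a b)
      = (\<Sum>(a, b)\<in>?L. f a b) + (\<Sum>(a, b)\<in>?G. f a b) + (\<Sum>(a, b)\<in>?D. f a b)"
    by (subst sum.union_disjoint, simp, simp, force)+ simp
  also have "(\<Sum>(a, b)\<in>?D. f a b) = 0" using assms(2) by (intro sum.neutral) auto
  also have "(\<Sum>(a, b)\<in>?G. f a b) = (\<Sum>(a, b)\<in>?L. f a b)"
    by (rule sum.reindex_bij_witness[of _ "\<lambda>(a, b). (b, a)" "\<lambda>(a, b). (b, a)"]) (auto simp: assms(1))
  finally show ?thesis by simp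
qed

text \<open>The diagonal can be included since division by zero gives 0. The symmetric double sum
  replaces the order on the bodies in all later computations.\<close>

lemma force_function_eq:
  "force_function m q = (\<Sum>a\<in>UNIV. \<Sum>b\<in>UNIV. m a * m b / norm (q $ a - q $ b)) / 2"
  unfolding force_function_def
  by (rule sum_pairs_half) (auto simp: norm_minus_commute mult.commute)

lemma inverse_distance_has_derivative:
  fixes q :: "('d::finite, 'n::finite) config"
  assumes "q \<in> collision_free"
  shows "((\<lambda>q. k / norm (q $ a - q $ b)) has_derivative
    (\<lambda>h. - (k * ((q $ a - q $ b) \<bullet> (h $ a - h $ b)) / norm (q $ a - q $ b) ^ 3))) (at q)"
proof (cases "a = b")
  case False
  then have ne: "q $ a - q $ b \<noteq> 0" using assms by (simp add: collision_free_def)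
  have lin: "((\<lambda>q. q $ a - q $ b) has_derivative (\<lambda>h. h $ a - h $ b)) (at q)"
    by (intro has_derivative_diff bounded_linear_imp_has_derivative bounded_linear_vec_nth)
  have "((\<lambda>q. norm (q $ a - q $ b)) has_derivative (\<lambda>h. (h $ a - h $ b) \<bullet> sgn (q $ a - q $ b))) (at q)"
    by (rule has_derivative_compose[OF lin has_derivative_norm[OF ne]])
  then have "((\<lambda>q. k / norm (q $ a - q $ b)) has_derivative
      (\<lambda>h. - (k * ((h $ a - h $ b) \<bullet> sgn (q $ a - q $ b))) / (norm (q $ a - q $ b))\<^sup>2)) (at q)"
    using ne by (auto intro!: derivative_eq_intros simp: power2_eq_square)
  moreover have "- (k * ((h $ a - h $ b) \<bullet> sgn (q $ a - q $ b))) / (norm (q $ a - q $ b))\<^sup>2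
     = - (k * ((q $ a - q $ b) \<bullet> (h $ a - h $ b)) / norm (q $ a - q $ b) ^ 3)" for h :: "('d, 'n) config"
    by (simp add: sgn_div_norm inner_commute power3_eq_cube power2_eq_square divide_simps)
  ultimately show ?thesis by simp
qed simp

lemma mass_inner_acceleration:
  "mass_inner m (acceleration m q) h
    = (\<Sum>a\<in>UNIV. \<Sum>b\<in>UNIV. m a * m b / norm (q $ a - q $ b) ^ 3 * ((q $ b - q $ a) \<bullet> h $ a))"
  by (simp add: mass_inner_def acceleration_def inner_sum_left sum_distrib_left mult.assoc)

lemma force_function_has_mass_gradient:
  fixes q :: "('d::finite, 'n::{finite,linorder}) config"
  assumes "q \<in> collision_free"
  shows "has_mass_gradient m (force_function m) q (acceleration m q)"
proof -
  let ?w = "\<lambda>a b. m a * m b / norm (q $ a - q $ b) ^ 3"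
  have wc: "?w a b = ?w b a" for a b by (simp add: norm_minus_commute mult.commute)
  have "(force_function m has_derivative
      (\<lambda>h. (\<Sum>a\<in>UNIV. \<Sum>b\<in>UNIV. - (m a * m b * ((q $ a - q $ b) \<bullet> (h $ a - h $ b)) / norm (q $ a - q $ b) ^ 3)) / 2)) (at q)"
    unfolding force_function_eq[abs_def]
    by (intro bounded_linear.has_derivative[OF bounded_linear_divide] has_derivative_sum
        inverse_distance_has_derivative assms)
  moreover have "(\<Sum>a\<in>UNIV. \<Sum>b\<in>UNIV. - (m a * m b * ((q $ a - q $ b) \<bullet> (h $ a - h $ b)) / norm (q $ a - q $ b) ^ 3)) / 2
      = mass_inner m (acceleration m q) h" for h
  proof -
    have "(\<Sum>a\<in>UNIV. \<Sum>b\<in>UNIV. - (m a * m b * ((q $ a - q $ b) \<bullet> (h $ a - h $ b)) / norm (q $ a - q $ b) ^ 3))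
       = (\<Sum>a\<in>UNIV. \<Sum>b\<in>UNIV. ?w a b * ((q $ b - q $ a) \<bullet> h $ a)) + (\<Sum>a\<in>UNIV. \<Sum>b\<in>UNIV. ?w a b * ((q $ a - q $ b) \<bullet> h $ b))"
      unfolding sum.distrib[symmetric]
      by (intro sum.cong refl) (simp add: inner_diff_left inner_diff_right diff_divide_distrib add_divide_distrib algebra_simps)
    also have "(\<Sum>a\<in>UNIV. \<Sum>b\<in>UNIV. ?w a b * ((q $ a - q $ b) \<bullet> h $ b)) = (\<Sum>a\<in>UNIV. \<Sum>b\<in>UNIV. ?w a b * ((q $ b - q $ a) \<bullet> h $ a))"
      by (subst sum.swap) (intro sum.cong refl arg_cong2[where f = "(*)"] wc)
    finally show ?thesis
      unfolding mass_inner_acceleration by simp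
  qed
  ultimately show ?thesis by (simp add: has_mass_gradient_def)
qed

lemma mass_inner_commute: "mass_inner m x y = mass_inner m y x"
  by (simp add: mass_inner_def inner_commute)

lemma mass_inner_self_nonneg:
  assumes "\<And>a. m a > 0" shows "mass_inner m x x \<ge> 0"
  using assms unfolding mass_inner_def by (intro sum_nonneg mult_nonneg_nonneg) (auto intro: less_imp_le)

lemma mass_inner_self_eq_0:
  assumes "\<And>a. m a > 0" and "mass_inner m x x = 0" shows "x = 0"
proof -
  have "\<forall>a\<in>UNIV. m a * (x $ a \<bullet> x $ a) = 0"
    using assms sum_nonneg_eq_0_iff[of UNIV "\<lambda>a. m a * (x $ a \<bullet> x $ a)"] by (simp add: mass_inner_def less_imp_le)
  then show ?thesis using assms(1) by (simp add: vec_eq_iff) (metis less_irrefl)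
qed

lemma mass_inner_diff_left: "mass_inner m (x - y) z = mass_inner m x z - mass_inner m y z"
  by (rule bounded_bilinear.diff_left[OF bilinear_mass_inner])

lemma mass_inner_scaleR: "mass_inner m (r *\<^sub>R x) y = r * mass_inner m x y" "mass_inner m x (r *\<^sub>R y) = r * mass_inner m x y"
  using bounded_bilinear.scaleR_left[OF bilinear_mass_inner] bounded_bilinear.scaleR_right[OF bilinear_mass_inner] by auto

lemma mass_inner_add: "mass_inner m (x + y) z = mass_inner m x z + mass_inner m y z" "mass_inner m x (y + z) = mass_inner m x y + mass_inner m x z"
  using bounded_bilinear.add_left[OF bilinear_mass_inner] bounded_bilinear.add_right[OF bilinear_mass_inner] by auto

lemma has_mass_gradient_unique:
  assumes m: "\<And>a. m a > 0" and "has_mass_gradient m f q g" "has_mass_gradient m f q g'"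
  shows "g = g'"
proof -
  have "mass_inner m g h = mass_inner m g' h" for h
    using has_derivative_unique assms(2,3) unfolding has_mass_gradient_def by metis
  then have "mass_inner m (g - g') (g - g') = 0" by (simp add: mass_inner_diff_left)
  then show ?thesis using mass_inner_self_eq_0[OF m] by fastforce
qed

text \<open>Euler's identity for the force function, which is homogeneous of degree -1. Averaging
  the double sum with its transpose turns each pair into minus its mutual energy.\<close>

lemma mass_inner_acceleration_self:
  "mass_inner m (acceleration m q) q = - force_function m q"
proof -
  let ?w = "\<lambda>a b. m a * m b / norm (q $ a - q $ b) ^ 3"
  have wc: "?w a b = ?w b a" for a b by (simp add: norm_minus_commute mult.commute)
  have "mass_inner m (acceleration m q) q = (\<Sum>a\<in>UNIV. \<Sum>b\<in>UNIV. ?w a b * ((q $ b - q $ a) \<bullet> q $ a))"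
    by (rule mass_inner_acceleration)
  moreover have "\<dots> = (\<Sum>a\<in>UNIV. \<Sum>b\<in>UNIV. ?w a b * ((q $ a - q $ b) \<bullet> q $ b))"
    by (subst sum.swap) (intro sum.cong refl arg_cong2[where f = "(*)"] wc)
  ultimately have "2 * mass_inner m (acceleration m q) q
      = (\<Sum>a\<in>UNIV. \<Sum>b\<in>UNIV. ?w a b * ((q $ b - q $ a) \<bullet> q $ a) + ?w a b * ((q $ a - q $ b) \<bullet> q $ b))"
    by (simp add: sum.distrib)
  also have "\<dots> = (\<Sum>a\<in>UNIV. \<Sum>b\<in>UNIV. - (m a * m b / norm (q $ a - q $ b)))"
  proof (intro sum.cong refl)
    fix a b
    have "?w a b * ((q $ b - q $ a) \<bullet> q $ a) + ?w a b * ((q $ a - q $ b) \<bullet> q $ b)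
        = - (?w a b * ((q $ a - q $ b) \<bullet> (q $ a - q $ b)))"
      unfolding distrib_left[symmetric] minus_mult_right
      by (simp add: inner_diff_left inner_diff_right inner_commute)
    also have "\<dots> = - (m a * m b / norm (q $ a - q $ b))"
      by (simp add: dot_square_norm power2_eq_square power3_eq_cube)
    finally show "?w a b * ((q $ b - q $ a) \<bullet> q $ a) + ?w a b * ((q $ a - q $ b) \<bullet> q $ b)
      = - (m a * m b / norm (q $ a - q $ b))" .
  qed
  finally show ?thesis by (simp add: force_function_eq sum_negf)
qed

lemma force_function_pos:
  fixes q :: "('d::finite, 'n::{finite,linorder}) config"
  assumes m: "\<And>a. m a > 0" and "q \<in> collision_free" and "CARD('n) \<ge> 2"
  shows "force_function m q > 0"
proof -
  obtain a b :: 'n where ab: "a < b"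
    using assms(3) card_2_iff' by (metis One_nat_def UNIV_I card_1_singleton_iff card_le_Suc0_iff_eq finite_code linorder_neq_iff not_less_eq_eq numeral_2_eq_2)
  have nn: "0 \<le> m a * m b / norm (q $ a - q $ b)" for a b
    using m[of a] m[of b] by simp
  show ?thesis
    unfolding force_function_def
  proof (rule sum_pos2[of _ "(a, b)"])
    show "0 < (case (a, b) of (a, b) \<Rightarrow> m a * m b / norm (q $ a - q $ b))"
      using ab assms(2) m[of a] m[of b] by (auto simp: collision_free_def)
  qed (use ab nn in auto)
qed

lemma subspace_centered: "subspace (centered m :: ('d::finite, 'n::finite) config set)"
proof -
  have "(\<Sum>a\<in>UNIV. m a *\<^sub>R (r *\<^sub>R q $ a)) = r *\<^sub>R (\<Sum>a\<in>UNIV. m a *\<^sub>R q $ a)"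
    for r and q :: "('d, 'n) config"
    by (simp add: scaleR_sum_right mult.commute)
  then show ?thesis
    by (auto simp: subspace_def centered_def scaleR_right_distrib sum.distrib)
qed

text \<open>Newton's third law: the summands are antisymmetric in the two bodies.\<close>

lemma acceleration_centered: "acceleration m q \<in> centered m"
proof -
  let ?f = "\<lambda>a b. (m a * m b / norm (q $ a - q $ b) ^ 3) *\<^sub>R (q $ b - q $ a)"
  have "(\<Sum>a\<in>UNIV. \<Sum>b\<in>UNIV. ?f a b) = (\<Sum>a\<in>UNIV. \<Sum>b\<in>UNIV. ?f b a)"
    by (rule sum.swap)
  also have "\<dots> = - (\<Sum>a\<in>UNIV. \<Sum>b\<in>UNIV. ?f a b)"
    unfolding sum_negf[symmetric]
    by (intro sum.cong refl) (simp add: norm_minus_commute mult.commute flip: scaleR_minus_right)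
  finally have "2 *\<^sub>R (\<Sum>a\<in>UNIV. \<Sum>b\<in>UNIV. ?f a b) = 0"
    unfolding scaleR_2 by (metis (no_types, lifting) add.right_inverse)
  then have "(\<Sum>a\<in>UNIV. \<Sum>b\<in>UNIV. ?f a b) = 0" by simp
  then show ?thesis by (simp add: centered_def acceleration_def scaleR_sum_right)
qed

text \<open>The vector \<open>g\<close> is the tangential part of the gradient: Euler's identity
  makes it orthogonal to \<open>s\<close>, with the force function itself as Lagrange multiplier.
  Criticality applied to the tangent vector \<open>g\<close> then gives \<open>g\<close> zero mass
  norm.\<close>

lemma normalized_CC_acceleration:
  fixes s :: "('d::finite, 'n::{finite,linorder}) config"
  assumes m: "\<And>a. m a > 0" and "normalized_CC m s"
  shows "acceleration m s = - force_function m s *\<^sub>R s"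
proof -
  let ?U = "force_function m s"
  define g where "g = acceleration m s + ?U *\<^sub>R s"
  have s: "s \<in> centered m" "mass_inner m s s = 1" "s \<in> collision_free"
    and crit: "\<And>v. v \<in> centered m \<Longrightarrow> mass_inner m s v = 0 \<Longrightarrow> frechet_derivative (force_function m) (at s) v = 0"
    using assms normalized_CC_iff_tangent[where m = m and s = s, OF m] by (auto simp: mass_sphere_def mass_norm_def)
  have D: "frechet_derivative (force_function m) (at s) = (\<lambda>h. mass_inner m (acceleration m s) h)"
    using force_function_has_mass_gradient[OF s(3), of m] unfolding has_mass_gradient_def
    by (rule frechet_derivative_at[symmetric])
  have "g \<in> centered m"
    unfolding g_def using s(1) by (intro subspace_add subspace_scale subspace_centered acceleration_centered)
  moreover have sg: "mass_inner m s g = 0"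
    using s(2) mass_inner_acceleration_self[of m s]
    unfolding g_def mass_inner_add mass_inner_scaleR by (subst mass_inner_commute) simp
  ultimately have "mass_inner m (acceleration m s) g = 0" using crit[of g] D by simp
  then have "mass_inner m g g = 0"
    using sg by (simp add: g_def mass_inner_add(1) mass_inner_scaleR(1))
  then show ?thesis using mass_inner_self_eq_0[where m = m and x = g, OF m] by (simp add: g_def eq_neg_iff_add_eq_0)
qed

section \<open>Coordinate functions and the Laplacian of the distances\<close>

definition mass_row :: "('n::finite \<Rightarrow> real) \<Rightarrow> ('d::finite, 'n) config \<Rightarrow> real ^ 'd \<Rightarrow> real ^ 'n"
  where "mass_row m q c = (\<chi> a. sqrt (m a) * (q $ a \<bullet> c))"

text \<open>The graph Laplacian with edge weights \<open>m a * m b * w a b\<close>, conjugated by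
  the inverse square roots of the masses. Together with the factor in \<open>mass_row\<close> this
  turns the mass inner product into the standard one, so that symmetry is meant in the ordinary
  sense. Leaving \<open>w\<close> free allows the difference of two such operators to be treated as
  one with small weights.\<close>

definition mass_laplacian :: "('n::finite \<Rightarrow> real) \<Rightarrow> ('n \<Rightarrow> 'n \<Rightarrow> real) \<Rightarrow> real ^ 'n \<Rightarrow> real ^ 'n"
  where "mass_laplacian m w x =
    (\<chi> a. \<Sum>b\<in>UNIV. w a b * sqrt (m b) * (sqrt (m b) * x $ a - sqrt (m a) * x $ b))"

definition inverse_cubes :: "('d::finite, 'n::finite) config \<Rightarrow> 'n \<Rightarrow> 'n \<Rightarrow> real"
  where "inverse_cubes q a b = 1 / norm (q $ a - q $ b) ^ 3"

lemma inverse_cubes_commute: "inverse_cubes q a b = inverse_cubes q b a"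
  by (simp add: inverse_cubes_def norm_minus_commute)

text \<open>Here the nonlinear system becomes linear: once the distances are regarded as given
  functions of time, the same operator acts on the coordinates in every direction
  \<open>c\<close>.\<close>

lemma mass_row_acceleration:
  assumes m: "\<And>a. m a > 0"
  shows "mass_row m (acceleration m q) c = - mass_laplacian m (inverse_cubes q) (mass_row m q c)"
proof -
  have sq: "sqrt (m a) * (sqrt (m a) * x) = m a * x" for a x
    using m[of a] by (simp add: mult.assoc[symmetric])
  have "(m b / norm (q $ a - q $ b) ^ 3) * ((q $ b - q $ a) \<bullet> c) * sqrt (m a)
     = - (inverse_cubes q a b * sqrt (m b) * (sqrt (m b) * (sqrt (m a) * (q $ a \<bullet> c)) - sqrt (m a) * (sqrt (m b) * (q $ b \<bullet> c))))" for a b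
  proof -
    have "inverse_cubes q a b * sqrt (m b) * (sqrt (m b) * (sqrt (m a) * (q $ a \<bullet> c)) - sqrt (m a) * (sqrt (m b) * (q $ b \<bullet> c)))
      = inverse_cubes q a b * ((sqrt (m b) * (sqrt (m b) * (sqrt (m a) * (q $ a \<bullet> c - q $ b \<bullet> c)))))"
      by (simp add: algebra_simps)
    also have "\<dots> = inverse_cubes q a b * (m b * (sqrt (m a) * (q $ a \<bullet> c - q $ b \<bullet> c)))"
      by (simp only: sq)
    finally show ?thesis
      by (simp only:) (simp add: inverse_cubes_def inner_diff_left algebra_simps diff_divide_distrib)
  qed
  note key = this
  have "mass_row m (acceleration m q) c $ a = - (mass_laplacian m (inverse_cubes q) (mass_row m q c) $ a)" for a
  proof -
    have "mass_row m (acceleration m q) c $ a = (\<Sum>b\<in>UNIV. (m b / norm (q $ a - q $ b) ^ 3) * ((q $ b - q $ a) \<bullet> c) * sqrt (m a))"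
      by (simp add: mass_row_def acceleration_def inner_sum_left sum_distrib_right mult.commute[of "sqrt (m a)"])
    then show ?thesis
      unfolding key by (simp add: sum_negf mass_laplacian_def mass_row_def)
  qed
  then show ?thesis by (simp add: vec_eq_iff)
qed

lemma normalized_CC_mass_laplacian:
  fixes s :: "('d::finite, 'n::{finite,linorder}) config"
  assumes m: "\<And>a. m a > 0" and cc: "normalized_CC m s"
  shows "mass_laplacian m (inverse_cubes s) (mass_row m s c) = force_function m s *\<^sub>R mass_row m s c"
proof -
  have "mass_row m (acceleration m s) c = - (force_function m s *\<^sub>R mass_row m s c)"
    unfolding normalized_CC_acceleration[OF m cc] by (simp add: mass_row_def vec_eq_iff)
  then show ?thesis using mass_row_acceleration[where m = m and q = s and c = c, OF m] by simp
qed

lemma linear_mass_laplacian: "linear (mass_laplacian m w)"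
  by (intro linearI) (simp_all add: mass_laplacian_def vec_eq_iff algebra_simps sum.distrib sum_subtractf sum_distrib_left)

lemma mass_laplacian_scale: "mass_laplacian m (\<lambda>a b. k * w a b) x = k *\<^sub>R mass_laplacian m w x"
  by (simp add: mass_laplacian_def vec_eq_iff sum_distrib_left mult.assoc)

lemma mass_laplacian_diff: "mass_laplacian m (\<lambda>a b. w a b - w' a b) x = mass_laplacian m w x - mass_laplacian m w' x"
  by (simp add: mass_laplacian_def vec_eq_iff sum_subtractf[symmetric] left_diff_distrib)

lemma mass_laplacian_total: "mass_laplacian m w (\<chi> a. sqrt (m a)) = 0"
  by (simp add: mass_laplacian_def vec_eq_iff)

lemma mass_laplacian_symmetric:
  assumes "\<And>a b. w a b = w b a"
  shows "mass_laplacian m w x \<bullet> y = x \<bullet> mass_laplacian m w y"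
proof -
  have 1: "mass_laplacian m w x \<bullet> y = (\<Sum>a\<in>UNIV. \<Sum>b\<in>UNIV. w a b * (sqrt (m b))\<^sup>2 * x $ a * y $ a) - (\<Sum>a\<in>UNIV. \<Sum>b\<in>UNIV. w a b * sqrt (m b) * sqrt (m a) * x $ b * y $ a)" for x y
    unfolding sum_subtractf[symmetric] inner_vec_def[of "mass_laplacian m w x"]
    unfolding mass_laplacian_def vec_lambda_beta inner_real_def sum_distrib_right
    by (intro sum.cong refl) (simp only: power2_eq_square right_diff_distrib left_diff_distrib mult.assoc mult.left_commute)
  have "(\<Sum>a\<in>UNIV. \<Sum>b\<in>UNIV. w a b * sqrt (m b) * sqrt (m a) * x $ b * y $ a) = (\<Sum>a\<in>UNIV. \<Sum>b\<in>UNIV. w a b * sqrt (m b) * sqrt (m a) * y $ b * x $ a)"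
    by (subst sum.swap) (simp add: assms mult.commute mult.left_commute)
  then have "mass_laplacian m w x \<bullet> y = mass_laplacian m w y \<bullet> x"
    unfolding 1 by (simp add: mult.commute mult.left_commute)
  then show ?thesis by (simp add: inner_commute)
qed

text \<open>A crude operator bound, linear in the absolute weights. It is used twice: for weights
  tending to 0 at the collision, and for weights bounded on a compact interval.\<close>

lemma mass_laplacian_norm_le:
  "norm (mass_laplacian m w x) \<le> (\<Sum>a\<in>UNIV. \<Sum>b\<in>UNIV. \<bar>w a b\<bar> * (\<bar>sqrt (m b)\<bar> * (\<bar>sqrt (m b)\<bar> + \<bar>sqrt (m a)\<bar>))) * norm x"
proof -
  have "norm (mass_laplacian m w x) \<le> (\<Sum>a\<in>UNIV. norm (mass_laplacian m w x $ a))"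
    using norm_le_l1_cart[of "mass_laplacian m w x"] by simp
  also have "\<dots> \<le> (\<Sum>a\<in>UNIV. \<Sum>b\<in>UNIV. \<bar>w a b\<bar> * (\<bar>sqrt (m b)\<bar> * (\<bar>sqrt (m b)\<bar> + \<bar>sqrt (m a)\<bar>)) * norm x)"
  proof (rule sum_mono)
    fix a
    have c: "\<bar>x $ c\<bar> \<le> norm x" for c by (rule component_le_norm_cart)
    have "norm (mass_laplacian m w x $ a) \<le> (\<Sum>b\<in>UNIV. \<bar>w a b * sqrt (m b) * (sqrt (m b) * x $ a - sqrt (m a) * x $ b)\<bar>)"
      unfolding mass_laplacian_def by simp
    also have "\<dots> \<le> (\<Sum>b\<in>UNIV. \<bar>w a b\<bar> * (\<bar>sqrt (m b)\<bar> * (\<bar>sqrt (m b)\<bar> + \<bar>sqrt (m a)\<bar>)) * norm x)"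
    proof (rule sum_mono)
      fix b
      have "\<bar>sqrt (m b) * x $ a - sqrt (m a) * x $ b\<bar> \<le> \<bar>sqrt (m b)\<bar> * \<bar>x $ a\<bar> + \<bar>sqrt (m a)\<bar> * \<bar>x $ b\<bar>"
        by (metis abs_mult abs_triangle_ineq4)
      also have "\<dots> \<le> \<bar>sqrt (m b)\<bar> * norm x + \<bar>sqrt (m a)\<bar> * norm x"
        by (intro add_mono mult_left_mono c) auto
      finally have "\<bar>w a b * sqrt (m b)\<bar> * \<bar>sqrt (m b) * x $ a - sqrt (m a) * x $ b\<bar> \<le> \<bar>w a b * sqrt (m b)\<bar> * (\<bar>sqrt (m b)\<bar> * norm x + \<bar>sqrt (m a)\<bar> * norm x)"
        by (intro mult_left_mono) auto
      then show "\<bar>w a b * sqrt (m b) * (sqrt (m b) * x $ a - sqrt (m a) * x $ b)\<bar> \<le> \<bar>w a b\<bar> * (\<bar>sqrt (m b)\<bar> * (\<bar>sqrt (m b)\<bar> + \<bar>sqrt (m a)\<bar>)) * norm x"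
        unfolding abs_mult[of "w a b * sqrt (m b)"] by (simp only: abs_mult distrib_left distrib_right ac_simps)
    qed
    finally show "norm (mass_laplacian m w x $ a) \<le> (\<Sum>b\<in>UNIV. \<bar>w a b\<bar> * (\<bar>sqrt (m b)\<bar> * (\<bar>sqrt (m b)\<bar> + \<bar>sqrt (m a)\<bar>)) * norm x)" .
  qed
  finally show ?thesis by (simp add: sum_distrib_right)
qed

lemma mass_row_centered:
  assumes "\<And>a. m a > 0" and "q \<in> centered m"
  shows "mass_row m q c \<bullet> (\<chi> a. sqrt (m a)) = 0"
proof -
  have "mass_row m q c \<bullet> (\<chi> a. sqrt (m a)) = (\<Sum>a\<in>UNIV. m a *\<^sub>R q $ a) \<bullet> c"
  proof -
    have "sqrt (m a) * (q $ a \<bullet> c) * sqrt (m a) = m a * (q $ a \<bullet> c)" for a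
    proof -
      have "sqrt (m a) * (q $ a \<bullet> c) * sqrt (m a) = (sqrt (m a) * sqrt (m a)) * (q $ a \<bullet> c)"
        by (simp only: ac_simps)
      also have "sqrt (m a) * sqrt (m a) = m a" using assms(1)[of a] by simp
      finally show ?thesis .
    qed
    note 1 = this
    have "mass_row m q c \<bullet> (\<chi> a. sqrt (m a)) = (\<Sum>a\<in>UNIV. sqrt (m a) * (q $ a \<bullet> c) * sqrt (m a))"
      unfolding inner_vec_def[of "mass_row m q c"] by (simp add: mass_row_def)
    then show ?thesis unfolding 1 by (simp add: inner_sum_left)
  qed
  then show ?thesis using assms(2) by (simp add: centered_def)
qed

lemma norm_mass_row_le:
  assumes "\<And>a. m a > 0"
  shows "norm (mass_row m q c) \<le> mass_norm m q * norm c"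
proof -
  have "(norm (mass_row m q c))\<^sup>2 = (\<Sum>a\<in>UNIV. m a * (q $ a \<bullet> c)\<^sup>2)"
    using assms by (simp add: power2_norm_eq_inner inner_vec_def mass_row_def power2_eq_square[symmetric] power_mult_distrib less_imp_le)
  also have "\<dots> \<le> (\<Sum>a\<in>UNIV. m a * ((q $ a \<bullet> q $ a) * (c \<bullet> c)))"
    using assms by (intro sum_mono mult_left_mono Cauchy_Schwarz_ineq) (simp add: less_imp_le)
  also have "\<dots> = (mass_norm m q * norm c)\<^sup>2"
    using mass_inner_self_nonneg[where m = m and x = q, OF assms]
    by (simp add: mass_norm_def power_mult_distrib mass_inner_def sum_distrib_right mult.assoc power2_norm_eq_inner)
  finally show ?thesis
    by (rule power2_le_imp_le) (use mass_inner_self_nonneg[where m = m and x = q, OF assms] in \<open>simp add: mass_norm_def\<close>)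
qed

lemma component_le_mass_norm:
  assumes "\<And>a. m a > 0"
  shows "norm (q $ a) \<le> mass_norm m q / sqrt (m a)"
proof -
  have "m a * (q $ a \<bullet> q $ a) \<le> mass_inner m q q"
    unfolding mass_inner_def using assms
    by (intro member_le_sum[of a UNIV "\<lambda>a. m a * (q $ a \<bullet> q $ a)"]) (auto simp: mult_nonneg_nonneg less_imp_le)
  then have "sqrt (m a * (q $ a \<bullet> q $ a)) \<le> mass_norm m q" by (simp add: mass_norm_def)
  then show ?thesis using assms[of a] by (simp add: real_sqrt_mult norm_eq_sqrt_inner pos_le_divide_eq mult.commute)
qed

text \<open>Every point of the rotation orbit has the mutual distances of \<open>s\<close>, so being
  near some point of the orbit is enough, however that point moves with time. The constant
  \<open>K\<close> bounds differences of two bodies by the mass norm.\<close>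

lemma limiting_shape_distances:
  fixes q :: "real \<Rightarrow> ('d::finite, 'n::{finite,linorder}) config"
  assumes m: "\<And>a. m a > 0" and lim: "limiting_shape m T q s"
  shows "((\<lambda>t. norm (q t $ a - q t $ b) / mass_norm m (q t)) \<longlongrightarrow> norm (s $ a - s $ b)) (at_left T)"
proof -
  define K where "K = 1 / sqrt (m a) + 1 / sqrt (m b)"
  have K: "K > 0" using m by (simp add: K_def add_pos_pos)
  have mn: "mass_norm m x \<ge> 0" for x :: "('d, 'n) config"
    using mass_inner_self_nonneg[OF m] by (simp add: mass_norm_def)
  have ne: "rotation_orbit s \<noteq> {}"
    unfolding rotation_orbit_def using rotation_matrix_def[of "mat 1 :: real^'d^'d"] orthogonal_matrix_id det_I by auto
  have lim0: "((\<lambda>t. mass_infdist m (q t /\<^sub>R mass_norm m (q t)) (rotation_orbit s)) \<longlongrightarrow> 0) (at_left T)"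
    using lim by (simp add: limiting_shape_def)
  show ?thesis
  proof (rule tendstoI)
    fix e :: real assume e: "e > 0"
    have "eventually (\<lambda>t. mass_infdist m (q t /\<^sub>R mass_norm m (q t)) (rotation_orbit s) < e / K) (at_left T)"
      using order_tendstoD(2)[OF lim0, of "e / K"] e K by simp
    then show "eventually (\<lambda>t. dist (norm (q t $ a - q t $ b) / mass_norm m (q t)) (norm (s $ a - s $ b)) < e) (at_left T)"
    proof eventually_elim
      case (elim t)
      let ?x = "q t /\<^sub>R mass_norm m (q t)"
      obtain y where y: "y \<in> rotation_orbit s" "mass_norm m (?x - y) < e / K"
        using cInf_lessD[OF _ elim[unfolded mass_infdist_def]] ne by blast
      obtain R where R: "orthogonal_matrix R" "y = (\<chi> a. R *v (s $ a))"
        using y(1) by (auto simp: rotation_orbit_def rotation_matrix_def)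
      have "norm (R *v (s $ a - s $ b)) = norm (s $ a - s $ b)"
        using R(1) orthogonal_transformation_matrix[of "(*v) R"] orthogonal_transformation_norm
        by (metis matrix_of_matrix_vector_mul matrix_vector_mul_linear)
      then have yab: "norm (y $ a - y $ b) = norm (s $ a - s $ b)"
        by (simp add: R(2) matrix_vector_mult_diff_distrib)
      have xab: "norm (?x $ a - ?x $ b) = norm (q t $ a - q t $ b) / mass_norm m (q t)"
        using mn[of "q t"] by (simp add: scaleR_diff_right[symmetric] divide_inverse mult.commute)
      have "\<bar>norm (?x $ a - ?x $ b) - norm (y $ a - y $ b)\<bar> \<le> norm ((?x $ a - ?x $ b) - (y $ a - y $ b))"
        by (rule norm_triangle_ineq3)
      also have "\<dots> = norm ((?x - y) $ a - (?x - y) $ b)" by (simp add: algebra_simps)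
      also have "\<dots> \<le> norm ((?x - y) $ a) + norm ((?x - y) $ b)" by (rule norm_triangle_ineq4)
      also have "\<dots> \<le> mass_norm m (?x - y) / sqrt (m a) + mass_norm m (?x - y) / sqrt (m b)"
        by (intro add_mono component_le_mass_norm m)
      also have "\<dots> = mass_norm m (?x - y) * K" by (simp add: K_def algebra_simps)
      also have "\<dots> < e" using y(2) K by (simp add: pos_less_divide_eq)
      finally show ?case unfolding xab yab dist_real_def .
    qed
  qed
qed

subsection \<open>Asymptotics of the size at total collision\<close>

lemma newton_solution_acceleration:
  assumes m: "\<And>a. m a > 0" and "newton_solution m t0 T q"
  obtains v where "\<And>t. t \<in> {t0..<T} \<Longrightarrow> (q has_vector_derivative v t) (at t within {t0..<T})"
    and "\<And>t. t \<in> {t0..<T} \<Longrightarrow> (v has_vector_derivative acceleration m (q t)) (at t within {t0..<T})"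
    and "\<And>t. t \<in> {t0..<T} \<Longrightarrow> q t \<in> centered m" "\<And>t. t \<in> {t0..<T} \<Longrightarrow> q t \<in> collision_free"
proof -
  obtain v w where c: "\<forall>t\<in>{t0..<T}. q t \<in> centered m \<inter> collision_free"
    and vw: "\<And>t. t \<in> {t0..<T} \<Longrightarrow> (q has_vector_derivative v t) (at t within {t0..<T})"
      "\<And>t. t \<in> {t0..<T} \<Longrightarrow> (v has_vector_derivative w t) (at t within {t0..<T})"
      "\<And>t. t \<in> {t0..<T} \<Longrightarrow> has_mass_gradient m (force_function m) (q t) (w t)"
    using assms(2) unfolding newton_solution_def by blast
  have "w t = acceleration m (q t)" if "t \<in> {t0..<T}" for t
    using has_mass_gradient_unique[OF m vw(3)[OF that] force_function_has_mass_gradient] c that by simp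
  then show ?thesis using that[OF vw(1)] vw(2) c by (metis Int_iff)
qed

lemma mass_inner_eq_inner:
  assumes "\<And>a. m a > 0"
  shows "mass_inner m x y = (\<chi> a. sqrt (m a) *\<^sub>R x $ a) \<bullet> (\<chi> a. sqrt (m a) *\<^sub>R y $ a)"
  using assms by (simp add: mass_inner_def inner_vec_def[of "vec_lambda _"] mult.assoc[symmetric] less_imp_le)

lemma mass_inner_Cauchy_Schwarz:
  assumes "\<And>a. m a > 0"
  shows "(mass_inner m x y)\<^sup>2 \<le> mass_inner m x x * mass_inner m y y"
  unfolding mass_inner_eq_inner[OF assms] by (rule Cauchy_Schwarz_ineq)

lemma mass_norm_square:
  assumes "\<And>a. m a > 0"
  shows "(mass_norm m x)\<^sup>2 = mass_inner m x x"
  using mass_inner_self_nonneg[where m = m and x = x, OF assms] by (simp add: mass_norm_def)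

lemma mass_norm_pos:
  fixes q :: "('d::finite, 'n::{finite,linorder}) config"
  assumes "\<And>a. m a > 0" and "q \<in> collision_free" and "CARD('n) \<ge> 2"
  shows "mass_norm m q > 0"
proof (rule ccontr)
  assume "\<not> mass_norm m q > 0"
  then have "mass_inner m q q = 0"
    using mass_inner_self_nonneg[where m = m and x = q, OF assms(1)] by (simp add: mass_norm_def)
  then have "q = 0" using mass_inner_self_eq_0[where m = m and x = q, OF assms(1)] by simp
  \<comment> \<open>At the origin every summand is a division by zero, hence 0, which contradicts
    positivity.\<close>
  then have "force_function m q = 0" by (simp add: force_function_eq)
  then show False using force_function_pos[where m = m and q = q, OF assms] by simp
qed

lemma energy_conservation:
  fixes q v :: "real \<Rightarrow> ('d::finite, 'n::{finite,linorder}) config"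
  assumes dq: "\<And>t. t \<in> {t0..<T} \<Longrightarrow> (q has_vector_derivative v t) (at t within {t0..<T})"
    and dv: "\<And>t. t \<in> {t0..<T} \<Longrightarrow> (v has_vector_derivative acceleration m (q t)) (at t within {t0..<T})"
    and free: "\<And>t. t \<in> {t0..<T} \<Longrightarrow> q t \<in> collision_free"
  obtains h where "\<And>t. t \<in> {t0..<T} \<Longrightarrow> mass_inner m (v t) (v t) = 2 * (force_function m (q t) + h)"
proof -
  let ?E = "\<lambda>t. mass_inner m (v t) (v t) / 2 - force_function m (q t)"
  have "(?E has_derivative (\<lambda>_. 0)) (at t within {t0..<T})" if t: "t \<in> {t0..<T}" for t
  proof -
    have "((\<lambda>t. mass_inner m (v t) (v t)) has_vector_derivative
        mass_inner m (v t) (acceleration m (q t)) + mass_inner m (acceleration m (q t)) (v t)) (at t within {t0..<T})"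
      by (rule bounded_bilinear.has_vector_derivative[OF bilinear_mass_inner dv[OF t] dv[OF t]])
    then have 1: "((\<lambda>t. mass_inner m (v t) (v t)) has_derivative (\<lambda>x. x * (2 * mass_inner m (acceleration m (q t)) (v t)))) (at t within {t0..<T})"
      using mass_inner_commute[of m "v t" "acceleration m (q t)"] by (simp add: has_vector_derivative_def)
    have "(force_function m has_derivative (\<lambda>h. mass_inner m (acceleration m (q t)) h)) (at (q t))"
      using force_function_has_mass_gradient[OF free[OF t]] by (simp add: has_mass_gradient_def)
    then have 2: "((\<lambda>t. force_function m (q t)) has_derivative (\<lambda>x. mass_inner m (acceleration m (q t)) (x *\<^sub>R v t))) (at t within {t0..<T})"
      by (rule has_derivative_compose[OF dq[OF t, unfolded has_vector_derivative_def]])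
    show ?thesis
      using has_derivative_diff[OF bounded_linear.has_derivative[OF bounded_linear_divide[of 2] 1] 2]
      by (simp add: mass_inner_scaleR)
  qed
  then obtain h where "\<And>t. t \<in> {t0..<T} \<Longrightarrow> ?E t = h"
    using has_derivative_zero_constant[of "{t0..<T}" ?E] by auto
  then have "mass_inner m (v t) (v t) = 2 * (force_function m (q t) + h)" if "t \<in> {t0..<T}" for t
    using that by (smt (verit) field_sum_of_halves)
  then show ?thesis by (rule that)
qed

text \<open>The moment of inertia obeys the scalar equation \<open>(r r')' = U + 2 h\<close> with \<open>U \<sim> \<lambda> / r\<close>; two
  applications of l'Hopital's rule integrate it.\<close>
lemma total_collision_asymptotics:
  fixes q v :: "real \<Rightarrow> ('d::finite, 'n::{finite,linorder}) config"
  assumes m: "\<And>a. m a > 0" and card: "CARD('n) \<ge> 2" and "t0 < T"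
    and dq: "\<And>t. t \<in> {t0..<T} \<Longrightarrow> (q has_vector_derivative v t) (at t within {t0..<T})"
    and dv: "\<And>t. t \<in> {t0..<T} \<Longrightarrow> (v has_vector_derivative acceleration m (q t)) (at t within {t0..<T})"
    and free: "\<And>t. t \<in> {t0..<T} \<Longrightarrow> q t \<in> collision_free"
    and coll: "(q \<longlongrightarrow> 0) (at_left T)"
    and s: "s \<in> collision_free"
    and shape: "\<And>a b. ((\<lambda>t. norm (q t $ a - q t $ b) / mass_norm m (q t)) \<longlongrightarrow> norm (s $ a - s $ b)) (at_left T)"
  defines "r \<equiv> \<lambda>t. mass_norm m (q t)"
  shows "((\<lambda>t. r t ^ 3 / (T - t)\<^sup>2) \<longlongrightarrow> 9 / 2 * force_function m s) (at_left T)" (is ?A)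
    and "\<exists>K. eventually (\<lambda>t. r t \<le> K * (T - t) powr (2/3) \<and> mass_norm m (v t) \<le> K * (T - t) powr (-1/3)) (at_left T)" (is ?B)
proof -
  define l where "l = force_function m s"
  have l: "l > 0" unfolding l_def by (rule force_function_pos[OF m s card])
  define U where "U = (\<lambda>t. force_function m (q t))"
  define j where "j = (\<lambda>t. mass_inner m (q t) (v t))"
  obtain h where h: "\<And>t. t \<in> {t0..<T} \<Longrightarrow> mass_inner m (v t) (v t) = 2 * (U t + h)"
    using energy_conservation[OF dq dv free] unfolding U_def by blast
  have inT: "eventually (\<lambda>t. t \<in> {t0<..<T}) (at_left T)"
    using \<open>t0 < T\<close> by (rule eventually_at_leftI[rotated]) simp
  have rpos: "r t > 0" if "t \<in> {t0..<T}" for t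
    unfolding r_def by (rule mass_norm_pos[OF m free[OF that] card])
  have rne: "r t \<noteq> 0" if "t \<in> {t0<..<T}" for t using rpos[of t] that by simp
  have r2: "(r t)\<^sup>2 = mass_inner m (q t) (q t)" for t unfolding r_def by (rule mass_norm_square[OF m])
  have at: "at t within {t0..<T} = at t" if "t \<in> {t0<..<T}" for t
    using that by (intro at_within_nhd[of _ "{t0<..<T}"]) auto
  have dj: "(j has_real_derivative U t + 2 * h) (at t)" if t: "t \<in> {t0<..<T}" for t
  proof -
    have t': "t \<in> {t0..<T}" using t by simp
    have "(j has_vector_derivative mass_inner m (q t) (acceleration m (q t)) + mass_inner m (v t) (v t)) (at t within {t0..<T})"
      unfolding j_def by (rule bounded_bilinear.has_vector_derivative[OF bilinear_mass_inner dq[OF t'] dv[OF t']])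
    then show ?thesis
      using h[OF t'] mass_inner_acceleration_self[of m "q t"]
      by (simp add: at[OF t] has_real_derivative_iff_has_vector_derivative mass_inner_commute[of m "q t"] U_def)
  qed
  have dr: "(r has_real_derivative j t / r t) (at t)" if t: "t \<in> {t0<..<T}" for t
  proof -
    have t': "t \<in> {t0..<T}" using t by simp
    have "((\<lambda>t. mass_inner m (q t) (q t)) has_vector_derivative mass_inner m (q t) (v t) + mass_inner m (v t) (q t)) (at t within {t0..<T})"
      by (rule bounded_bilinear.has_vector_derivative[OF bilinear_mass_inner dq[OF t'] dq[OF t']])
    then have 1: "((\<lambda>t. mass_inner m (q t) (q t)) has_real_derivative 2 * j t) (at t)"
      by (simp add: at[OF t] has_real_derivative_iff_has_vector_derivative mass_inner_commute[of m "v t"] j_def)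
    have 2: "mass_inner m (q t) (q t) > 0" using rpos[OF t'] r2[of t] by (metis zero_less_power)
    show ?thesis
      unfolding r_def mass_norm_def
      using DERIV_chain2[OF DERIV_real_sqrt[OF 2] 1] by (simp add: field_simps)
  qed
  have r0: "(r \<longlongrightarrow> 0) (at_left T)"
  proof -
    have "((\<lambda>t. mass_inner m (q t) (q t)) \<longlongrightarrow> 0) (at_left T)"
      using bounded_bilinear.tendsto_zero[OF bilinear_mass_inner coll coll] by simp
    then show ?thesis unfolding r_def mass_norm_def using tendsto_real_sqrt by fastforce
  qed
  have Ur: "((\<lambda>t. U t * r t) \<longlongrightarrow> l) (at_left T)"
  proof -
    have "((\<lambda>t. (\<Sum>a\<in>UNIV. \<Sum>b\<in>UNIV. m a * m b / (norm (q t $ a - q t $ b) / r t)) / 2) \<longlongrightarrow> l) (at_left T)"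
      unfolding l_def force_function_eq
    proof (rule tendsto_divide[OF tendsto_sum[OF tendsto_sum] tendsto_const])
      fix a b
      show "((\<lambda>t. m a * m b / (norm (q t $ a - q t $ b) / r t)) \<longlongrightarrow> m a * m b / norm (s $ a - s $ b)) (at_left T)"
      proof (cases "a = b")
        case False
        then show ?thesis using shape[of a b] s unfolding r_def
          by (intro tendsto_divide tendsto_const) (auto simp: collision_free_def)
      qed simp
    qed simp
    moreover have "(\<Sum>a\<in>UNIV. \<Sum>b\<in>UNIV. m a * m b / (norm (q t $ a - q t $ b) / r t)) / 2 = U t * r t" for t
      by (simp add: U_def force_function_eq sum_distrib_right)
    ultimately show ?thesis by simp
  qed
  have Uhr: "((\<lambda>t. U t * r t + c * r t) \<longlongrightarrow> l) (at_left T)" for c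
    using tendsto_add[OF Ur tendsto_mult_right_zero[OF r0, of c]] by simp
  \<comment> \<open>By Cauchy-Schwarz and the energy integral, the square of \<open>j\<close> is at
    most \<open>2 * r * (U * r + h * r)\<close>, and \<open>U * r\<close> stays bounded.\<close>
  have j0: "(j \<longlongrightarrow> 0) (at_left T)"
  proof -
    have "((\<lambda>t. 2 * (r t * (U t * r t + h * r t))) \<longlongrightarrow> 2 * (0 * l)) (at_left T)"
      by (intro tendsto_intros r0 Uhr)
    then have "((\<lambda>t. sqrt (2 * (r t * (U t * r t + h * r t)))) \<longlongrightarrow> 0) (at_left T)"
      using tendsto_real_sqrt by fastforce
    moreover have "eventually (\<lambda>t. norm (j t) \<le> sqrt (2 * (r t * (U t * r t + h * r t)))) (at_left T)"
      using inT
    proof eventually_elim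
      case (elim t)
      have "(j t)\<^sup>2 \<le> (r t)\<^sup>2 * (2 * (U t + h))"
        using mass_inner_Cauchy_Schwarz[where m = m and x = "q t" and y = "v t", OF m] h[of t] elim
        by (simp add: j_def r2)
      also have "\<dots> = 2 * (r t * (U t * r t + h * r t))" by (simp add: power2_eq_square algebra_simps)
      finally have "sqrt ((j t)\<^sup>2) \<le> sqrt (2 * (r t * (U t * r t + h * r t)))" by (rule real_sqrt_le_mono)
      then show ?case by simp
    qed
    ultimately show ?thesis by (rule Lim_null_comparison[rotated])
  qed
  \<comment> \<open>Near \<open>T\<close> the derivative \<open>U + 2 * h\<close> is positive
    because \<open>U * r\<close> tends to \<open>l > 0\<close> while \<open>h * r\<close> tends to
    0. So \<open>j\<close> increases strictly to its limit 0. The sign is needed to divide by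
    \<open>j\<close> and to choose the root of its square.\<close>
  have jneg: "eventually (\<lambda>t. j t < 0) (at_left T)"
  proof -
    have "eventually (\<lambda>t. t \<in> {t0<..<T} \<and> U t * r t + 2 * h * r t > 0) (at_left T)"
      using order_tendstoD(1)[OF Uhr l] inT by (rule eventually_conj[rotated])
    then obtain t2 where t2: "t2 < T" "\<And>t. t \<in> {t2<..<T} \<Longrightarrow> t \<in> {t0<..<T} \<and> U t * r t + 2 * h * r t > 0"
      by (auto simp: eventually_at_left_field)
    have dpos: "U t + 2 * h > 0" if "t \<in> {t2<..<T}" for t
    proof -
      have "(U t + 2 * h) * r t > 0" using t2(2)[OF that] by (simp add: algebra_simps)
      then show ?thesis using rpos[of t] t2(2)[OF that] by (simp add: zero_less_mult_iff)
    qed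
    have inc: "j x < j y" if "t2 < x" "x < y" "y < T" for x y
    proof (rule DERIV_pos_imp_increasing[OF that(2)])
      fix z assume "x \<le> z" "z \<le> y"
      then have z: "z \<in> {t2<..<T}" using that by simp
      then show "\<exists>d. (j has_real_derivative d) (at z) \<and> d > 0" using dj dpos t2(2) by blast
    qed
    have "j x < 0" if x: "x \<in> {t2<..<T}" for x
    proof -
      obtain y where y: "x < y" "y < T" using x dense by auto
      have "eventually (\<lambda>t. j y \<le> j t) (at_left T)"
        by (rule eventually_at_leftI[OF _ y(2)]) (use inc[of y] x y in \<open>auto intro: less_imp_le\<close>)
      then have "j y \<le> 0" using tendsto_lowerbound[OF j0] by simp
      then show ?thesis using inc[of x y] x y by auto
    qed
    then show ?thesis using t2(1) by (rule eventually_at_leftI[of t2])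
  qed
  \<comment> \<open>The factor \<open>j\<close> cancels from the quotient of the derivatives, which
    becomes \<open>2 * r * (U + 2 * h)\<close>.\<close>
  have jr: "((\<lambda>t. (j t)\<^sup>2 / r t) \<longlongrightarrow> 2 * l) (at_left T)"
  proof (rule lhopital_left[where f' = "\<lambda>t. 2 * j t * (U t + 2 * h)" and g' = "\<lambda>t. j t / r t"])
    show "((\<lambda>t. (j t)\<^sup>2) \<longlongrightarrow> 0) (at_left T)" using tendsto_power[OF j0, of 2] by simp
    show "eventually (\<lambda>t. r t \<noteq> 0) (at_left T)" using inT by eventually_elim (rule rne)
    show "eventually (\<lambda>t. j t / r t \<noteq> 0) (at_left T)" using inT jneg by eventually_elim (simp add: rne)
    show "eventually (\<lambda>t. ((\<lambda>t. (j t)\<^sup>2) has_real_derivative 2 * j t * (U t + 2 * h)) (at t)) (at_left T)"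
      using inT by eventually_elim (auto intro!: derivative_eq_intros dj)
    show "eventually (\<lambda>t. (r has_real_derivative j t / r t) (at t)) (at_left T)"
      using inT by eventually_elim (rule dr)
    have "((\<lambda>t. 2 * (U t * r t + 2 * h * r t)) \<longlongrightarrow> 2 * l) (at_left T)"
      by (intro tendsto_intros Uhr)
    then show "((\<lambda>t. 2 * j t * (U t + 2 * h) / (j t / r t)) \<longlongrightarrow> 2 * l) (at_left T)"
    proof (rule Lim_transform_eventually)
      show "eventually (\<lambda>t. 2 * (U t * r t + 2 * h * r t) = 2 * j t * (U t + 2 * h) / (j t / r t)) (at_left T)"
        using jneg inT
      proof eventually_elim
        case (elim t)
        have "j t \<noteq> 0" "r t \<noteq> 0" using elim rne by auto
        then show ?case by (simp add: field_simps)
      qed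
    qed
  qed (rule r0)
  \<comment> \<open>Since \<open>r' = j / r\<close>, the derivative of the 3/2 power of
    \<open>r\<close> is 3/2 times \<open>j / sqrt r\<close>, whose absolute value has just been
    determined. Squaring the limit yields the constant \<open>9/2 * l\<close>.\<close>
  have "((\<lambda>t. (r t * sqrt (r t)) / (T - t)) \<longlongrightarrow> 3/2 * sqrt (2 * l)) (at_left T)"
  proof (rule lhopital_left[where f' = "\<lambda>t. 3/2 * (sqrt (r t) * (j t / r t))" and g' = "\<lambda>_. - 1"])
    show "((\<lambda>t. r t * sqrt (r t)) \<longlongrightarrow> 0) (at_left T)"
      using tendsto_mult[OF r0 tendsto_real_sqrt[OF r0]] by simp
    show "((\<lambda>t. T - t) \<longlongrightarrow> 0) (at_left T)" by (auto intro!: tendsto_eq_intros)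
    show "eventually (\<lambda>t. T - t \<noteq> 0) (at_left T)" using inT by eventually_elim simp
    show "eventually (\<lambda>t. ((\<lambda>t. r t * sqrt (r t)) has_real_derivative 3/2 * (sqrt (r t) * (j t / r t))) (at t)) (at_left T)"
      using inT
    proof eventually_elim
      case (elim t)
      have rp: "r t > 0" using rpos[of t] elim by simp
      note D = DERIV_mult[OF dr[OF elim] DERIV_chain2[OF DERIV_real_sqrt[OF rp] dr[OF elim]]]
      have "r t = sqrt (r t) * sqrt (r t)" using rp by simp
      then have "j t / r t * sqrt (r t) + inverse (sqrt (r t)) / 2 * (j t / r t) * r t = 3/2 * (sqrt (r t) * (j t / r t))"
        using rp by (simp add: field_simps)
      then show ?case using D by simp
    qed
    show "eventually (\<lambda>t. ((\<lambda>t. T - t) has_real_derivative - 1) (at t)) (at_left T)"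
      by (intro always_eventually allI) (auto intro!: derivative_eq_intros)
    have "((\<lambda>t. 3/2 * sqrt ((j t)\<^sup>2 / r t)) \<longlongrightarrow> 3/2 * sqrt (2 * l)) (at_left T)"
      by (intro tendsto_intros jr)
    then show "((\<lambda>t. 3/2 * (sqrt (r t) * (j t / r t)) / - 1) \<longlongrightarrow> 3/2 * sqrt (2 * l)) (at_left T)"
    proof (rule Lim_transform_eventually)
      show "eventually (\<lambda>t. 3/2 * sqrt ((j t)\<^sup>2 / r t) = 3/2 * (sqrt (r t) * (j t / r t)) / - 1) (at_left T)"
        using inT jneg
      proof eventually_elim
        case (elim t)
        have rp: "r t > 0" using rpos[of t] elim by simp
        have "sqrt ((j t)\<^sup>2 / r t) = - (j t / sqrt (r t))" using elim by (simp add: real_sqrt_divide)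
        also have "\<dots> = - (sqrt (r t) * (j t / r t))"
        proof -
          have "r t = sqrt (r t) * sqrt (r t)" using rp by simp
          then show ?thesis using rp by (simp add: field_simps)
        qed
        finally show ?case by simp
      qed
    qed
  qed simp
  note sqlim = tendsto_power[OF this, of 2]
  have "(3/2 * sqrt (2 * l))\<^sup>2 = 9/2 * l"
    using l unfolding power_mult_distrib by (simp add: power2_eq_square)
  then have lim: "((\<lambda>t. ((r t * sqrt (r t)) / (T - t))\<^sup>2) \<longlongrightarrow> 9/2 * l) (at_left T)"
    using sqlim by (simp only:)
  show A: ?A
    unfolding l_def[symmetric] using lim
  proof (rule Lim_transform_eventually)
    show "eventually (\<lambda>t. ((r t * sqrt (r t)) / (T - t))\<^sup>2 = r t ^ 3 / (T - t)\<^sup>2) (at_left T)"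
      using inT
    proof eventually_elim
      case (elim t)
      have "r t > 0" using rpos[of t] elim by simp
      then show ?case by (simp add: power_divide power_mult_distrib power2_eq_square power3_eq_cube)
    qed
  qed
  have l1: "((\<lambda>t. (r t ^ 3 / (T - t)\<^sup>2) powr (1/3)) \<longlongrightarrow> (9/2 * l) powr (1/3)) (at_left T)"
    using A l unfolding l_def[symmetric] by (intro tendsto_powr tendsto_const) auto
  have root: "(r t ^ 3 / (T - t)\<^sup>2) powr (1/3) = r t / (T - t) powr (2/3)" if "t \<in> {t0<..<T}" for t
  proof -
    have "r t > 0" "T - t > 0" using rpos[of t] that by auto
    then show ?thesis by (simp add: powr_divide powr_powr flip: powr_numeral)
  qed
  have e1: "eventually (\<lambda>t. (r t ^ 3 / (T - t)\<^sup>2) powr (1/3) < (9/2 * l) powr (1/3) + 1) (at_left T)"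
    by (rule order_tendstoD(2)[OF l1]) simp
  have l2: "((\<lambda>t. 2 * (U t * r t + h * r t) / (r t ^ 3 / (T - t)\<^sup>2) powr (1/3)) \<longlongrightarrow> 2 * l / (9/2 * l) powr (1/3)) (at_left T)"
    using l by (intro tendsto_intros Uhr l1) auto
  have e2: "eventually (\<lambda>t. 2 * (U t * r t + h * r t) / (r t ^ 3 / (T - t)\<^sup>2) powr (1/3) < 2 * l / (9/2 * l) powr (1/3) + 1) (at_left T)"
    by (rule order_tendstoD(2)[OF l2]) simp
  define K where "K = max ((9/2 * l) powr (1/3) + 1) (sqrt (2 * l / (9/2 * l) powr (1/3) + 1))"
  have "eventually (\<lambda>t. r t \<le> K * (T - t) powr (2/3) \<and> mass_norm m (v t) \<le> K * (T - t) powr (-1/3)) (at_left T)"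
    using inT e1 e2
  proof eventually_elim
    case (elim t)
    have pos: "r t > 0" "T - t > 0" using rpos[of t] elim by auto
    have "r t / (T - t) powr (2/3) \<le> K" using elim root[of t] by (simp add: K_def)
    then have 1: "r t \<le> K * (T - t) powr (2/3)" using pos by (simp add: pos_divide_le_eq)
    \<comment> \<open>The energy integral turns the size estimate into the velocity estimate: the
      kinetic term behaves like \<open>2 * l / r\<close>.\<close>
    have "mass_inner m (v t) (v t) * (T - t) powr (2/3) = 2 * (U t * r t + h * r t) / (r t / (T - t) powr (2/3))"
      using pos h[of t] elim by (simp add: field_simps)
    also have "\<dots> \<le> 2 * l / (9/2 * l) powr (1/3) + 1" using elim root[of t] by simp
    finally have "sqrt (mass_inner m (v t) (v t) * (T - t) powr (2/3)) \<le> K"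
      by (metis K_def real_sqrt_le_mono max.coboundedI2)
    moreover have "sqrt ((T - t) powr (2/3)) = (T - t) powr (1/3)"
      using pos by (simp add: powr_half_sqrt[symmetric] powr_powr)
    ultimately have "mass_norm m (v t) * (T - t) powr (1/3) \<le> K"
      by (simp add: mass_norm_def real_sqrt_mult)
    then have "mass_norm m (v t) \<le> K * (T - t) powr (-1/3)"
      using pos by (simp add: powr_minus field_simps)
    with 1 show ?case ..
  qed
  then show ?B by blast
qed

subsection \<open>Spectral gap in the normal directions\<close>

text \<open>The quadratic form attains its minimum on the compact unit sphere of \<open>N\<close>,
  and a minimiser is an eigenvector because the first variation vanishes. Strictness for eigenvalues
  therefore gives a uniform gap \<open>\<eta>\<close>.\<close>

lemma symmetric_spectral_gap:
  fixes L :: "'a::euclidean_space \<Rightarrow> 'a"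
  assumes L: "linear L" "\<And>x y. L x \<bullet> y = x \<bullet> L y" and N: "subspace N" "\<And>x. x \<in> N \<Longrightarrow> L x \<in> N"
    and eig: "\<And>x \<alpha>. x \<in> N \<Longrightarrow> x \<noteq> 0 \<Longrightarrow> L x = \<alpha> *\<^sub>R x \<Longrightarrow> \<alpha> > \<mu>"
  shows "\<exists>\<eta>>0. \<forall>x\<in>N. (\<mu> + \<eta>) * (norm x)\<^sup>2 \<le> L x \<bullet> x"
proof (cases "N \<subseteq> {0}")
  case True
  then show ?thesis by (intro exI[of _ 1]) auto
next
  case False
  interpret L: linear L by fact
  let ?S = "sphere 0 1 \<inter> N"
  obtain x0 where "x0 \<in> N" "x0 \<noteq> 0" using False by auto
  then have "sgn x0 \<in> ?S" using N(1) by (auto simp: norm_sgn sgn_div_norm subspace_scale)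
  moreover have "compact ?S" by (intro compact_Int_closed closed_subspace N) simp
  moreover have "continuous_on ?S (\<lambda>x. L x \<bullet> x)"
    by (intro continuous_intros linear_continuous_on L(1)[unfolded linear_conv_bounded_linear])
  ultimately obtain e where e: "e \<in> ?S" "\<And>x. x \<in> ?S \<Longrightarrow> L e \<bullet> e \<le> L x \<bullet> x"
    using continuous_attains_inf[of ?S] by blast
  define \<alpha> where "\<alpha> = L e \<bullet> e"
  have min: "\<alpha> * (norm x)\<^sup>2 \<le> L x \<bullet> x" if x: "x \<in> N" for x
  proof (cases "x = 0")
    case False
    then have "x /\<^sub>R norm x \<in> ?S" using N(1) x by (auto simp: subspace_scale)
    from e(2)[OF this] show ?thesis
      using False by (simp add: \<alpha>_def L.scale power2_eq_square field_simps)
  qed (simp add: L.zero)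
  define g where "g = L e - \<alpha> *\<^sub>R e"
  define G where "G = L g \<bullet> g - \<alpha> * (g \<bullet> g)"
  have ee: "e \<bullet> e = 1" using e(1) by (simp add: dot_square_norm)
  have gN: "g \<in> N" unfolding g_def using e(1) N by (auto intro: subspace_diff subspace_scale)
  have quad: "0 \<le> 2 * t * (g \<bullet> g) + t\<^sup>2 * G" for t
  proof -
    have "e + t *\<^sub>R g \<in> N" using e(1) gN N(1) by (auto intro: subspace_add subspace_scale)
    from min[OF this] have "\<alpha> * ((e + t *\<^sub>R g) \<bullet> (e + t *\<^sub>R g)) \<le> L (e + t *\<^sub>R g) \<bullet> (e + t *\<^sub>R g)"
      by (simp add: power2_norm_eq_inner)
    moreover have "L g \<bullet> e = L e \<bullet> g" using L(2)[of g e] by (simp add: inner_commute)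
    moreover have "L e = g + \<alpha> *\<^sub>R e" by (simp add: g_def)
    moreover have "g \<bullet> e = 0" by (simp add: g_def inner_diff_left ee \<alpha>_def)
    ultimately show ?thesis
      by (simp add: L.add L.scale inner_add_left inner_add_right ee G_def inner_commute[of e g] power2_eq_square algebra_simps)
  qed
  have "g = 0"
  proof (rule ccontr)
    assume "g \<noteq> 0"
    then have gp: "g \<bullet> g > 0" by simp
    \<comment> \<open>If \<open>g\<close> were nonzero, the small negative step
      \<open>t = - (g \<bullet> g) / c\<close> would let the linear term of \<open>quad\<close> win
      over the quadratic one.\<close>
    define c where "c = \<bar>G\<bar> + 1"
    have c: "c > 0" "G \<le> c" by (auto simp: c_def)
    have "0 \<le> 2 * (- (g \<bullet> g / c)) * (g \<bullet> g) + (- (g \<bullet> g / c))\<^sup>2 * G" by (rule quad)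
    also have "\<dots> \<le> 2 * (- (g \<bullet> g / c)) * (g \<bullet> g) + (- (g \<bullet> g / c))\<^sup>2 * c"
      using c by (intro add_left_mono mult_left_mono) auto
    also have "\<dots> = - ((g \<bullet> g) * (g \<bullet> g) / c)"
      using c by (simp add: power2_eq_square field_simps)
    finally have "(g \<bullet> g) * (g \<bullet> g) / c \<le> 0" by simp
    moreover have "(g \<bullet> g) * (g \<bullet> g) / c > 0" by (intro divide_pos_pos mult_pos_pos gp c)
    ultimately show False by linarith
  qed
  then have "L e = \<alpha> *\<^sub>R e" by (simp add: g_def)
  then have "\<alpha> > \<mu>" using eig[of e \<alpha>] e(1) ee by fastforce
  then show ?thesis using min by (intro exI[of _ "\<alpha> - \<mu>"]) auto
qed

text \<open>A Dziobek configuration: the mass Laplacian minus \<open>\<mu>\<close> has rank one modulo the total-mass direction,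
  so its off-diagonal entries are products \<open>\<kappa> \<nu>\<^sub>a \<nu>\<^sub>b\<close>; comparing with
  \<open>\<Sum> D\<^sub>a D\<^sub>b \<bar>s\<^sub>a - s\<^sub>b\<bar>\<^sup>2 = 0\<close>, where \<open>D\<^sub>a = \<surd>m\<^sub>a \<nu>\<^sub>a\<close>, gives the sign of \<open>\<kappa>\<close>.\<close>
lemma dziobek_normal_eigenvalue:
  fixes s :: "('d::finite, 'n::finite) config"
  assumes m: "\<And>a. m a > 0" and free: "s \<in> collision_free" and "\<mu> > 0"
    and dim: "dim (range (mass_row m s)) + 2 = CARD('n)"
    and L_row: "\<And>c. mass_laplacian m (inverse_cubes s) (mass_row m s c) = \<mu> *\<^sub>R mass_row m s c"
    and centered: "\<And>c. mass_row m s c \<bullet> (\<chi> a. sqrt (m a)) = 0"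
    and \<nu>: "\<nu> \<noteq> 0" "\<nu> \<bullet> (\<chi> a. sqrt (m a)) = 0" "\<And>c. \<nu> \<bullet> mass_row m s c = 0"
    and eig: "mass_laplacian m (inverse_cubes s) \<nu> = \<alpha> *\<^sub>R \<nu>"
  shows "\<alpha> > \<mu>"
proof (rule ccontr)
  assume neg: "\<not> \<alpha> > \<mu>"
  let ?L = "mass_laplacian m (inverse_cubes s)" and ?e0 = "(\<chi> a. sqrt (m a)) :: real ^ 'n" and ?P = "range (mass_row m s)"
  interpret L: linear ?L by (rule linear_mass_laplacian)
  define M where "M = (\<Sum>a\<in>UNIV. m a)"
  have M: "M > 0" unfolding M_def using m by (simp add: sum_pos)
  have e0e0: "?e0 \<bullet> ?e0 = M" using m by (simp add: inner_vec_def M_def less_imp_le)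
  then have e0: "?e0 \<noteq> 0" using M by auto
  have Le0: "?L ?e0 = 0" by (rule mass_laplacian_total)
  \<comment> \<open>The last term makes \<open>R\<close> vanish on the total-mass direction too. As
    \<open>R\<close> also vanishes on the coordinate functions and the dimensions leave just one
    further direction, \<open>R\<close> is a multiple of the projection to
    \<open>\<nu>\<close>.\<close>
  define R where "R = (\<lambda>x. ?L x - \<mu> *\<^sub>R x + (\<mu> / M * (x \<bullet> ?e0)) *\<^sub>R ?e0)"
  have linR: "linear R"
    unfolding R_def by (intro linearI) (simp_all add: L.add L.scale inner_add_left algebra_simps)
  interpret R: linear R by (rule linR)
  define S where "S = insert ?e0 ?P"
  have R0: "R x = 0" if "x \<in> span S" for x
  proof (rule linear_eq_0_on_span[OF linR _ that])
    show "R x = 0" if "x \<in> S" for x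
      using that M L_row centered by (auto simp: S_def R_def Le0 e0e0)
  qed
  define W where "W = {y \<in> UNIV. \<forall>x \<in> span S. orthogonal x y}"
  have \<nu>W: "\<nu> \<in> W"
  proof -
    have "orthogonal \<nu> x" if "x \<in> span S" for x
      by (rule orthogonal_to_span[OF that]) (use \<nu> in \<open>auto simp: S_def orthogonal_def\<close>)
    then show ?thesis by (simp add: W_def orthogonal_commute)
  qed
  have "?e0 \<notin> span ?P"
  proof
    assume "?e0 \<in> span ?P"
    then have "orthogonal ?e0 ?e0"
      by (rule orthogonal_to_span) (use centered in \<open>auto simp: orthogonal_def inner_commute\<close>)
    then show False using e0 by (simp add: orthogonal_def)
  qed
  then have "dim S = dim ?P + 1" by (simp add: S_def dim_insert)
  then have "dim W = 1"
    using dim_subspace_orthogonal_to_vectors[of "span S" "UNIV :: (real ^ 'n) set"] dim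
    by (simp add: W_def)
  then have Wspan: "W \<subseteq> span {\<nu>}"
    using \<nu>W \<nu>(1) by (intro card_ge_dim_independent) auto
  have Rx: "R x = ((\<alpha> - \<mu>) / (\<nu> \<bullet> \<nu>) * (x \<bullet> \<nu>)) *\<^sub>R \<nu>" for x
  proof -
    obtain p y where py: "p \<in> span S" "\<And>w. w \<in> span S \<Longrightarrow> orthogonal y w" "x = p + y"
      using orthogonal_subspace_decomp_exists[of S x] by metis
    have "y \<in> W" using py(2) by (simp add: W_def orthogonal_commute)
    then obtain k where k: "y = k *\<^sub>R \<nu>" using Wspan by (auto simp: span_singleton)
    have "p \<bullet> \<nu> = 0" using \<nu>W py(1) by (simp add: W_def orthogonal_def)
    then have "x \<bullet> \<nu> = k * (\<nu> \<bullet> \<nu>)" by (simp add: py(3) k inner_add_left)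
    moreover have "R \<nu> = (\<alpha> - \<mu>) *\<^sub>R \<nu>" by (simp add: R_def eig \<nu>(2) algebra_simps)
    then have "R x = (k * (\<alpha> - \<mu>)) *\<^sub>R \<nu>" by (simp add: py(3) R.add R0[OF py(1)] k R.scale)
    ultimately show ?thesis using \<nu>(1) by simp
  qed
  define \<kappa> where "\<kappa> = (\<alpha> - \<mu>) / (\<nu> \<bullet> \<nu>)"
  have \<kappa>: "\<kappa> \<le> 0" unfolding \<kappa>_def using neg by (simp add: divide_nonpos_nonneg)
  define D where "D = (\<lambda>a. sqrt (m a) * \<nu> $ a)"
  let ?d = "\<lambda>a b. norm (s $ a - s $ b)"
  have entry: "m a * m b * (\<mu> / M - inverse_cubes s a b) = \<kappa> * (D a * D b)" if "a \<noteq> b" for a b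
  proof -
    have "?L (axis b 1) $ a = - (inverse_cubes s a b * sqrt (m b) * sqrt (m a))"
    proof -
      have "?L (axis b 1) $ a = (\<Sum>c\<in>UNIV. if c = b then - (inverse_cubes s a b * sqrt (m b) * sqrt (m a)) else 0)"
        unfolding mass_laplacian_def vec_lambda_beta
        by (intro sum.cong refl) (use that in \<open>auto simp: axis_def\<close>)
      then show ?thesis by simp
    qed
    then have "R (axis b 1) $ a = (\<mu> / M - inverse_cubes s a b) * (sqrt (m a) * sqrt (m b))"
    proof -
      have "axis b (1::real) $ a = 0" using that by (simp add: axis_def)
      with \<open>?L (axis b 1) $ a = _\<close> show ?thesis by (simp add: R_def inner_axis' algebra_simps)
    qed
    moreover have "R (axis b 1) $ a = \<kappa> * \<nu> $ b * \<nu> $ a"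
      unfolding Rx \<kappa>_def by (simp add: inner_axis')
    ultimately have "(\<mu> / M - inverse_cubes s a b) * (sqrt (m a) * sqrt (m b)) * (sqrt (m a) * sqrt (m b)) = \<kappa> * \<nu> $ b * \<nu> $ a * (sqrt (m a) * sqrt (m b))"
      by simp
    moreover have "(sqrt (m a) * sqrt (m b)) * (sqrt (m a) * sqrt (m b)) = m a * m b"
      using m[of a] m[of b] by (simp add: real_sqrt_mult[symmetric])
    ultimately have "(\<mu> / M - inverse_cubes s a b) * (m a * m b) = \<kappa> * \<nu> $ b * \<nu> $ a * (sqrt (m a) * sqrt (m b))"
      by (simp only: mult.assoc)
    then show ?thesis by (simp add: D_def ac_simps)
  qed
  \<comment> \<open>The numbers \<open>D a\<close> form an affine dependence of the bodies. Hence
    expanding the squared distances in \<open>quad\<close> leaves nothing.\<close>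
  have sumD: "(\<Sum>a\<in>UNIV. D a) = 0"
    using \<nu>(2) by (simp add: inner_vec_def D_def mult.commute)
  have sumDs: "(\<Sum>a\<in>UNIV. D a *\<^sub>R s $ a) = 0"
  proof -
    have "(\<Sum>a\<in>UNIV. D a *\<^sub>R s $ a) \<bullet> c = \<nu> \<bullet> mass_row m s c" for c
      unfolding inner_vec_def[of \<nu>] by (simp add: inner_sum_left mass_row_def D_def ac_simps)
    then show ?thesis using \<nu>(3) by (metis inner_eq_zero_iff)
  qed
  have quad: "(\<Sum>a\<in>UNIV. \<Sum>b\<in>UNIV. D a * D b * (?d a b)\<^sup>2) = 0"
  proof -
    have "D a * D b * (?d a b)\<^sup>2 = D a * (s $ a \<bullet> s $ a) * D b + D a * (D b * (s $ b \<bullet> s $ b)) - 2 * ((D a *\<^sub>R s $ a) \<bullet> (D b *\<^sub>R s $ b))" for a b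
      by (simp add: power2_norm_eq_inner inner_diff_left inner_diff_right inner_commute algebra_simps)
    then have "(\<Sum>a\<in>UNIV. \<Sum>b\<in>UNIV. D a * D b * (?d a b)\<^sup>2)
      = (\<Sum>a\<in>UNIV. D a * (s $ a \<bullet> s $ a)) * (\<Sum>b\<in>UNIV. D b) + (\<Sum>a\<in>UNIV. D a) * (\<Sum>b\<in>UNIV. D b * (s $ b \<bullet> s $ b))
        - 2 * ((\<Sum>a\<in>UNIV. D a *\<^sub>R s $ a) \<bullet> (\<Sum>b\<in>UNIV. D b *\<^sub>R s $ b))"
      unfolding sum_product inner_sum_left unfolding inner_sum_right unfolding sum_distrib_left
      by (simp only: sum.distrib sum_subtractf)
    then show ?thesis by (simp add: sumD sumDs)
  qed
  \<comment> \<open>The distance at which an off-diagonal entry vanishes. Under the contrary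
    assumption \<open>\<kappa> \<le> 0\<close>, the sign of \<open>D a * D b\<close> is opposite to
    that of the distance minus \<open>\<rho>\<close>, where these differ.\<close>
  define \<rho> where "\<rho> = root 3 (M / \<mu>)"
  have \<rho>: "\<rho> > 0" "1 / \<rho> ^ 3 = \<mu> / M" using M \<open>\<mu> > 0\<close> by (simp_all add: \<rho>_def)
  have sign: "D a * D b * ((?d a b)\<^sup>2 - \<rho>\<^sup>2) \<le> 0" if "a \<noteq> b" for a b
  proof -
    have d: "?d a b > 0" using free that by (simp add: collision_free_def)
    have E: "m a * m b * (1 / \<rho> ^ 3 - 1 / ?d a b ^ 3) = \<kappa> * (D a * D b)"
      using entry[OF that] by (simp add: \<rho>(2) inverse_cubes_def)
    have mm: "m a * m b > 0" using m by simp
    consider "?d a b = \<rho>" | "?d a b > \<rho>" | "?d a b < \<rho>" by linarith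
    then show ?thesis
    proof cases
      case 2
      then have "1 / ?d a b ^ 3 < 1 / \<rho> ^ 3" using \<rho>(1) by (intro frac_less2 power_strict_mono) auto
      then have "\<kappa> * (D a * D b) > 0" using E mm by (metis diff_gt_0_iff_gt mult_pos_pos)
      then have "D a * D b < 0" using \<kappa> by (simp add: zero_less_mult_iff)
      moreover have "\<rho>\<^sup>2 \<le> (?d a b)\<^sup>2" using 2 \<rho> by (simp add: power_mono)
      ultimately show ?thesis by (simp add: mult_nonpos_nonneg)
    next
      case 3
      then have "1 / \<rho> ^ 3 < 1 / ?d a b ^ 3" using d by (intro frac_less2 power_strict_mono) auto
      then have "\<kappa> * (D a * D b) < 0" using E mm by (metis diff_less_0_iff_less mult_pos_neg)
      then have "D a * D b > 0" using \<kappa> by (simp add: mult_less_0_iff)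
      moreover have "(?d a b)\<^sup>2 \<le> \<rho>\<^sup>2" using 3 d by (simp add: power_mono)
      ultimately show ?thesis by (simp add: mult_nonneg_nonpos)
    qed simp
  qed
  \<comment> \<open>Subtracting \<open>\<rho>\<^sup>2\<close> does not change the sum, which is 0
    since the \<open>D a\<close> add up to 0. It makes all off-diagonal terms nonpositive, while the
    diagonal contributes \<open>- \<rho>\<^sup>2 * (D a)\<^sup>2\<close>.\<close>
  have "(\<Sum>a\<in>UNIV. \<Sum>b\<in>UNIV. D a * D b * ((?d a b)\<^sup>2 - \<rho>\<^sup>2)) \<le> (\<Sum>a\<in>UNIV. \<Sum>b\<in>UNIV. if a = b then - (\<rho>\<^sup>2 * (D a)\<^sup>2) else 0)"
    by (intro sum_mono) (auto simp: power2_eq_square intro: sign[unfolded power2_eq_square])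
  also have "\<dots> = - (\<rho>\<^sup>2 * (\<Sum>a\<in>UNIV. (D a)\<^sup>2))" by (simp add: sum_negf sum_distrib_left)
  finally have "(\<Sum>a\<in>UNIV. \<Sum>b\<in>UNIV. D a * D b * ((?d a b)\<^sup>2 - \<rho>\<^sup>2)) \<le> - (\<rho>\<^sup>2 * (\<Sum>a\<in>UNIV. (D a)\<^sup>2))" .
  moreover have "(\<Sum>a\<in>UNIV. \<Sum>b\<in>UNIV. D a * D b * ((?d a b)\<^sup>2 - \<rho>\<^sup>2)) = 0"
  proof -
    have "(\<Sum>a\<in>UNIV. \<Sum>b\<in>UNIV. D a * D b * ((?d a b)\<^sup>2 - \<rho>\<^sup>2))
      = (\<Sum>a\<in>UNIV. \<Sum>b\<in>UNIV. D a * D b * (?d a b)\<^sup>2) - (\<Sum>a\<in>UNIV. D a) * (\<Sum>b\<in>UNIV. D b) * \<rho>\<^sup>2"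
      unfolding sum_product unfolding sum_distrib_right unfolding sum_subtractf[symmetric]
      by (intro sum.cong refl) (simp add: right_diff_distrib)
    then show ?thesis by (simp add: quad sumD)
  qed
  ultimately have "(\<Sum>a\<in>UNIV. (D a)\<^sup>2) \<le> 0" using \<rho>(1) by (simp add: mult_le_0_iff)
  then have "(\<Sum>a\<in>UNIV. (D a)\<^sup>2) = 0" by (simp add: antisym sum_nonneg)
  then have "D a = 0" for a using sum_nonneg_eq_0_iff[of UNIV "\<lambda>a. (D a)\<^sup>2"] by simp
  then have "\<nu> = 0" using m by (simp add: D_def vec_eq_iff) (metis less_irrefl)
  then show False using \<nu>(1) by simp
qed

text \<open>Conley's argument: minus the Laplacian pushes a boundary point of the cone of vectors ordered like
  \<open>x\<close> strictly inside, and a second eigenvector with eigenvalue at most \<open>\<mu>\<close> would produce a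
  boundary point \<open>\<kappa> x - \<xi>\<close> that is not pushed inside.\<close>
lemma conley_cone:
  fixes x \<xi> m :: "'n::finite \<Rightarrow> real" and w :: "'n \<Rightarrow> 'n \<Rightarrow> real"
  assumes m: "\<And>a. m a > 0" and inj: "inj x" and card: "CARD('n) \<ge> 2"
    and w: "\<And>a b. w a b = 1 / \<bar>x a - x b\<bar> ^ 3"
    and x: "\<And>a. (\<Sum>b\<in>UNIV. w a b * m b * (x a - x b)) = \<mu> * x a"
    and \<xi>: "\<And>a. (\<Sum>b\<in>UNIV. w a b * m b * (\<xi> a - \<xi> b)) = \<alpha> * \<xi> a"
    and orth: "(\<Sum>a\<in>UNIV. m a * x a) = 0" "(\<Sum>a\<in>UNIV. m a * \<xi> a) = 0" "(\<Sum>a\<in>UNIV. m a * x a * \<xi> a) = 0"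
    and "\<alpha> \<le> \<mu>"
  shows "\<xi> a = 0"
proof -
  define Q where "Q = {(a, b). x a < x b}"
  define f where "f = (\<lambda>(a, b). (\<xi> b - \<xi> a) / (x b - x a))"
  define \<kappa> where "\<kappa> = Max (f ` Q)"
  obtain a0 b0 :: 'n where "a0 \<noteq> b0"
    using card by (metis One_nat_def card_le_Suc0_iff_eq finite_code UNIV_I not_less_eq_eq numeral_2_eq_2)
  then have "x a0 < x b0 \<or> x b0 < x a0" using inj by (metis injD linorder_neq_iff)
  then have Qne: "Q \<noteq> {}" by (auto simp: Q_def)
  have slope: "\<xi> b - \<xi> a \<le> \<kappa> * (x b - x a)" if "x a < x b" for a b
  proof -
    have "f (a, b) \<le> \<kappa>" unfolding \<kappa>_def using that by (intro Max_ge) (auto simp: Q_def)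
    then show ?thesis using that by (simp add: f_def pos_divide_le_eq)
  qed
  have "\<kappa> \<in> f ` Q" unfolding \<kappa>_def using Qne by (intro Max_in) auto
  then obtain p r where pr: "x p < x r" "\<xi> r - \<xi> p = \<kappa> * (x r - x p)"
    by (auto simp: Q_def f_def)
  \<comment> \<open>With \<open>\<kappa>\<close> the largest slope of \<xi> against x, the
    combination \<open>y\<close> is still ordered like \<open>x\<close> but has a tie at the pair
    \<open>p\<close>, \<open>r\<close> where that slope is attained. This is the boundary point of
    the cone.\<close>
  define y where "y = (\<lambda>a. \<kappa> * x a - \<xi> a)"
  have ymono: "y a \<le> y b" if "x a < x b" for a b
    using slope[OF that] by (simp add: y_def algebra_simps)
  have ypr: "y p = y r" using pr(2) by (simp add: y_def algebra_simps)
  \<comment> \<open>If all slopes were negative, \<xi> would strictly decrease along x; the weighted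
    sum of products of differences would then be negative, whereas the orthogonality relations make
    it 0.\<close>
  have \<kappa>: "\<kappa> \<ge> 0"
  proof (rule ccontr)
    assume "\<not> \<kappa> \<ge> 0"
    have nonpos: "(\<xi> b - \<xi> a) * (x b - x a) \<le> \<kappa> * (x b - x a)\<^sup>2" for a b
    proof -
      consider "x a < x b" | "x a = x b" | "x b < x a" by linarith
      then show ?thesis
      proof cases
        case 1
        then show ?thesis using mult_right_mono[OF slope[OF 1], of "x b - x a"] by (simp add: power2_eq_square mult.assoc)
      next
        case 3
        then show ?thesis using mult_right_mono[OF slope[OF 3], of "x a - x b"] by (simp add: power2_eq_square algebra_simps)
      qed simp
    qed
    have "(\<Sum>a\<in>UNIV. \<Sum>b\<in>UNIV. m a * m b * ((\<xi> b - \<xi> a) * (x b - x a)))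
      = 2 * ((\<Sum>a\<in>UNIV. m a) * (\<Sum>b\<in>UNIV. m b * x b * \<xi> b) - (\<Sum>a\<in>UNIV. m a * \<xi> a) * (\<Sum>b\<in>UNIV. m b * x b))"
    proof -
      have "(\<Sum>a\<in>UNIV. \<Sum>b\<in>UNIV. m a * m b * ((\<xi> b - \<xi> a) * (x b - x a)))
        = (\<Sum>a\<in>UNIV. \<Sum>b\<in>UNIV. m a * (m b * x b * \<xi> b)) + (\<Sum>a\<in>UNIV. \<Sum>b\<in>UNIV. (m a * x a * \<xi> a) * m b)
          - (\<Sum>a\<in>UNIV. \<Sum>b\<in>UNIV. (m a * \<xi> a) * (m b * x b)) - (\<Sum>a\<in>UNIV. \<Sum>b\<in>UNIV. (m a * x a) * (m b * \<xi> b))"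
        unfolding sum.distrib[symmetric] sum_subtractf[symmetric]
        by (intro sum.cong refl) (simp add: algebra_simps)
      then show ?thesis by (simp add: sum_product[symmetric])
    qed
    then have zero: "(\<Sum>a\<in>UNIV. \<Sum>b\<in>UNIV. m a * m b * ((\<xi> b - \<xi> a) * (x b - x a))) = 0"
      by (simp add: orth)
    have le: "m a * m b * ((\<xi> b - \<xi> a) * (x b - x a)) \<le> 0" for a b
    proof -
      have "\<kappa> * (x b - x a)\<^sup>2 \<le> 0" using \<open>\<not> \<kappa> \<ge> 0\<close> by (simp add: mult_nonpos_nonneg)
      then have "(\<xi> b - \<xi> a) * (x b - x a) \<le> 0" using nonpos order_trans by blast
      then show ?thesis using m[of a] m[of b] by (simp add: mult_nonneg_nonpos)
    qed
    have "(\<Sum>a\<in>UNIV. \<Sum>b\<in>UNIV. m a * m b * ((\<xi> b - \<xi> a) * (x b - x a))) \<le> m p * m r * ((\<xi> r - \<xi> p) * (x r - x p))"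
    proof -
      have "(\<Sum>a\<in>UNIV. \<Sum>b\<in>UNIV. m a * m b * ((\<xi> b - \<xi> a) * (x b - x a)))
        \<le> (\<Sum>a\<in>UNIV. \<Sum>b\<in>UNIV. if a = p \<and> b = r then m p * m r * ((\<xi> r - \<xi> p) * (x r - x p)) else 0)"
        by (intro sum_mono) (auto simp: le)
      also have "\<dots> = (\<Sum>a\<in>UNIV. if a = p then m p * m r * ((\<xi> r - \<xi> p) * (x r - x p)) else 0)"
        by (intro sum.cong refl) auto
      finally show ?thesis by simp
    qed
    moreover have "m p * m r * ((\<xi> r - \<xi> p) * (x r - x p)) < 0"
      using pr m[of p] m[of r] \<open>\<not> \<kappa> \<ge> 0\<close> by (simp add: mult_pos_neg mult_neg_pos)
    ultimately show False using zero by simp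
  qed
  have Ay: "(\<Sum>b\<in>UNIV. w a b * m b * (y a - y b)) = \<kappa> * \<mu> * x a - \<alpha> * \<xi> a" for a
  proof -
    have "(\<Sum>b\<in>UNIV. w a b * m b * (y a - y b)) = \<kappa> * (\<Sum>b\<in>UNIV. w a b * m b * (x a - x b)) - (\<Sum>b\<in>UNIV. w a b * m b * (\<xi> a - \<xi> b))"
      unfolding y_def sum_distrib_left sum_subtractf[symmetric] by (intro sum.cong refl) (simp add: algebra_simps)
    then show ?thesis by (simp add: x \<xi>)
  qed
  \<comment> \<open>The contribution of body \<open>c\<close> to the difference of the Laplacian of
    \<open>y\<close> at \<open>r\<close> and at \<open>p\<close>. The eigenvalue equations give the
    total \<open>\<kappa> * (\<mu> - \<alpha>) * (x r - x p)\<close>, which is nonnegative.\<close>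
  define g where "g = (\<lambda>c. m c * ((y p - y c) * (w r c - w p c)))"
  have "(\<Sum>c\<in>UNIV. g c) = (\<Sum>b\<in>UNIV. w r b * m b * (y r - y b)) - (\<Sum>b\<in>UNIV. w p b * m b * (y p - y b))"
    unfolding g_def sum_subtractf[symmetric] by (intro sum.cong refl) (simp add: ypr algebra_simps)
  also have "\<dots> = \<kappa> * (\<mu> - \<alpha>) * (x r - x p)"
  proof -
    have "\<xi> r = \<xi> p + \<kappa> * (x r - x p)" using pr(2) by simp
    then show ?thesis unfolding Ay by (simp only:) (simp add: algebra_simps)
  qed
  also have "\<dots> \<ge> 0" using \<kappa> \<open>\<alpha> \<le> \<mu>\<close> pr(1) by simp
  finally have gsum: "(\<Sum>c\<in>UNIV. g c) \<ge> 0" .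
  \<comment> \<open>A body outside the interval from \<open>x p\<close> to \<open>x r\<close> acts
    more strongly on the nearer endpoint; a body inside has the common value of \<open>y\<close> at
    the ends by monotonicity. A total that is both nonnegative and nonpositive makes
    \<open>y\<close> constant.\<close>
  have gneg: "g c \<le> 0 \<and> (g c = 0 \<longrightarrow> y c = y p)" for c
  proof -
    consider "c = p \<or> c = r" | "x c < x p" | "x p < x c" "x c < x r" | "x r < x c"
      using inj by (metis injD linorder_neq_iff)
    then show ?thesis
    proof cases
      case 1
      then show ?thesis by (auto simp: g_def ypr)
    next
      case 2
      have "1 / \<bar>x r - x c\<bar> ^ 3 < 1 / \<bar>x p - x c\<bar> ^ 3"
        using 2 pr(1) by (intro frac_less2 power_strict_mono) auto
      then have "w r c - w p c < 0" by (simp add: w)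
      moreover have "y p - y c \<ge> 0" using ymono[OF 2] by simp
      ultimately show ?thesis using m[of c] by (auto simp: g_def mult_nonneg_nonpos mult_le_0_iff)
    next
      case 3
      then show ?thesis using ymono[OF 3(1)] ymono[OF 3(2)] ypr by (simp add: g_def)
    next
      case 4
      have "1 / \<bar>x p - x c\<bar> ^ 3 < 1 / \<bar>x r - x c\<bar> ^ 3"
        using 4 pr(1) by (intro frac_less2 power_strict_mono) auto
      then have "w r c - w p c > 0" by (simp add: w)
      moreover have "y p - y c \<le> 0" using ymono[OF 4] ypr by simp
      ultimately show ?thesis using m[of c] by (auto simp: g_def mult_nonpos_nonneg mult_le_0_iff)
    qed
  qed
  have "(\<Sum>c\<in>UNIV. - g c) = 0"
    using gsum gneg by (simp add: sum_negf antisym sum_nonpos)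
  then have "g c = 0" for c using sum_nonneg_eq_0_iff[of UNIV "\<lambda>c. - g c"] gneg by simp
  then have yc: "y c = y p" for c using gneg by blast
  have "(\<Sum>a\<in>UNIV. m a) * y p = (\<Sum>a\<in>UNIV. m a * y a)" 
    unfolding sum_distrib_right by (intro sum.cong refl arg_cong2[where f = "(*)"] yc[symmetric])
  also have "\<dots> = \<kappa> * (\<Sum>a\<in>UNIV. m a * x a) - (\<Sum>a\<in>UNIV. m a * \<xi> a)"
    unfolding sum_distrib_left sum_subtractf[symmetric] y_def by (intro sum.cong refl) (simp add: algebra_simps)
  finally have "(\<Sum>a\<in>UNIV. m a) * y p = 0" by (simp add: orth)
  moreover have "(\<Sum>a\<in>UNIV. m a) > 0" using m by (simp add: sum_pos)
  ultimately have "y p = 0" by simp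
  then have \<xi>x: "\<xi> a = \<kappa> * x a" for a using yc[of a] by (simp add: y_def)
  have "0 = (\<Sum>a\<in>UNIV. m a * x a * \<xi> a)" by (simp add: orth)
  also have "\<dots> = \<kappa> * (\<Sum>a\<in>UNIV. m a * (x a)\<^sup>2)"
    unfolding sum_distrib_left by (intro sum.cong refl) (simp add: \<xi>x power2_eq_square algebra_simps)
  finally have "\<kappa> = 0 \<or> (\<Sum>a\<in>UNIV. m a * (x a)\<^sup>2) = 0" by simp
  moreover have "(\<Sum>a\<in>UNIV. m a * (x a)\<^sup>2) \<noteq> 0"
  proof
    assume "(\<Sum>a\<in>UNIV. m a * (x a)\<^sup>2) = 0"
    then have "\<forall>a. m a * (x a)\<^sup>2 = 0"
      using sum_nonneg_eq_0_iff[of UNIV "\<lambda>a. m a * (x a)\<^sup>2"] m by (simp add: less_imp_le)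
    then have "x p = 0" "x r = 0" using m by (metis less_irrefl mult_eq_0_iff power_eq_0_iff)+
    then show False using pr(1) by simp
  qed
  ultimately show ?thesis by (simp add: \<xi>x)
qed

lemma collinear_normal_eigenvalue:
  fixes s :: "('d::finite, 'n::finite) config"
  assumes m: "\<And>a. m a > 0" and free: "s \<in> collision_free" and card: "CARD('n) \<ge> 2"
    and s: "s \<in> centered m" "acceleration m s = - \<mu> *\<^sub>R s" and "collinear_config s"
    and \<nu>: "\<nu> \<noteq> 0" "\<nu> \<bullet> (\<chi> a. sqrt (m a)) = 0" "\<And>c. \<nu> \<bullet> mass_row m s c = 0"
    and eig: "mass_laplacian m (inverse_cubes s) \<nu> = \<alpha> *\<^sub>R \<nu>"
  shows "\<alpha> > \<mu>"
proof (rule ccontr)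
  assume neg: "\<not> \<alpha> > \<mu>"
  obtain B where B: "\<And>b. b \<in> B \<Longrightarrow> norm b = 1" "card B = 1" "span B = span (range (\<lambda>a. s $ a))"
    using orthonormal_basis_subspace[OF subspace_span, of "range (\<lambda>a. s $ a)"] \<open>collinear_config s\<close>
    unfolding collinear_config_def config_dim_def by metis
  then obtain u where u: "B = {u}" by (auto simp: card_1_singleton_iff)
  then have uu: "u \<bullet> u = 1" using B(1) by (simp add: dot_square_norm)
  define x where "x = (\<lambda>a. s $ a \<bullet> u)"
  have su: "s $ a = x a *\<^sub>R u" for a
  proof -
    have "s $ a \<in> span {u}" using B(3) u span_base[of "s $ a" "range (\<lambda>a. s $ a)"] by auto
    then obtain k where "s $ a = k *\<^sub>R u" by (auto simp: span_singleton)
    then show ?thesis by (simp add: x_def uu)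
  qed
  have inj: "inj x" using free su by (metis (mono_tags, lifting) collision_free_def injI mem_Collect_eq)
  have w: "inverse_cubes s a b = 1 / \<bar>x a - x b\<bar> ^ 3" for a b
  proof -
    have "s $ a - s $ b = (x a - x b) *\<^sub>R u" using su by (metis scaleR_diff_left)
    then show ?thesis using uu by (simp add: inverse_cubes_def norm_eq_sqrt_inner)
  qed
  have sm: "sqrt (m a) > 0" "sqrt (m a) * sqrt (m a) = m a" for a using m[of a] by auto
  \<comment> \<open>Dividing by the root of the mass undoes the symmetrisation and gives the
    unweighted form used in the cone argument.\<close>
  define \<xi> where "\<xi> = (\<lambda>a. \<nu> $ a / sqrt (m a))"
  have \<nu>\<xi>: "\<nu> $ a = sqrt (m a) * \<xi> a" for a using sm(1)[of a] by (simp add: \<xi>_def)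
  have "\<xi> a = 0" for a
  proof (rule conley_cone[OF m inj card w])
    fix a
    have "acceleration m s $ a \<bullet> u = - (\<Sum>b\<in>UNIV. inverse_cubes s a b * m b * (x a - x b))"
      unfolding sum_negf[symmetric] acceleration_def vec_lambda_beta inner_sum_left
      by (intro sum.cong refl) (simp add: inverse_cubes_def x_def inner_diff_left algebra_simps diff_divide_distrib)
    then show "(\<Sum>b\<in>UNIV. inverse_cubes s a b * m b * (x a - x b)) = \<mu> * x a"
      using s(2) by (simp add: x_def)
    have "mass_laplacian m (inverse_cubes s) \<nu> $ a = sqrt (m a) * (\<Sum>b\<in>UNIV. inverse_cubes s a b * m b * (\<xi> a - \<xi> b))"
      unfolding mass_laplacian_def vec_lambda_beta sum_distrib_left \<nu>\<xi>
    proof (intro sum.cong refl)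
      fix b
      have "inverse_cubes s a b * sqrt (m b) * (sqrt (m b) * (sqrt (m a) * \<xi> a) - sqrt (m a) * (sqrt (m b) * \<xi> b))
        = sqrt (m a) * (inverse_cubes s a b * (sqrt (m b) * sqrt (m b)) * (\<xi> a - \<xi> b))"
        by (simp only: right_diff_distrib ac_simps)
      then show "inverse_cubes s a b * sqrt (m b) * (sqrt (m b) * (sqrt (m a) * \<xi> a) - sqrt (m a) * (sqrt (m b) * \<xi> b))
        = sqrt (m a) * (inverse_cubes s a b * m b * (\<xi> a - \<xi> b))" unfolding sm(2) .
    qed
    then show "(\<Sum>b\<in>UNIV. inverse_cubes s a b * m b * (\<xi> a - \<xi> b)) = \<alpha> * \<xi> a"
      using eig sm(1)[of a] \<nu>\<xi>[of a] by simp
  next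
    have "(\<Sum>a\<in>UNIV. m a * x a) = (\<Sum>a\<in>UNIV. m a *\<^sub>R s $ a) \<bullet> u"
      by (simp add: inner_sum_left x_def)
    then show "(\<Sum>a\<in>UNIV. m a * x a) = 0" using s(1) by (simp add: centered_def)
    have "(\<Sum>a\<in>UNIV. m a * \<xi> a) = \<nu> \<bullet> (\<chi> a. sqrt (m a))"
      unfolding inner_vec_def vec_lambda_beta \<nu>\<xi> inner_real_def
    proof (intro sum.cong refl)
      fix a
      have "sqrt (m a) * \<xi> a * sqrt (m a) = (sqrt (m a) * sqrt (m a)) * \<xi> a" by (simp only: ac_simps)
      then show "m a * \<xi> a = sqrt (m a) * \<xi> a * sqrt (m a)" unfolding sm(2) by (rule sym)
    qed
    then show "(\<Sum>a\<in>UNIV. m a * \<xi> a) = 0" using \<nu>(2) by simp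
    have "(\<Sum>a\<in>UNIV. m a * x a * \<xi> a) = \<nu> \<bullet> mass_row m s u"
      unfolding inner_vec_def[of \<nu>] mass_row_def vec_lambda_beta \<nu>\<xi> inner_real_def
    proof (intro sum.cong refl)
      fix a
      have "sqrt (m a) * \<xi> a * (sqrt (m a) * (s $ a \<bullet> u)) = (sqrt (m a) * sqrt (m a)) * x a * \<xi> a"
        unfolding x_def by (simp only: ac_simps)
      then show "m a * x a * \<xi> a = sqrt (m a) * \<xi> a * (sqrt (m a) * (s $ a \<bullet> u))" unfolding sm(2) by (rule sym)
    qed
    then show "(\<Sum>a\<in>UNIV. m a * x a * \<xi> a) = 0" using \<nu>(3) by simp
  qed (use neg in simp)
  then have "\<nu> = 0" by (simp add: vec_eq_iff \<nu>\<xi>)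
  then show False using \<nu>(1) by simp
qed

section \<open>Linear algebra for counting dimensions\<close>

lemma dim_range_mass_row:
  fixes s :: "('d::finite, 'n::finite) config"
  assumes m: "\<And>a. m a > 0"
  shows "dim (range (mass_row m s)) = config_dim s"
proof -
  define A :: "real ^ 'd ^ 'n" where "A = (\<chi> a. sqrt (m a) *\<^sub>R s $ a)"
  have "mass_row m s = (*v) A"
    by (auto simp: fun_eq_iff vec_eq_iff mass_row_def A_def matrix_vector_mult_def inner_vec_def sum_distrib_left mult.assoc)
  \<comment> \<open>Row rank equals column rank: the coordinate functions span the column space, the
    bodies up to positive factors are the rows.\<close>
  then have "dim (range (mass_row m s)) = dim (rows A)"
    using rank_dim_range[of A] row_rank_def[of A] by simp
  also have "rows A = range (\<lambda>a. sqrt (m a) *\<^sub>R s $ a)"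
  proof -
    have "row i A = sqrt (m i) *\<^sub>R s $ i" for i by (simp add: vec_eq_iff row_def A_def)
    then show ?thesis by (auto simp: rows_def)
  qed
  also have "dim \<dots> = dim (span \<dots>)" by simp
  also have "span (range (\<lambda>a. sqrt (m a) *\<^sub>R s $ a)) = span (range (\<lambda>a. s $ a))"
  proof (intro subset_antisym span_minimal subspace_span image_subsetI)
    fix a
    show "sqrt (m a) *\<^sub>R s $ a \<in> span (range (\<lambda>a. s $ a))"
      by (intro span_scale span_base) simp
    have "(1 / sqrt (m a)) *\<^sub>R sqrt (m a) *\<^sub>R s $ a \<in> span (range (\<lambda>a. sqrt (m a) *\<^sub>R s $ a))"
      by (intro span_scale span_base) simp
    then show "s $ a \<in> span (range (\<lambda>a. sqrt (m a) *\<^sub>R s $ a))"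
      using m[of a] by simp
  qed
  finally show ?thesis by (simp add: config_dim_def)
qed

text \<open>The basis \<open>B\<close> is kept next to the projection since
  \<open>\<pi> x = 0\<close> must be tested by exactly \<open>dim P\<close> linear conditions; these
  are later pulled back to directions in space.\<close>

lemma orthogonal_projection:
  fixes P :: "'a::euclidean_space set"
  assumes "subspace P"
  shows "\<exists>B \<pi>. finite B \<and> card B = dim P \<and> linear \<pi> \<and> (\<forall>x y. \<pi> x \<bullet> y = x \<bullet> \<pi> y) \<and>
    (\<forall>x. \<pi> x \<in> P) \<and> (\<forall>x\<in>P. \<pi> x = x) \<and> (\<forall>x. (\<forall>b\<in>B. x \<bullet> b = 0) \<longrightarrow> \<pi> x = 0)"
proof -
  obtain B where B: "B \<subseteq> P" "pairwise orthogonal B" "\<And>x. x \<in> B \<Longrightarrow> norm x = 1"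
    "independent B" "card B = dim P" "span B = P"
    using orthonormal_basis_subspace[OF assms] by metis
  have fin: "finite B" using B(4) by (rule independent_imp_finite)
  define \<pi> where "\<pi> = (\<lambda>x. \<Sum>b\<in>B. (x \<bullet> b) *\<^sub>R b)"
  have lin: "linear \<pi>"
    unfolding \<pi>_def by (intro linearI) (simp_all add: inner_add_left scaleR_add_left sum.distrib scaleR_sum_right)
  have sym: "\<pi> x \<bullet> y = x \<bullet> \<pi> y" for x y
    by (simp add: \<pi>_def inner_sum_left inner_sum_right inner_commute mult.commute)
  have mem: "\<pi> x \<in> P" for x
    unfolding \<pi>_def using B(1) assms by (intro subspace_sum subspace_scale) auto
  have "\<pi> x \<bullet> b = x \<bullet> b" if b: "b \<in> B" for x b
  proof -
    have "\<pi> x \<bullet> b = (\<Sum>b'\<in>B. if b' = b then x \<bullet> b else 0)"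
      unfolding \<pi>_def inner_sum_left
    proof (intro sum.cong refl)
      fix b' assume b': "b' \<in> B"
      show "((x \<bullet> b') *\<^sub>R b') \<bullet> b = (if b' = b then x \<bullet> b else 0)"
      proof (cases "b' = b")
        case True
        then show ?thesis using B(3)[OF b] by (simp add: dot_square_norm)
      next
        case False
        then have "b' \<bullet> b = 0" using B(2) b b' by (simp add: pairwise_def orthogonal_def)
        then show ?thesis using False by simp
      qed
    qed
    then show ?thesis using b fin by simp
  qed
  then have orth: "orthogonal (x - \<pi> x) b" if "b \<in> B" for x b
    using that by (simp add: orthogonal_def inner_diff_left)
  have "\<pi> x = x" if "x \<in> P" for x
  proof -
    have "x - \<pi> x \<in> span B" using that mem assms B(6) by (simp add: subspace_diff)
    then have "orthogonal (x - \<pi> x) (x - \<pi> x)" using orth orthogonal_to_span by blast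
    then show ?thesis by (simp add: orthogonal_def)
  qed
  moreover have "\<pi> x = 0" if "\<And>b. b \<in> B \<Longrightarrow> x \<bullet> b = 0" for x using that by (simp add: \<pi>_def)
  ultimately show ?thesis
    using fin B(5) lin sym mem by (intro exI[of _ B] exI[of _ \<pi>]) simp
qed

text \<open>Confinement only bounds the dimension from above, while a planar or collinear solution
  asks for a plane or line of exact dimension.\<close>

lemma extend_subspace:
  fixes S :: "'a::euclidean_space set"
  assumes "subspace S" "dim S \<le> k" "k \<le> DIM('a)"
  obtains S' where "subspace S'" "S \<subseteq> S'" "dim S' = k"
proof -
  have "\<exists>S'. subspace S' \<and> S \<subseteq> S' \<and> dim S' = k"
    using assms(2,3)
  proof (induction k rule: dec_induct)
    case base
    then show ?case using assms(1) by auto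
  next
    case (step n)
    then obtain S' where S': "subspace S'" "S \<subseteq> S'" "dim S' = n" by auto
    then have "S' \<noteq> UNIV" using step by auto
    then obtain x where "x \<notin> S'" by auto
    then have "dim (span (insert x S')) = Suc n"
      using S' by (simp add: dim_insert span_eq_iff[THEN iffD2])
    moreover have "S \<subseteq> span (insert x S')" using S'(2) span_superset by blast
    ultimately show ?case using subspace_span by blast
  qed
  then show ?thesis using that by blast
qed

lemma linear_mass_row: "linear (mass_row m q)"
  by (intro linearI) (simp_all add: mass_row_def vec_eq_iff inner_add_right algebra_simps)

lemma bounded_linear_mass_row_config:
  "bounded_linear (\<lambda>q :: ('d::finite, 'n::finite) config. mass_row m q c)"
  unfolding linear_conv_bounded_linear[symmetric]
  by (intro linearI) (simp_all add: mass_row_def vec_eq_iff inner_add_left algebra_simps)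

subsection \<open>Confinement to the span of the limiting shape\<close>

text \<open>The hypothesis \<open>normal\<close> isolates what depends on the kind of shape: every
  eigenvalue of the Laplacian on normal vectors exceeds \<mu>. The rest works for any number of
  bodies in any dimension, and the bound on \<open>dim S\<close> counts the conditions that make the
  solution in a direction \<open>c\<close> vanish.\<close>

lemma total_collision_confined:
  fixes q :: "real \<Rightarrow> ('d::finite, 'n::{finite,linorder}) config"
  assumes m: "\<And>a. m a > 0" and card: "CARD('n) \<ge> 2"
    and sol: "total_collision_solution m t0 T q" and shape: "limiting_shape m T q s"
    and normal: "\<And>\<nu> \<alpha>. \<nu> \<noteq> 0 \<Longrightarrow> \<nu> \<bullet> (\<chi> a. sqrt (m a)) = 0 \<Longrightarrow> (\<And>c. \<nu> \<bullet> mass_row m s c = 0) \<Longrightarrow>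
      mass_laplacian m (inverse_cubes s) \<nu> = \<alpha> *\<^sub>R \<nu> \<Longrightarrow> \<alpha> > force_function m s"
  shows "\<exists>S. subspace S \<and> dim S \<le> config_dim s \<and> (\<forall>t\<in>{t0..<T}. \<forall>a. q t $ a \<in> S)"
proof -
  define \<mu> where "\<mu> = force_function m s"
  have cc: "normalized_CC m s" using shape by (simp add: limiting_shape_def)
  then have free: "s \<in> collision_free" and cen: "s \<in> centered m"
    by (auto simp: normalized_CC_def critical_point_on_def mass_sphere_def)
  have \<mu>: "\<mu> > 0" unfolding \<mu>_def by (rule force_function_pos[OF m free card])
  have t0T: "t0 < T" and newton: "newton_solution m t0 T q" and coll: "(q \<longlongrightarrow> 0) (at_left T)"
    using sol by (auto simp: total_collision_solution_def)
  obtain v where dq: "\<And>t. t \<in> {t0..<T} \<Longrightarrow> (q has_vector_derivative v t) (at t within {t0..<T})"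
    and dv: "\<And>t. t \<in> {t0..<T} \<Longrightarrow> (v has_vector_derivative acceleration m (q t)) (at t within {t0..<T})"
    and qcen: "\<And>t. t \<in> {t0..<T} \<Longrightarrow> q t \<in> centered m" and qfree: "\<And>t. t \<in> {t0..<T} \<Longrightarrow> q t \<in> collision_free"
    using newton_solution_acceleration[where m = m, OF m newton] by blast
  note dist = limiting_shape_distances[where m = m, OF m shape]
  note asym = total_collision_asymptotics[OF m card t0T dq dv qfree coll free dist]
  define r where "r = (\<lambda>t. mass_norm m (q t))"
  have rpos: "r t > 0" if "t \<in> {t0..<T}" for t
    unfolding r_def by (rule mass_norm_pos[OF m qfree[OF that] card])
  have inT: "eventually (\<lambda>t. t \<in> {t0<..<T}) (at_left T)"
    using t0T by (rule eventually_at_leftI[rotated]) simp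
  let ?L = "mass_laplacian m (inverse_cubes s)" and ?e0 = "\<chi> a. sqrt (m a)"
  let ?P = "range (mass_row m s)"
  interpret L: linear ?L by (rule linear_mass_laplacian)
  have Lsym: "?L x \<bullet> y = x \<bullet> ?L y" for x y by (rule mass_laplacian_symmetric[OF inverse_cubes_commute])
  have Lrow: "?L (mass_row m s c) = \<mu> *\<^sub>R mass_row m s c" for c
    unfolding \<mu>_def by (rule normalized_CC_mass_laplacian[OF m cc])
  have row_e0: "mass_row m s c \<bullet> ?e0 = 0" for c by (rule mass_row_centered[OF m cen])
  define N where "N = {x. x \<bullet> ?e0 = 0 \<and> (\<forall>c. x \<bullet> mass_row m s c = 0)}"
  have N: "subspace N" by (auto simp: N_def subspace_def inner_add_left)
  have LN: "?L x \<in> N" if "x \<in> N" for x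
    using that by (auto simp: N_def Lsym mass_laplacian_total Lrow)
  have eigN: "\<alpha> > \<mu>" if "x \<in> N" "x \<noteq> 0" "?L x = \<alpha> *\<^sub>R x" for x \<alpha>
    unfolding \<mu>_def by (rule normal[of x]) (use that in \<open>auto simp: N_def\<close>)
  have "\<exists>\<eta>>0. \<forall>x\<in>N. (\<mu> + \<eta>) * (norm x)\<^sup>2 \<le> ?L x \<bullet> x"
    by (rule symmetric_spectral_gap[OF linear_mass_laplacian Lsym N]) (blast intro: LN eigN)+
  then obtain \<eta> where \<eta>: "\<eta> > 0" "\<And>x. x \<in> N \<Longrightarrow> (\<mu> + \<eta>) * (norm x)\<^sup>2 \<le> ?L x \<bullet> x"
    by blast
  have subP: "subspace ?P" using linear_mass_row by (metis linear_subspace_image subspace_UNIV)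
  obtain Bs \<pi> where Bs: "finite Bs" "card Bs = dim ?P"
    and \<pi>: "linear \<pi>" "\<And>x y. \<pi> x \<bullet> y = x \<bullet> \<pi> y" "\<And>x. \<pi> x \<in> ?P" "\<And>x. x \<in> ?P \<Longrightarrow> \<pi> x = x"
    and \<pi>0: "\<And>x. \<forall>b\<in>Bs. x \<bullet> b = 0 \<Longrightarrow> \<pi> x = 0"
    using orthogonal_projection[OF subP] by (elim exE conjE) (simp add: Ball_def)
  interpret P: linear \<pi> by (rule \<pi>(1))
  have \<pi>\<pi>: "\<pi> (\<pi> x) = \<pi> x" for x using \<pi> by blast
  have L\<pi>: "?L (\<pi> x) = \<mu> *\<^sub>R \<pi> x" for x using \<pi>(3)[of x] Lrow by auto
  \<comment> \<open>The rescaled Laplacian minus its value 2/9 on the coordinate functions, so that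
    \<open>B\<close> vanishes there and is at least \<open>\<beta>\<close> on
    \<open>N\<close>.\<close>
  define B where "B = (\<lambda>x. (2 / (9 * \<mu>)) *\<^sub>R ?L x - (2/9) *\<^sub>R x)"
  have B: "linear B" "\<And>x y. B x \<bullet> y = x \<bullet> B y" "\<And>x. B (\<pi> x) = 0"
  proof -
    show "linear B" unfolding B_def
      by (intro linearI) (simp_all add: L.add L.scale algebra_simps)
    show "B x \<bullet> y = x \<bullet> B y" for x y
      by (simp add: B_def inner_diff_left inner_diff_right Lsym)
    show "B (\<pi> x) = 0" for x using \<mu> by (simp add: B_def L\<pi>)
  qed
  interpret B: linear B by (rule B(1))
  define \<beta> where "\<beta> = 2 / (9 * \<mu>) * \<eta>"
  have \<beta>: "\<beta> > 0" using \<mu> \<eta> by (simp add: \<beta>_def)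
  have gap: "\<beta> * (norm (x - \<pi> x))\<^sup>2 \<le> B x \<bullet> x" if x: "x \<bullet> ?e0 = 0" for x
  proof -
    define n where "n = x - \<pi> x"
    have "\<pi> x \<bullet> ?e0 = 0" using \<pi>(3)[of x] row_e0 by auto
    moreover have "n \<bullet> mass_row m s c = 0" for c
      using \<pi>(2)[of x "mass_row m s c"] \<pi>(4)[of "mass_row m s c"] by (simp add: n_def inner_diff_left)
    ultimately have "n \<in> N" using x by (simp add: N_def n_def inner_diff_left)
    then have "(2 / (9 * \<mu>)) * ((\<mu> + \<eta>) * (norm n)\<^sup>2) \<le> (2 / (9 * \<mu>)) * (?L n \<bullet> n)"
      using \<eta>(2) \<mu> by (intro mult_left_mono) auto
    then have "\<beta> * (norm n)\<^sup>2 \<le> B n \<bullet> n"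
      using \<mu> by (simp add: B_def \<beta>_def inner_diff_left power2_norm_eq_inner distrib_right distrib_left)
    also have "B n \<bullet> n = B x \<bullet> x"
      using B(2)[of x "\<pi> x"] by (simp add: n_def B.diff B(3) inner_diff_right)
    finally show ?thesis by (simp add: n_def)
  qed
  define \<epsilon> where "\<epsilon> = min (1/12) \<beta>"
  have \<epsilon>: "0 < \<epsilon>" "\<epsilon> \<le> 1/12" "\<epsilon> \<le> \<beta>" using \<beta> by (auto simp: \<epsilon>_def)
  define \<delta> where "\<delta> = min (\<epsilon> / 36) (\<epsilon> * \<beta> / 2) / 240"
  have \<delta>: "240 * \<delta> \<le> \<epsilon> / 36" "240 * \<delta> \<le> \<epsilon> * \<beta> / 2" "\<delta> > 0"
    using \<epsilon> \<beta> by (auto simp: \<delta>_def)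
  \<comment> \<open>Weights of the perturbation: the limit weights minus the rescaled actual ones,
    so that \<open>(T - t)\<^sup>2 x'' + (2/9) x + B x\<close> is the Laplacian of \<open>x\<close>
    with weights \<open>w t\<close>.\<close>
  define w where "w = (\<lambda>t a b. (2 / (9 * \<mu>)) * inverse_cubes s a b - (T - t)\<^sup>2 * inverse_cubes (q t) a b)"
  have w0: "((\<lambda>t. w t a b) \<longlongrightarrow> 0) (at_left T)" for a b
  proof (cases "a = b")
    case True
    then show ?thesis by (simp add: w_def inverse_cubes_def)
  next
    case False
    then have n0: "norm (s $ a - s $ b) \<noteq> 0" using free by (simp add: collision_free_def)
    have "((\<lambda>t. 1 / ((norm (q t $ a - q t $ b) / mass_norm m (q t)) ^ 3 * (mass_norm m (q t) ^ 3 / (T - t)\<^sup>2)))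
        \<longlongrightarrow> 1 / (norm (s $ a - s $ b) ^ 3 * (9 / 2 * \<mu>))) (at_left T)"
      unfolding \<mu>_def using n0 \<mu> by (intro tendsto_intros dist asym(1)) (auto simp: \<mu>_def)
    then have "((\<lambda>t. (T - t)\<^sup>2 * inverse_cubes (q t) a b) \<longlongrightarrow> 1 / (norm (s $ a - s $ b) ^ 3 * (9 / 2 * \<mu>))) (at_left T)"
    proof (rule Lim_transform_eventually)
      show "eventually (\<lambda>t. 1 / ((norm (q t $ a - q t $ b) / mass_norm m (q t)) ^ 3 * (mass_norm m (q t) ^ 3 / (T - t)\<^sup>2))
          = (T - t)\<^sup>2 * inverse_cubes (q t) a b) (at_left T)"
        using inT
      proof eventually_elim
        case (elim t)
        then have "mass_norm m (q t) \<noteq> 0" using rpos[of t] by (simp add: r_def)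
        then show ?case by (simp add: inverse_cubes_def power_divide)
      qed
    qed
    from tendsto_diff[OF tendsto_const this, of "1 / (norm (s $ a - s $ b) ^ 3 * (9 / 2 * \<mu>))"]
    show ?thesis by (simp add: w_def inverse_cubes_def mult.commute)
  qed
  have "((\<lambda>t. \<Sum>a\<in>UNIV. \<Sum>b\<in>UNIV. \<bar>w t a b\<bar> * (\<bar>sqrt (m b)\<bar> * (\<bar>sqrt (m b)\<bar> + \<bar>sqrt (m a)\<bar>))) \<longlongrightarrow>
      (\<Sum>a\<in>UNIV. \<Sum>b\<in>UNIV. \<bar>0\<bar> * (\<bar>sqrt (m b)\<bar> * (\<bar>sqrt (m b)\<bar> + \<bar>sqrt (m a)\<bar>)))) (at_left T)"
    by (intro tendsto_intros w0)
  then have "eventually (\<lambda>t. (\<Sum>a\<in>UNIV. \<Sum>b\<in>UNIV. \<bar>w t a b\<bar> * (\<bar>sqrt (m b)\<bar> * (\<bar>sqrt (m b)\<bar> + \<bar>sqrt (m a)\<bar>))) < \<delta>) (at_left T)"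
    using \<delta>(3) by (intro order_tendstoD(2)) auto
  moreover obtain K where "eventually (\<lambda>t. mass_norm m (q t) \<le> K * (T - t) powr (2/3) \<and> mass_norm m (v t) \<le> K * (T - t) powr (-1/3)) (at_left T)"
    using asym(2) by blast
  ultimately have "eventually (\<lambda>t. t \<in> {t0<..<T} \<and>
      (\<Sum>a\<in>UNIV. \<Sum>b\<in>UNIV. \<bar>w t a b\<bar> * (\<bar>sqrt (m b)\<bar> * (\<bar>sqrt (m b)\<bar> + \<bar>sqrt (m a)\<bar>))) < \<delta> \<and>
      mass_norm m (q t) \<le> K * (T - t) powr (2/3) \<and> mass_norm m (v t) \<le> K * (T - t) powr (-1/3)) (at_left T)"
    using inT by eventually_elim blast
  then obtain t2 where t2: "t2 < T" "\<And>t. t2 < t \<Longrightarrow> t < T \<Longrightarrow> t \<in> {t0<..<T} \<and>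
      (\<Sum>a\<in>UNIV. \<Sum>b\<in>UNIV. \<bar>w t a b\<bar> * (\<bar>sqrt (m b)\<bar> * (\<bar>sqrt (m b)\<bar> + \<bar>sqrt (m a)\<bar>))) < \<delta> \<and>
      mass_norm m (q t) \<le> K * (T - t) powr (2/3) \<and> mass_norm m (v t) \<le> K * (T - t) powr (-1/3)"
    unfolding eventually_at_left_field by blast
  define t1 where "t1 = (t2 + T) / 2"
  have t1: "t2 < t1" "t1 < T" using t2(1) by (auto simp: t1_def)
  then have t01: "t0 < t1" using t2(2)[of t1] by simp
  have sub: "{t1..<T} \<subseteq> {t0..<T}" using t01 by auto
  have near: "t2 < t" "t < T" if "t \<in> {t1..<T}" for t using that t1 by auto
  \<comment> \<open>The initial condition of \<open>bounded_solution_vanishes\<close> as a linear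
    function of the direction \<open>c\<close>.\<close>
  define G where "G = (\<lambda>c. mass_row m (q t1) c + (3 * (T - t1)) *\<^sub>R mass_row m (v t1) c)"
  have linG: "linear G"
    unfolding G_def by (intro linear_compose_add linear_compose_scale_right linear_mass_row)
  have row_dq: "((\<lambda>t. mass_row m (q t) c) has_vector_derivative mass_row m (v t) c) (at t within {t0..<T})"
    and row_dv: "((\<lambda>t. mass_row m (v t) c) has_vector_derivative mass_row m (acceleration m (q t)) c) (at t within {t0..<T})"
    if "t \<in> {t0..<T}" for t c
    by (rule bounded_linear.has_vector_derivative[OF bounded_linear_mass_row_config dq[OF that]],
        rule bounded_linear.has_vector_derivative[OF bounded_linear_mass_row_config dv[OF that]])
  have vanish: "q t $ a \<bullet> c = 0" if c: "\<pi> (G c) = 0" and t: "t \<in> {t0..<T}" for c t a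
  proof -
    have "mass_row m (q t1) c = 0 \<and> mass_row m (v t1) c = 0"
    proof (rule bounded_solution_vanishes[OF t1(2) \<beta> \<pi>(1,2) \<pi>\<pi> B \<epsilon> \<delta>(1,2),
          where x = "\<lambda>t. mass_row m (q t) c" and v = "\<lambda>t. mass_row m (v t) c"
            and a = "\<lambda>t. mass_row m (acceleration m (q t)) c" and K = "K * norm c"])
      fix t assume t: "t \<in> {t1..<T}"
      then have t': "t \<in> {t0..<T}" using sub by blast
      note near = t2(2)[OF near[OF t]]
      show "((\<lambda>t. mass_row m (q t) c) has_vector_derivative mass_row m (v t) c) (at t within {t1..<T})"
        by (rule has_vector_derivative_within_subset[OF row_dq[OF t'] sub])
      show "((\<lambda>t. mass_row m (v t) c) has_vector_derivative mass_row m (acceleration m (q t)) c) (at t within {t1..<T})"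
        by (rule has_vector_derivative_within_subset[OF row_dv[OF t'] sub])
      show "\<beta> * (norm (mass_row m (q t) c - \<pi> (mass_row m (q t) c)))\<^sup>2 \<le> B (mass_row m (q t) c) \<bullet> mass_row m (q t) c"
        by (rule gap[OF mass_row_centered[OF m qcen[OF t']]])
      have "norm (mass_row m (q t) c) \<le> mass_norm m (q t) * norm c" by (rule norm_mass_row_le[OF m])
      also have "\<dots> \<le> K * (T - t) powr (2/3) * norm c" using near by (intro mult_right_mono) auto
      finally show "norm (mass_row m (q t) c) \<le> K * norm c * (T - t) powr (2/3)" by (simp add: ac_simps)
      have "norm (mass_row m (v t) c) \<le> mass_norm m (v t) * norm c" by (rule norm_mass_row_le[OF m])
      also have "\<dots> \<le> K * (T - t) powr (-1/3) * norm c" using near by (intro mult_right_mono) auto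
      finally show "norm (mass_row m (v t) c) \<le> K * norm c * (T - t) powr (-1/3)" by (simp add: ac_simps)
      have "(T - t)\<^sup>2 *\<^sub>R mass_row m (acceleration m (q t)) c + (2/9) *\<^sub>R mass_row m (q t) c + B (mass_row m (q t) c)
        = mass_laplacian m (w t) (mass_row m (q t) c)"
        unfolding w_def mass_laplacian_diff mass_laplacian_scale mass_row_acceleration[OF m] B_def by simp
      also have "norm \<dots> \<le> \<delta> * norm (mass_row m (q t) c)"
        using near by (intro order_trans[OF mass_laplacian_norm_le] mult_right_mono) auto
      finally show "norm ((T - t)\<^sup>2 *\<^sub>R mass_row m (acceleration m (q t)) c + (2/9) *\<^sub>R mass_row m (q t) c + B (mass_row m (q t) c))
        \<le> \<delta> * norm (mass_row m (q t) c)" .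
    qed (use c in \<open>simp add: G_def\<close>)
    then have z: "mass_row m (q t1) c = 0" "mass_row m (v t1) c = 0" by auto
    \<comment> \<open>A compact interval containing both \<open>t\<close> and \<open>t1\<close> but
      staying away from \<open>T\<close>, where the coefficients blow up.\<close>
    define b where "b = max t t1"
    have b: "t0 < b" "b < T" "t \<in> {t0..b}" "t1 \<in> {t0..b}" using t t1 t01 by (auto simp: b_def)
    have subb: "{t0..b} \<subseteq> {t0..<T}" using b by auto
    have contq: "continuous_on {t0..b} q"
      by (rule continuous_on_subset[OF _ subb]) (rule continuous_on_vector_derivative[OF dq])
    let ?W = "\<lambda>t. \<Sum>a\<in>UNIV. \<Sum>b\<in>UNIV. \<bar>inverse_cubes (q t) a b\<bar> * (\<bar>sqrt (m b)\<bar> * (\<bar>sqrt (m b)\<bar> + \<bar>sqrt (m a)\<bar>))"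
    have "continuous_on {t0..b} (\<lambda>t. inverse_cubes (q t) a' b')" for a' b'
    proof (cases "a' = b'")
      case False
      then show ?thesis
        unfolding inverse_cubes_def using qfree subb
        by (intro continuous_intros contq) (auto simp: collision_free_def)
    qed (simp add: inverse_cubes_def)
    then have "continuous_on {t0..b} ?W" by (intro continuous_intros)
    then have "\<exists>x\<in>{t0..b}. \<forall>y\<in>{t0..b}. ?W y \<le> ?W x"
      by (rule continuous_attains_sup[OF compact_Icc, rotated]) (use b(1) in simp)
    then obtain C where C: "\<And>t. t \<in> {t0..b} \<Longrightarrow> ?W t \<le> C" by blast
    have "mass_row m (q t) c = 0"
    proof (rule second_order_zero_unique[where x = "\<lambda>t. mass_row m (q t) c" and v = "\<lambda>t. mass_row m (v t) c"
          and w = "\<lambda>t. mass_row m (acceleration m (q t)) c" and a = t0 and b = b and s = t1 and C = C])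
      fix t assume t: "t \<in> {t0..b}"
      then have t': "t \<in> {t0..<T}" using subb by blast
      show "((\<lambda>t. mass_row m (q t) c) has_vector_derivative mass_row m (v t) c) (at t within {t0..b})"
        by (rule has_vector_derivative_within_subset[OF row_dq[OF t'] subb])
      show "((\<lambda>t. mass_row m (v t) c) has_vector_derivative mass_row m (acceleration m (q t)) c) (at t within {t0..b})"
        by (rule has_vector_derivative_within_subset[OF row_dv[OF t'] subb])
      show "norm (mass_row m (acceleration m (q t)) c) \<le> C * norm (mass_row m (q t) c)"
        unfolding mass_row_acceleration[OF m] norm_minus_cancel
        by (rule order_trans[OF mass_laplacian_norm_le]) (intro mult_right_mono C t, simp)
    qed (use b z in auto)
    then have "sqrt (m a) * (q t $ a \<bullet> c) = 0" by (simp add: mass_row_def vec_eq_iff)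
    then show ?thesis using m[of a] by simp
  qed
  \<comment> \<open>A direction orthogonal to these vectors is mapped by \<open>G\<close> to a
    vector orthogonal to \<open>Bs\<close>, hence killed by \<open>\<pi>\<close>. There are at most
    as many of them as basis vectors in \<open>Bs\<close>.\<close>
  let ?A = "adjoint G ` Bs"
  show ?thesis
  proof (intro exI[of _ "span ?A"] conjI ballI allI)
    have "dim (span ?A) \<le> card Bs"
      using Bs(1) by (metis card_image_le dim_le_card dim_span finite_imageI order_trans span_superset)
    then show "dim (span ?A) \<le> config_dim s"
      using Bs(2) dim_range_mass_row[where m = m and s = s, OF m] by simp
    show "q t $ a \<in> span ?A" if t: "t \<in> {t0..<T}" for t a
    proof -
      obtain y z where yz: "y \<in> span ?A" "\<And>w. w \<in> span ?A \<Longrightarrow> orthogonal z w" "q t $ a = y + z"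
        using orthogonal_subspace_decomp_exists[of ?A "q t $ a"] by metis
      have "\<pi> (G z) = 0"
      proof (intro \<pi>0 ballI)
        fix b assume "b \<in> Bs"
        then have "z \<bullet> adjoint G b = 0" using yz(2)[of "adjoint G b"] by (simp add: orthogonal_def span_base)
        then show "G z \<bullet> b = 0" using adjoint_works[OF linG, of z b] by simp
      qed
      \<comment> \<open>The position is tested against its own component \<open>z\<close> orthogonal
        to the span, so this component must be zero.\<close>
      then have "q t $ a \<bullet> z = 0" by (rule vanish[OF _ t])
      moreover have "y \<bullet> z = 0" using yz(1,2) by (simp add: orthogonal_def inner_commute)
      ultimately have "z = 0" by (simp add: yz(3) inner_add_left)
      then show ?thesis using yz by simp
    qed
  qed simp
qed

lemma subspace_solution_affine:
  fixes q :: "real \<Rightarrow> ('d::finite, 'n::finite) config"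
  assumes "subspace S" "dim S \<le> k" "k \<le> CARD('d)" and "\<And>t a. t \<in> {t0..<T} \<Longrightarrow> q t $ a \<in> S"
  shows "\<exists>P. affine P \<and> aff_dim P = int k \<and> (\<forall>t\<in>{t0..<T}. \<forall>a. q t $ a \<in> P)"
proof -
  obtain S' where "subspace S'" "S \<subseteq> S'" "dim S' = k"
    using extend_subspace[OF assms(1,2)] assms(3) by auto
  then show ?thesis using assms(4) by (intro exI[of _ S']) (auto simp: subspace_imp_affine aff_dim_subspace)
qed

theorem theorem1p1:
  fixes m :: "4 \<Rightarrow> real" and q :: "real \<Rightarrow> (3, 4) config" and s0 :: "(3, 4) config"
    and t0 T :: real
  assumes "\<And>a. m a > 0"
    and "total_collision_solution m t0 T q"
    and "limiting_shape m T q s0"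
  shows "(planar_config s0 \<longrightarrow> planar_solution t0 T q) \<and>
         (collinear_config s0 \<longrightarrow> collinear_solution t0 T q)"
proof -
  note m = assms(1)
  have cc: "normalized_CC m s0" using assms(3) by (simp add: limiting_shape_def)
  then have free: "s0 \<in> collision_free" and cen: "s0 \<in> centered m"
    by (auto simp: normalized_CC_def critical_point_on_def mass_sphere_def)
  note acc = normalized_CC_acceleration[OF m cc]
  have card: "CARD(4) \<ge> 2" by simp
  note L_row = normalized_CC_mass_laplacian[OF m cc]
  have "planar_solution t0 T q" if planar: "planar_config s0"
  proof -
    \<comment> \<open>This is where the number of bodies enters: 2 + 2 = 4, so a planar shape has
      exactly one normal direction besides that of total mass, as Dziobek's argument
      requires.\<close>
    have dim: "dim (range (mass_row m s0)) + 2 = CARD(4)"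
      using planar dim_range_mass_row[where m = m and s = s0, OF m] by (simp add: planar_config_def)
    have "\<exists>S. subspace S \<and> dim S \<le> config_dim s0 \<and> (\<forall>t\<in>{t0..<T}. \<forall>a. q t $ a \<in> S)"
    proof (rule total_collision_confined[OF m card assms(2,3)])
      show "force_function m s0 < \<alpha>"
        if "\<nu> \<noteq> 0" "\<nu> \<bullet> (\<chi> a. sqrt (m a)) = 0" "\<And>c. \<nu> \<bullet> mass_row m s0 c = 0"
          "mass_laplacian m (inverse_cubes s0) \<nu> = \<alpha> *\<^sub>R \<nu>" for \<nu> \<alpha>
        by (rule dziobek_normal_eigenvalue[OF m free force_function_pos[OF m free card] dim L_row
              mass_row_centered[OF m cen] that])
    qed
    then obtain S where S: "subspace S" "dim S \<le> 2" "\<And>t a. t \<in> {t0..<T} \<Longrightarrow> q t $ a \<in> S"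
      using planar unfolding planar_config_def by metis
    have "2 \<le> CARD(3)" by simp
    from subspace_solution_affine[OF S(1,2) this S(3)] show ?thesis
      by (simp add: planar_solution_def)
  qed
  moreover have "collinear_solution t0 T q" if collinear: "collinear_config s0"
  proof -
    have "\<exists>S. subspace S \<and> dim S \<le> config_dim s0 \<and> (\<forall>t\<in>{t0..<T}. \<forall>a. q t $ a \<in> S)"
    proof (rule total_collision_confined[OF m card assms(2,3)])
      show "force_function m s0 < \<alpha>"
        if "\<nu> \<noteq> 0" "\<nu> \<bullet> (\<chi> a. sqrt (m a)) = 0" "\<And>c. \<nu> \<bullet> mass_row m s0 c = 0"
          "mass_laplacian m (inverse_cubes s0) \<nu> = \<alpha> *\<^sub>R \<nu>" for \<nu> \<alpha>
        \<comment> \<open>For a collinear shape of four bodies there are two normal directions, and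
          Conley's cone argument handles them all at once.\<close>
        by (rule collinear_normal_eigenvalue[OF m free card cen acc collinear that])
    qed
    then obtain S where S: "subspace S" "dim S \<le> 1" "\<And>t a. t \<in> {t0..<T} \<Longrightarrow> q t $ a \<in> S"
      using collinear unfolding collinear_config_def by metis
    have "1 \<le> CARD(3)" by simp
    from subspace_solution_affine[OF S(1,2) this S(3)] show ?thesis
      by (simp add: collinear_solution_def)
  qed
  ultimately show ?thesis by blast
qed

end
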